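(* Let $\mathbb{K}$ be an arbitrary field, let $q \in \mathbb{K}^*$ be an element which is not a root of unity, and let $n$ be a positive integer. Then every unipotent automorphism of the algebra of quantum matrices $R_q[M_n]$ is equal to the identity automorphism.
   Context: The algebra of quantum matrices $R_q[M_n]$ is the unital associative $\mathbb{K}$-algebra with generators $x_{kl}$, $1 \leq k, l \leq n$, and relations $$x_{ij} x_{kj} = q\, x_{kj} x_{ij} \quad \text{for } i < k,$$ $$x_{ij} x_{il} = q\, x_{il} x_{ij} \quad \text{for } j < l,$$ $$x_{ij} x_{kl} = x_{kl} x_{ij} \quad \text{for } i < k,\ j > l,$$ $$x_{ij} x_{kl} - x_{kl} x_{ij} = (q-q^{-1})\, x_{il} x_{kj} \quad \text{for } i < k,\ j<l.$$ It is a connected $\mathbb{N}$-graded algebra ($\mathbb{N} = \{0,1,2,\ldots\}$) generated in degree one, by assigning $\deg x_{kl} = 1$ for all $1 \leq k,l \leq n$. For $m \in \mathbb{N}$, $R_q[M_n]^{\geq m}$ denotes the sum of the graded components of $R_q[M_n]$ of degree $\geq m$. A $\mathbb{K}$-algebra automorphism $\Phi$ of $R_q[M_n]$ is called unipotent if $\Phi(x_{kl}) - x_{kl} \in R_q[M_n]^{\geq 2}$ for all $1 \leq k,l \leq n$. *)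

theory Defs
  imports "HOL-Library.Poly_Mapping" "HOL-Algebra.QuotRing" "HOL-Algebra.Module"
begin

section \<open>Free algebras\<close>

text \<open>The free monoid, written additively: finitely supported functions on a type of class
  \<^class>\<open>monoid_add\<close> form the monoid algebra (with convolution as product) in
  \<^theory>\<open>HOL-Library.Poly_Mapping\<close>.\<close>

datatype 'x free_monoid = Word (letters: "'x list")

instantiation free_monoid :: (type) monoid_add
begin
definition "0 = Word []"
definition "u + v = Word (letters u @ letters v)"
instance
  by standard (auto simp: zero_free_monoid_def plus_free_monoid_def)
end

abbreviation word_length :: "'x free_monoid \<Rightarrow> nat" where
  "word_length w \<equiv> length (letters w)"

definition scalar :: "'k \<Rightarrow> ('x free_monoid \<Rightarrow>\<^sub>0 'k::field)" where
  "scalar c = Poly_Mapping.single 0 c"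

definition gen :: "'x \<Rightarrow> ('x free_monoid \<Rightarrow>\<^sub>0 'k::field)" where
  "gen x = Poly_Mapping.single (Word [x]) 1"

text \<open>The free unital associative algebra on the set \<open>X\<close> of generators.\<close>

definition free_algebra :: "'x set \<Rightarrow> ('k::field, 'x free_monoid \<Rightarrow>\<^sub>0 'k) module" where
  "free_algebra X =
    \<lparr>carrier = {p. \<forall>w \<in> Poly_Mapping.keys p. set (letters w) \<subseteq> X},
     mult = (*), one = 1, zero = 0, add = (+), smult = (\<lambda>c p. scalar c * p)\<rparr>"

text \<open>\<open>F Quot I\<close> is only a ring; this adds the induced scalar multiplication.\<close>

definition quot_algebra :: "('k, 'a) module \<Rightarrow> 'a set \<Rightarrow> ('k, 'a set) module" where
  "quot_algebra F I =
    ring.extend (F Quot I) (module.fields (\<lambda>c A. \<Union>a\<in>A. I +>\<^bsub>F\<^esub> (c \<odot>\<^bsub>F\<^esub> a)))"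

text \<open>\<^const>\<open>ring_hom\<close> consists of unital homomorphisms.\<close>

definition algebra_automorphism :: "('k, 'a) module \<Rightarrow> ('a \<Rightarrow> 'a) \<Rightarrow> bool" where
  "algebra_automorphism A \<Phi> \<longleftrightarrow>
    \<Phi> \<in> ring_iso A A \<and> (\<forall>c. \<forall>a\<in>carrier A. \<Phi> (c \<odot>\<^bsub>A\<^esub> a) = c \<odot>\<^bsub>A\<^esub> \<Phi> a)"


section \<open>Quantum matrices\<close>

abbreviation free_mat :: "nat \<Rightarrow> ('k::field, (nat \<times> nat) free_monoid \<Rightarrow>\<^sub>0 'k) module" where
  "free_mat n \<equiv> free_algebra ({1..n} \<times> {1..n})"

text \<open>Each relation \<open>l = r\<close> is recorded as the element \<open>l - r\<close> of the free algebra.\<close>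

definition qmat_rels :: "'k::field \<Rightarrow> nat \<Rightarrow> ((nat \<times> nat) free_monoid \<Rightarrow>\<^sub>0 'k) set" where
  "qmat_rels q n =
     {gen (i,j) * gen (k,j) - scalar q * (gen (k,j) * gen (i,j)) | i j k.
        i \<in> {1..n} \<and> j \<in> {1..n} \<and> k \<in> {1..n} \<and> i < k}
   \<union> {gen (i,j) * gen (i,l) - scalar q * (gen (i,l) * gen (i,j)) | i j l.
        i \<in> {1..n} \<and> j \<in> {1..n} \<and> l \<in> {1..n} \<and> j < l}
   \<union> {gen (i,j) * gen (k,l) - gen (k,l) * gen (i,j) | i j k l.
        i \<in> {1..n} \<and> j \<in> {1..n} \<and> k \<in> {1..n} \<and> l \<in> {1..n} \<and> i < k \<and> j > l}
   \<union> {gen (i,j) * gen (k,l) - gen (k,l) * gen (i,j)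
        - scalar (q - inverse q) * (gen (i,l) * gen (k,j)) | i j k l.
        i \<in> {1..n} \<and> j \<in> {1..n} \<and> k \<in> {1..n} \<and> l \<in> {1..n} \<and> i < k \<and> j < l}"

definition qmat_ideal :: "'k::field \<Rightarrow> nat \<Rightarrow> ((nat \<times> nat) free_monoid \<Rightarrow>\<^sub>0 'k) set" where
  "qmat_ideal q n = Idl\<^bsub>free_mat n\<^esub> (qmat_rels q n)"

definition qmat ::
  "'k::field \<Rightarrow> nat \<Rightarrow> ('k, ((nat \<times> nat) free_monoid \<Rightarrow>\<^sub>0 'k) set) module" where
  "qmat q n = quot_algebra (free_mat n) (qmat_ideal q n)"

definition qmat_proj ::
  "'k::field \<Rightarrow> nat \<Rightarrow> ((nat \<times> nat) free_monoid \<Rightarrow>\<^sub>0 'k) \<Rightarrow> ((nat \<times> nat) free_monoid \<Rightarrow>\<^sub>0 'k) set"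
where
  "qmat_proj q n p = qmat_ideal q n +>\<^bsub>free_mat n\<^esub> p"

definition qmat_gen ::
  "'k::field \<Rightarrow> nat \<Rightarrow> nat \<Rightarrow> nat \<Rightarrow> ((nat \<times> nat) free_monoid \<Rightarrow>\<^sub>0 'k) set" where
  "qmat_gen q n k l = qmat_proj q n (gen (k,l))"

text \<open>The grading with all generators in degree one: the component of degree \<open>d\<close> consists of the
  linear combinations of products of \<open>d\<close> generators.\<close>

definition qmat_component ::
  "'k::field \<Rightarrow> nat \<Rightarrow> nat \<Rightarrow> ((nat \<times> nat) free_monoid \<Rightarrow>\<^sub>0 'k) set set" where
  "qmat_component q n d =
    qmat_proj q n ` {p \<in> carrier (free_mat n). \<forall>w \<in> Poly_Mapping.keys p. word_length w = d}"

definition qmat_ge ::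
  "'k::field \<Rightarrow> nat \<Rightarrow> nat \<Rightarrow> ((nat \<times> nat) free_monoid \<Rightarrow>\<^sub>0 'k) set set" where
  "qmat_ge q n m =
    {\<Oplus>\<^bsub>qmat q n\<^esub>d\<in>D. f d | D f. finite D \<and> D \<subseteq> {m..} \<and> f \<in> (\<Pi> d\<in>D. qmat_component q n d)}"

definition unipotent_automorphism ::
  "'k::field \<Rightarrow> nat \<Rightarrow>
    (((nat \<times> nat) free_monoid \<Rightarrow>\<^sub>0 'k) set \<Rightarrow> ((nat \<times> nat) free_monoid \<Rightarrow>\<^sub>0 'k) set) \<Rightarrow> bool" where
  "unipotent_automorphism q n \<Phi> \<longleftrightarrow>
    algebra_automorphism (qmat q n) \<Phi> \<and>
    (\<forall>k\<in>{1..n}. \<forall>l\<in>{1..n}.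
      \<Phi> (qmat_gen q n k l) \<ominus>\<^bsub>qmat q n\<^esub> qmat_gen q n k l \<in> qmat_ge q n 2)"


section \<open>Well-definedness\<close>

lemma free_algebra_simps [simp]:
  "p \<in> carrier (free_algebra X) \<longleftrightarrow> (\<forall>w \<in> Poly_Mapping.keys p. set (letters w) \<subseteq> X)"
  "mult (free_algebra X) = (*)" "one (free_algebra X) = 1"
  "zero (free_algebra X) = 0" "add (free_algebra X) = (+)"
  "smult (free_algebra X) = (\<lambda>c p. scalar c * p)"
  by (auto simp: free_algebra_def)

lemma free_algebra_mult_closed:
  assumes "p \<in> carrier (free_algebra X)" "p' \<in> carrier (free_algebra X)"
  shows "p * p' \<in> carrier (free_algebra X)"
  using assms keys_mult[of p p'] by (fastforce simp: plus_free_monoid_def)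

lemma free_algebra_add_closed:
  assumes "p \<in> carrier (free_algebra X)" "p' \<in> carrier (free_algebra X)"
  shows "p + p' \<in> carrier (free_algebra X)"
  using assms keys_add[of p p'] by fastforce

lemma free_algebra_diff_closed:
  assumes "p \<in> carrier (free_algebra X)" "p' \<in> carrier (free_algebra X)"
  shows "p - p' \<in> carrier (free_algebra X)"
  using assms keys_diff[of p p'] by fastforce

lemma scalar_closed: "scalar c \<in> carrier (free_algebra X)"
  by (auto simp: scalar_def zero_free_monoid_def)

lemma gen_closed: "x \<in> X \<Longrightarrow> gen x \<in> carrier (free_algebra X)"
  by (auto simp: gen_def)

lemma ring_free_algebra:
  fixes X :: "'x set"
  shows "ring (free_algebra X :: ('k::field, 'x free_monoid \<Rightarrow>\<^sub>0 'k) module)"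
    (is "ring ?F")
proof (rule ringI)
  show "abelian_group ?F"
  proof (rule abelian_groupI)
    fix p :: "'x free_monoid \<Rightarrow>\<^sub>0 'k"
    assume "p \<in> carrier ?F"
    then have "0 - p \<in> carrier ?F"
      by (intro free_algebra_diff_closed) auto
    then show "\<exists>p'\<in>carrier ?F. p' \<oplus>\<^bsub>?F\<^esub> p = \<zero>\<^bsub>?F\<^esub>"
      by (intro bexI[of _ "0 - p"]) auto
  qed (auto simp del: free_algebra_simps(1) intro: free_algebra_add_closed simp: algebra_simps,
       auto)
  show "Group.monoid ?F"
    using scalar_closed[of 1 X]
    by (unfold_locales)
       (auto simp del: free_algebra_simps(1) intro: free_algebra_mult_closed
         simp: mult.assoc scalar_def single_one)
qed (auto simp: algebra_simps)

lemma qmat_rels_closed: "qmat_rels q n \<subseteq> carrier (free_mat n)"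
  unfolding qmat_rels_def
  by (auto simp del: free_algebra_simps(1)
    intro!: free_algebra_diff_closed free_algebra_mult_closed scalar_closed gen_closed)

lemma ideal_qmat_ideal: "ideal (qmat_ideal q n) (free_mat n)"
  unfolding qmat_ideal_def by (rule ring.genideal_ideal[OF ring_free_algebra qmat_rels_closed])

lemma quot_algebra_simps [simp]:
  "carrier (quot_algebra F I) = carrier (F Quot I)"
  "mult (quot_algebra F I) = mult (F Quot I)"
  "one (quot_algebra F I) = one (F Quot I)"
  "zero (quot_algebra F I) = zero (F Quot I)"
  "add (quot_algebra F I) = add (F Quot I)"
  "smult (quot_algebra F I) = (\<lambda>c A. \<Union>a\<in>A. I +>\<^bsub>F\<^esub> (c \<odot>\<^bsub>F\<^esub> a))"
  by (simp_all add: quot_algebra_def ring.defs module.defs)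

lemma ring_quot_algebra:
  assumes "ideal I F"
  shows "ring (quot_algebra F I)"
proof -
  interpret Q: ring "F Quot I"
    by (rule ideal.quotient_is_ring[OF assms])
  show ?thesis
  proof (rule ringI)
    show "abelian_group (quot_algebra F I)"
      by (rule abelian_groupI)
         (use Q.l_neg Q.a_inv_closed in \<open>auto simp: Q.a_ac\<close>)
    show "Group.monoid (quot_algebra F I)"
      by (rule monoidI) (simp_all add: Q.m_assoc)
  qed (simp_all add: Q.l_distr Q.r_distr)
qed

lemma ring_qmat: "ring (qmat q n)"
  unfolding qmat_def by (rule ring_quot_algebra[OF ideal_qmat_ideal])

lemma qmat_smult:
  assumes "p \<in> carrier (free_mat n)"
  shows "c \<odot>\<^bsub>qmat q n\<^esub> qmat_proj q n p = qmat_proj q n (scalar c * p)"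
proof -
  interpret ideal "qmat_ideal q n" "free_mat n" by (rule ideal_qmat_ideal)
  have c: "scalar c \<in> carrier (free_mat n)" by (rule scalar_closed)
  have *: "qmat_ideal q n +>\<^bsub>free_mat n\<^esub> (scalar c * a) = qmat_ideal q n +>\<^bsub>free_mat n\<^esub> (scalar c * p)"
    if a: "a \<in> qmat_ideal q n +>\<^bsub>free_mat n\<^esub> p" for a
  proof -
    obtain i where i: "i \<in> qmat_ideal q n" "a = i + p"
      using a by (auto simp: a_r_coset_def')
    have "scalar c * i \<in> qmat_ideal q n"
      using I_l_closed[OF i(1) c] by simp
    then have "scalar c * a \<in> qmat_ideal q n +>\<^bsub>free_mat n\<^esub> (scalar c * p)"
      by (auto simp: a_r_coset_def' i algebra_simps)
    from a_repr_independence'[OF this] free_algebra_mult_closed[OF c assms]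
    show ?thesis by simp
  qed
  have "p \<in> qmat_ideal q n +>\<^bsub>free_mat n\<^esub> p"
    using a_rcos_self[OF assms] by simp
  then have "(\<Union>a \<in> qmat_ideal q n +>\<^bsub>free_mat n\<^esub> p. qmat_ideal q n +>\<^bsub>free_mat n\<^esub> (scalar c * a))
      = qmat_ideal q n +>\<^bsub>free_mat n\<^esub> (scalar c * p)"
    by (intro SUP_eq_const *) blast+
  then show ?thesis
    by (simp add: qmat_def qmat_proj_def del: One_nat_def)
qed

end

theory Submission
  imports Defs "HOL-Library.Function_Algebras" "HOL-Library.Product_Lexorder"
    "HOL-Library.Multiset" "HOL-Computational_Algebra.Polynomial"
begin

text \<open>The proof compares a unipotent automorphism with its inverse through leading monomials.

  Write \<open>x_p\<close>, \<open>p = (i,j)\<close>, for the generators. Adding one row at a time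
  (\<open>row_extension\<close>) embeds the quantum matrices into a quantum torus: \<open>x_p\<close> becomes
  \<open>M_{e_p}\<close> plus monomials that arise from \<open>e_p\<close> by subtracting boxes
  \<open>e_{ij} + e_{kl} - e_{il} - e_{kj}\<close> with \<open>i < k\<close>, \<open>j < l\<close>. For every additive order in which the boxes
  are positive, the leading monomial of a product of generators is therefore its exponent vector. With
  straightening this shows that the sorted words are a basis, and it makes leading exponents of
  elements available for many orders at once.

  Let \<open>X_p\<close> and \<open>Y_p\<close> be the images of the generators under the automorphism and its inverse, written
  in sorted words. A shift is the difference \<open>s\<close> between the exponent of a word of \<open>X_p\<close> or \<open>Y_p\<close> other
  than \<open>x_p\<close> and \<open>e_p\<close>; its degree is positive. Fix an order and take a shift \<open>s\<close> of maximal slope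
  \<open>s / deg s\<close>. In the order that first compares \<open>v - (deg v / deg s) s\<close> and then the degree, all leading
  exponents \<open>f_p\<close> of the \<open>X_p\<close> lie on the rays \<open>e_p + \<rat> s\<close>, and the defining relations force the \<open>f_p\<close> to
  have the commutation exponents of the \<open>e_p\<close>, as \<open>q\<close> is not a root of unity. If
  \<open>m \<mapsto> \<Sum> m_p f_p\<close> is injective, then no cancellation occurs when the \<open>X_p\<close> are substituted into \<open>Y_p\<close>, and
  \<open>Y_p(X) = x_p\<close> bounds all words of \<open>Y_p\<close>; applying this twice contradicts the existence of \<open>s\<close>. Otherwise \<open>s\<close>
  must be central with an entry \<open>-1\<close> (\<open>extremal_central\<close>). Central exponents are constant on diagonals
  and antiperiodic, so the entry \<open>-1\<close> sits at a corner \<open>(1,n)\<close> or \<open>(n,1)\<close>, and only the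
  corner generator has a leading exponent that moves.

  For \<open>n \<ge> 3\<close> the order can be chosen such that the two boxes at these corners are infinitesimally small; then
  the relation between the four generators of such a box is violated (\<open>no_corner_shift\<close>). For
  \<open>n = 2\<close>, orders beginning with \<open>\<plusminus> (v_{11} - v_{22})\<close> show that all shifts satisfy \<open>s_{11} = s_{22}\<close>, hence
  \<open>X_{11}\<close> divides \<open>x_{11}\<close> and \<open>X_{22}\<close> divides \<open>x_{22}\<close>; comparing degrees, both are fixed, and so are the other two
  generators because \<open>X_{12} X_{21} = x_{12} x_{21}\<close>.\<close>

abbreviation keys :: "('a \<Rightarrow>\<^sub>0 'b::zero) \<Rightarrow> 'a set" where "keys \<equiv> Poly_Mapping.keys"
abbreviation lookup :: "('a \<Rightarrow>\<^sub>0 'b::zero) \<Rightarrow> 'a \<Rightarrow> 'b" where "lookup \<equiv> Poly_Mapping.lookup"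

section \<open>Evaluating noncommutative polynomials\<close>

definition word_val :: "('x \<Rightarrow> 'r::monoid_mult) \<Rightarrow> 'x free_monoid \<Rightarrow> 'r" where
  "word_val X w = prod_list (map X (letters w))"

lemma word_val_0 [simp]: "word_val X 0 = 1"
  by (simp add: word_val_def zero_free_monoid_def)

lemma word_val_add: "word_val X (u + v) = word_val X u * word_val X v"
  by (simp add: word_val_def plus_free_monoid_def)

lemma word_val_Word_Cons: "word_val X (Word (x # xs)) = X x * word_val X (Word xs)"
  by (simp add: word_val_def)

definition eval :: "('k::field \<Rightarrow> 'r::ring_1) \<Rightarrow> ('x \<Rightarrow> 'r) \<Rightarrow> ('x free_monoid \<Rightarrow>\<^sub>0 'k) \<Rightarrow> 'r"
  where "eval s X p = (\<Sum>w\<in>keys p. s (lookup p w) * word_val X w)"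

text \<open>Scalars act through a central homomorphism \<open>s\<close>; the free algebra itself (\<^const>\<open>scalar\<close>) and the
  operator algebra (\<open>scal\<close>) are instances, so one evaluation map covers both.\<close>

locale scalars =
  fixes s :: "'k::field \<Rightarrow> 'r::ring_1"
  assumes s_add: "s (a + b) = s a + s b"
    and s_mult: "s (a * b) = s a * s b"
    and s_1 [simp]: "s 1 = 1"
    and s_central: "s a * x = x * s a"
begin

lemma s_0 [simp]: "s 0 = 0"
  using s_add[of 0 0] by simp

lemma s_minus: "s (- a) = - s a"
  using s_add[of a "- a"] by (simp add: eq_neg_iff_add_eq_0 add.commute)

lemma s_diff: "s (a - b) = s a - s b"
  using s_add[of a "- b"] by (simp add: s_minus)

lemma eval_superset:
  assumes "finite A" "keys p \<subseteq> A"
  shows "eval s X p = (\<Sum>w\<in>A. s (lookup p w) * word_val X w)"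
  unfolding eval_def using assms
  by (intro sum.mono_neutral_left) (auto simp: not_in_keys_iff_lookup_eq_zero)

lemma eval_0 [simp]: "eval s X 0 = 0"
  by (simp add: eval_def)

lemma eval_single: "eval s X (Poly_Mapping.single w c) = s c * word_val X w"
  by (simp add: eval_def)

lemma eval_add: "eval s X (p + p') = eval s X p + eval s X p'"
proof -
  let ?A = "keys p \<union> keys p'"
  have "eval s X (p + p') = (\<Sum>w\<in>?A. s (lookup (p + p') w) * word_val X w)"
    by (rule eval_superset) (use keys_add[of p p'] in auto)
  also have "\<dots> = (\<Sum>w\<in>?A. s (lookup p w) * word_val X w)
      + (\<Sum>w\<in>?A. s (lookup p' w) * word_val X w)"
    by (simp add: lookup_add s_add distrib_right sum.distrib)
  also have "\<dots> = eval s X p + eval s X p'"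
    by (subst (1 2) eval_superset[symmetric]) auto
  finally show ?thesis .
qed

lemma eval_minus: "eval s X (- p) = - eval s X p"
  using eval_add[of X p "- p"] by (simp add: eq_neg_iff_add_eq_0 add.commute)

lemma eval_diff: "eval s X (p - p') = eval s X p - eval s X p'"
  using eval_add[of X p "- p'"] by (simp add: eval_minus)

lemma eval_sum: "eval s X (\<Sum>i\<in>A. f i) = (\<Sum>i\<in>A. eval s X (f i))"
  by (induction A rule: infinite_finite_induct) (auto simp: eval_add)

end

lemma poly_mapping_eq_sum:
  "(\<Sum>w\<in>keys p. Poly_Mapping.single w (lookup p w)) = p"
  by (rule poly_mapping_eqI)
     (simp add: lookup_sum lookup_single when_def not_in_keys_iff_lookup_eq_zero)

lemma free_algebra_induct [case_names add single]:
  assumes add: "\<And>p p'. P p \<Longrightarrow> P p' \<Longrightarrow> P (p + p')"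
    and single: "\<And>w c. P (Poly_Mapping.single w (c::'k::field))"
  shows "P p"
proof -
  have "P (\<Sum>w\<in>A. Poly_Mapping.single w (lookup p w))" if "finite A" for A
    using that
  proof (induction A)
    case empty
    show ?case using single[of _ 0] by simp
  qed (auto intro: add single)
  from this[OF finite_keys, of p] show ?thesis by (simp only: poly_mapping_eq_sum)
qed

context scalars
begin

lemma eval_mult: "eval s X (p * p') = eval s X p * eval s X p'"
proof (induction p rule: free_algebra_induct)
  case (add p1 p2)
  then show ?case by (simp add: distrib_right eval_add)
next
  case (single w c)
  note w = this
  show ?case
  proof (induction p' rule: free_algebra_induct)
    case (add p1 p2)
    then show ?case by (simp add: distrib_left eval_add)
  next
    case (single w' c')
    have "s c * s c' * (word_val X w * word_val X w') = s c * word_val X w * (s c' * word_val X w')"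
      by (metis mult.assoc s_central)
    then show ?case by (simp add: mult_single eval_single word_val_add s_mult)
  qed
qed

lemma eval_1 [simp]: "eval s X 1 = 1"
  using eval_single[of X 0 1] by (simp add: single_one)

lemma eval_scalar [simp]: "eval s X (scalar c) = s c"
  by (simp add: scalar_def eval_single)

lemma eval_gen [simp]: "eval s X (gen x) = X x"
  by (simp add: gen_def eval_single word_val_def)

end

interpretation free_scalars: scalars "scalar :: 'k::field \<Rightarrow> ('x free_monoid \<Rightarrow>\<^sub>0 'k)"
proof
  fix a b :: 'k and x :: "'x free_monoid \<Rightarrow>\<^sub>0 'k"
  show "scalar (a + b) = scalar a + scalar b"
    by (simp add: scalar_def single_add)
  show "scalar (a * b) = scalar a * scalar b"
    by (simp add: scalar_def mult_single)
  show "scalar 1 = 1"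
    by (simp add: scalar_def)
  show "scalar a * x = x * scalar a"
    by (induction x rule: free_algebra_induct)
       (simp_all add: scalar_def mult_single distrib_left distrib_right mult.commute)
qed

text \<open>Composing endomorphisms of the free algebra with homomorphisms to the torus amounts to substituting
  images, which is how relations and inverses are transported.\<close>

lemma eval_eval:
  assumes "scalars s"
  shows "eval s X (eval scalar P p) = eval s (\<lambda>x. eval s X (P x)) p"
proof -
  interpret scalars s by (rule assms)
  have w: "eval s X (word_val P w) = word_val (\<lambda>x. eval s X (P x)) w" for w
  proof -
    have "eval s X (prod_list (map P xs)) = prod_list (map (\<lambda>x. eval s X (P x)) xs)" for xs
      by (induction xs) (auto simp: eval_mult)
    then show ?thesis by (simp add: word_val_def)
  qed
  show ?thesis
    by (induction p rule: free_algebra_induct)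
       (simp_all add: eval_add eval_mult eval_single free_scalars.eval_add
         free_scalars.eval_single w)
qed


section \<open>Quantum tori as algebras of operators\<close>

type_synonym expo = "nat \<times> nat \<Rightarrow> int"

text \<open>The quantum torus is realised inside the linear operators on functions of the exponents. Associativity
  is then composition of maps, and \<open>q\<close> stays a parameter of the monomials instead of the type.\<close>

typedef (overloaded) 'k lin_op =
  "{f :: (expo \<Rightarrow> 'k::field) \<Rightarrow> (expo \<Rightarrow> 'k).
     (\<forall>u v. f (u + v) = f u + f v) \<and> (\<forall>c u. f (\<lambda>v. c * u v) = (\<lambda>v. c * f u v))}"
  by (rule exI[of _ id]) simp

setup_lifting type_definition_lin_op

instantiation lin_op :: (field) ring_1
begin

lift_definition zero_lin_op :: "'a lin_op" is "\<lambda>u. 0" by (simp add: fun_eq_iff)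
lift_definition one_lin_op :: "'a lin_op" is "\<lambda>u. u" by simp
lift_definition plus_lin_op :: "'a lin_op \<Rightarrow> 'a lin_op \<Rightarrow> 'a lin_op" is "\<lambda>f g u. f u + g u"
  by (simp add: algebra_simps fun_eq_iff)
lift_definition uminus_lin_op :: "'a lin_op \<Rightarrow> 'a lin_op" is "\<lambda>f u. - f u"
  by (simp add: algebra_simps fun_eq_iff)
lift_definition minus_lin_op :: "'a lin_op \<Rightarrow> 'a lin_op \<Rightarrow> 'a lin_op" is "\<lambda>f g u. f u - g u"
  by (simp add: algebra_simps fun_eq_iff)
lift_definition times_lin_op :: "'a lin_op \<Rightarrow> 'a lin_op \<Rightarrow> 'a lin_op" is "\<lambda>f g u. f (g u)"
  by simp

instance
proof
  show "(0::'a lin_op) \<noteq> 1"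
  proof (transfer, rule notI)
    assume "(\<lambda>u. 0) = (\<lambda>u::expo \<Rightarrow> 'a. u)"
    from fun_cong[OF this, of 1] show False by (simp add: fun_eq_iff)
  qed
qed (transfer; simp add: algebra_simps fun_eq_iff)+

end

lift_definition scal :: "'k::field \<Rightarrow> 'k lin_op" is "\<lambda>c u v. c * u v"
  by (simp add: fun_eq_iff algebra_simps)

text \<open>A monomial of the torus maps the indicator function of \<open>0\<close> to that of its exponent, so coefficients can be read off
  from this single image.\<close>

lift_definition coef :: "'k::field lin_op \<Rightarrow> expo \<Rightarrow> 'k" is
  "\<lambda>f a. f (\<lambda>v. if v = 0 then 1 else 0) a" .

lemma coef_add [simp]: "coef (f + g) a = coef f a + coef g a"
  by transfer simp

lemma coef_diff [simp]: "coef (f - g) a = coef f a - coef g a"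
  by transfer simp

lemma coef_0 [simp]: "coef 0 a = 0"
  by transfer simp

lemma coef_scal_mult [simp]: "coef (scal c * f) a = c * coef f a"
  by transfer simp

definition grid :: "nat \<Rightarrow> (nat \<times> nat) set" where
  "grid n = {1..n} \<times> {1..n}"

lemma finite_grid [simp]: "finite (grid n)"
  by (simp add: grid_def)

text \<open>The relation between two distinct positions in the same row or in the same column, which are the pairs
  of torus generators that do not commute.\<close>

definition precedes :: "nat \<times> nat \<Rightarrow> nat \<times> nat \<Rightarrow> bool" where
  "precedes p r \<longleftrightarrow> fst p = fst r \<and> snd p < snd r \<or> snd p = snd r \<and> fst p < fst r"

definition twist :: "nat \<Rightarrow> expo \<Rightarrow> expo \<Rightarrow> int" where
  "twist n a b = (\<Sum>p\<in>grid n. \<Sum>r\<in>grid n. if precedes p r then a p * b r else 0)"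

lemma twist_add_left: "twist n (a + b) c = twist n a c + twist n b c"
  unfolding twist_def sum.distrib[symmetric]
  by (intro sum.cong) (auto simp: algebra_simps)

lemma twist_add_right: "twist n a (b + c) = twist n a b + twist n a c"
  unfolding twist_def sum.distrib[symmetric]
  by (intro sum.cong) (auto simp: algebra_simps)

lemma twist_0 [simp]: "twist n 0 c = 0" "twist n c 0 = 0"
  by (simp_all add: twist_def zero_fun_def cong: if_cong)

text \<open>The skew form of the torus: monomials satisfy
  \<open>M_a M_b = q^(comm_exp a b) M_b M_a\<close>.\<close>

definition comm_exp :: "nat \<Rightarrow> expo \<Rightarrow> expo \<Rightarrow> int" where
  "comm_exp n a b = twist n a b - twist n b a"

lift_definition monomial :: "'k::field \<Rightarrow> nat \<Rightarrow> expo \<Rightarrow> 'k lin_op" is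
  "\<lambda>q n a u v. q powi (twist n a (v - a)) * u (v - a)"
  by (auto simp: fun_eq_iff algebra_simps)

lemma mono_mult:
  assumes "q \<noteq> 0"
  shows "monomial q n a * monomial q n b = scal (q powi twist n a b) * monomial q n (a + b)"
proof (transfer fixing: q n a b, rule ext, rule ext)
  fix u :: "expo \<Rightarrow> 'a" and v :: expo
  have 1: "twist n a (v - a) = twist n a (v - (a + b)) + twist n a b"
    by (subst twist_add_right[symmetric]) (simp add: algebra_simps)
  have 2: "twist n (a + b) (v - (a + b)) = twist n a (v - (a + b)) + twist n b (v - (a + b))"
    by (rule twist_add_left)
  have 3: "v - a - b = v - (a + b)" by (simp add: algebra_simps)
  show "q powi twist n a (v - a) * (q powi twist n b (v - a - b) * u (v - a - b)) =
    q powi twist n a b * (q powi twist n (a + b) (v - (a + b)) * u (v - (a + b)))"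
    unfolding 1 2 3 by (simp add: power_int_add assms)
qed

lemma mono_0 [simp]: "monomial q n 0 = 1"
  by transfer simp

lemma coef_mono: "coef (monomial q n a) b = (if b = a then 1 else 0)"
  by transfer (auto simp: right_minus_eq)

interpretation op_scalars: scalars scal
proof
  fix a b :: "'k::field" and x :: "'k lin_op"
  show "scal (a + b) = scal a + scal b"
    by transfer (auto simp: fun_eq_iff algebra_simps)
  show "scal (a * b) = scal a * scal b"
    by transfer (auto simp: fun_eq_iff algebra_simps)
  show "scal 1 = (1 :: 'k lin_op)"
    by transfer (auto simp: fun_eq_iff algebra_simps)
  show "scal a * x = x * scal a"
    by transfer (auto simp: fun_eq_iff algebra_simps)
qed


section \<open>Adding a row to a quantum matrix\<close>

context scalars
begin

definition smul :: "'k \<Rightarrow> 'r \<Rightarrow> 'r" (infixr "\<bullet>" 75) where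
  "c \<bullet> x = s c * x"

lemma smul_simps [simp]:
  "(c \<bullet> x) * y = c \<bullet> (x * y)" "x * (c \<bullet> y) = c \<bullet> (x * y)" "c \<bullet> d \<bullet> x = (c * d) \<bullet> x"
  "1 \<bullet> x = x" "0 \<bullet> x = 0" "c \<bullet> 0 = 0"
proof -
  show "x * (c \<bullet> y) = c \<bullet> (x * y)"
    unfolding smul_def mult.assoc[symmetric] s_central[of c x] ..
qed (simp_all add: smul_def s_mult mult.assoc)

lemma s_left_commute: "x * (s c * y) = s c * (x * y)"
  using smul_simps(2)[of x c y] by (simp only: smul_def)

lemma smul_add: "c \<bullet> (x + y) = c \<bullet> x + c \<bullet> y"
  by (simp add: smul_def distrib_left)

lemma diff_smul: "(c - d) \<bullet> x = c \<bullet> x - d \<bullet> x"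
  by (simp add: smul_def left_diff_distrib s_diff)

lemma smul_sum: "c \<bullet> (\<Sum>i\<in>A. f i) = (\<Sum>i\<in>A. c \<bullet> f i)"
  by (simp add: smul_def sum_distrib_left)

text \<open>Proportionality of \<open>x y\<close> and \<open>y x\<close>. The factors multiply under products and are inverted under inverses,
  so that most relations of the extended matrix reduce to bookkeeping.\<close>

definition qcomm :: "'k \<Rightarrow> 'r \<Rightarrow> 'r \<Rightarrow> bool" where
  "qcomm c x y \<longleftrightarrow> x * y = c \<bullet> (y * x)"

lemma qcomm_mult_right:
  assumes "qcomm c x y" "qcomm d x z"
  shows "qcomm (c * d) x (y * z)"
proof -
  have "x * (y * z) = x * y * z" by (simp add: mult.assoc)
  also have "\<dots> = c \<bullet> (y * (x * z))" using assms(1) by (simp add: qcomm_def mult.assoc)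
  also have "\<dots> = (c * d) \<bullet> (y * z * x)" using assms(2) by (simp add: qcomm_def mult.assoc)
  finally show ?thesis by (simp add: qcomm_def)
qed

lemma qcomm_mult_left:
  assumes "qcomm c x z" "qcomm d y z"
  shows "qcomm (c * d) (x * y) z"
proof -
  have "x * y * z = x * (y * z)" by (simp add: mult.assoc)
  also have "\<dots> = d \<bullet> (x * z * y)" using assms(2) by (simp add: qcomm_def mult.assoc)
  also have "\<dots> = (c * d) \<bullet> (z * (x * y))"
    using assms(1) by (simp add: qcomm_def mult.assoc mult.commute)
  finally show ?thesis by (simp add: qcomm_def)
qed

lemma qcomm_swap:
  assumes "qcomm c x y" "c \<noteq> 0"
  shows "qcomm (1 / c) y x"
  using assms by (simp add: qcomm_def)

lemma qcomm_inverse_right: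
  assumes "qcomm c x y" "c \<noteq> 0" "y * z = 1" "z * y = 1"
  shows "qcomm (1 / c) x z"
proof -
  have "z * (x * y) * z = c \<bullet> (z * (y * x) * z)"
    using assms(1) by (simp add: qcomm_def)
  moreover have "z * (x * y) * z = z * x"
    by (simp add: mult.assoc assms(3))
  moreover have "z * (y * x) * z = x * z"
    by (simp add: mult.assoc[symmetric] assms(4))
  ultimately show ?thesis using assms(2) by (simp add: qcomm_def)
qed

lemma qcomm_inverse_left:
  assumes "qcomm c x y" "c \<noteq> 0" "x * z = 1" "z * x = 1"
  shows "qcomm (1 / c) z y"
  using qcomm_swap[OF qcomm_inverse_right[OF qcomm_swap[OF assms(1,2)] _ assms(3,4)]] assms(2)
  by simp

lemma qcomm_sum_left:
  assumes "\<And>i. i \<in> A \<Longrightarrow> qcomm c (f i) y"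
  shows "qcomm c (\<Sum>i\<in>A. f i) y"
  using assms unfolding qcomm_def
  by (simp add: sum_distrib_right sum_distrib_left smul_sum)

lemma qcomm_sum_right:
  assumes "\<And>i. i \<in> A \<Longrightarrow> qcomm c x (f i)"
  shows "qcomm c x (\<Sum>i\<in>A. f i)"
  using assms unfolding qcomm_def
  by (simp add: sum_distrib_right sum_distrib_left smul_sum)

lemma qcomm_self [simp]: "qcomm 1 x x"
  by (simp add: qcomm_def)

lemma qcomm_eq: "qcomm c x y \<Longrightarrow> c = d \<Longrightarrow> qcomm d x y"
  by simp

lemma qcomm_mult:
  assumes "qcomm a x z" "qcomm b x w" "qcomm c y z" "qcomm d y w"
  shows "qcomm (a * b * (c * d)) (x * y) (z * w)"
  by (intro qcomm_mult_left qcomm_mult_right assms)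

definition qmatrix :: "'k \<Rightarrow> nat \<Rightarrow> nat \<Rightarrow> (nat \<times> nat \<Rightarrow> 'r) \<Rightarrow> bool" where
  "qmatrix q r n X \<longleftrightarrow>
    (\<forall>i\<in>{1..r}. \<forall>k\<in>{1..r}. \<forall>j\<in>{1..n}. i < k \<longrightarrow> qcomm q (X (i,j)) (X (k,j))) \<and>
    (\<forall>i\<in>{1..r}. \<forall>j\<in>{1..n}. \<forall>l\<in>{1..n}. j < l \<longrightarrow> qcomm q (X (i,j)) (X (i,l))) \<and>
    (\<forall>i\<in>{1..r}. \<forall>k\<in>{1..r}. \<forall>j\<in>{1..n}. \<forall>l\<in>{1..n}. i < k \<longrightarrow> l < j \<longrightarrow>
       qcomm 1 (X (i,j)) (X (k,l))) \<and>
    (\<forall>i\<in>{1..r}. \<forall>k\<in>{1..r}. \<forall>j\<in>{1..n}. \<forall>l\<in>{1..n}. i < k \<longrightarrow> j < l \<longrightarrow>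
       X (i,j) * X (k,l) - X (k,l) * X (i,j) = (q - 1 / q) \<bullet> (X (i,l) * X (k,j)))"

lemma qmatrixD:
  assumes "qmatrix q r n X" "i \<in> {1..r}" "j \<in> {1..n}"
  shows "k \<in> {1..r} \<Longrightarrow> i < k \<Longrightarrow> qcomm q (X (i,j)) (X (k,j))"
    and "l \<in> {1..n} \<Longrightarrow> j < l \<Longrightarrow> qcomm q (X (i,j)) (X (i,l))"
    and "k \<in> {1..r} \<Longrightarrow> l \<in> {1..n} \<Longrightarrow> i < k \<Longrightarrow> l < j \<Longrightarrow> qcomm 1 (X (i,j)) (X (k,l))"
    and "k \<in> {1..r} \<Longrightarrow> l \<in> {1..n} \<Longrightarrow> i < k \<Longrightarrow> j < l \<Longrightarrow>
      X (i,j) * X (k,l) - X (k,l) * X (i,j) = (q - 1 / q) \<bullet> (X (i,l) * X (k,j))"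
  using assms by (simp_all add: qmatrix_def del: atLeastAtMost_iff)

end

text \<open>A step of the deleting derivations procedure, read backwards. Given a quantum matrix \<open>Y\<close> with \<open>k\<close> rows and a
  new row of invertible \<open>t j\<close> that \<open>q\<close>-commutes with the columns of \<open>Y\<close>, the matrix with last row \<open>t\<close> and the
  entries \<open>\<Sum>l\<ge>j. Y (i,l) (t l)\<inverse> t j\<close> above it is again a quantum matrix.\<close>

locale row_extension = scalars s
  for s :: "'k::field \<Rightarrow> 'r::ring_1" +
  fixes q :: 'k and k n :: nat and Y :: "nat \<times> nat \<Rightarrow> 'r" and t u :: "nat \<Rightarrow> 'r"
  assumes q: "q \<noteq> 0"
    and Y: "qmatrix q k n Y"
    and tu: "\<And>j. j \<in> {1..n} \<Longrightarrow> t j * u j = 1" "\<And>j. j \<in> {1..n} \<Longrightarrow> u j * t j = 1"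
    and tt: "\<And>j l. j \<in> {1..n} \<Longrightarrow> l \<in> {1..n} \<Longrightarrow> j < l \<Longrightarrow> qcomm q (t j) (t l)"
    and Yt: "\<And>i j l. i \<in> {1..k} \<Longrightarrow> j \<in> {1..n} \<Longrightarrow> l \<in> {1..n} \<Longrightarrow>
      qcomm (if j = l then q else 1) (Y (i,j)) (t l)"
begin

definition w :: "nat \<Rightarrow> nat \<Rightarrow> 'r" where "w i l = Y (i,l) * u l"
definition W :: "nat \<Rightarrow> nat \<Rightarrow> 'r" where "W i j = (\<Sum>l\<in>{j..n}. w i l)"
definition V :: "nat \<Rightarrow> nat \<Rightarrow> nat \<Rightarrow> 'r" where "V i j l = (\<Sum>m\<in>{j..<l}. w i m)"

definition X :: "nat \<times> nat \<Rightarrow> 'r" where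
  "X p = (if fst p = Suc k then t (snd p) else W (fst p) (snd p) * t (snd p))"

text \<open>With the common factor \<open>t j\<close> split off, the entries of a row are tails \<open>W\<close> of one sequence. For two columns
  \<open>j < l\<close>, the tail from \<open>j\<close> is the tail from \<open>l\<close> plus the segment \<open>V\<close>, and segment, tail and \<open>t\<close> commute up to
  powers of \<open>q\<close> except in the diagonal relation.\<close>

lemma W_split: "j \<le> l \<Longrightarrow> l \<le> n \<Longrightarrow> W i j = V i j l + W i l"
  unfolding W_def V_def
  by (subst sum.union_disjoint[symmetric]) (auto intro!: sum.cong)

lemma uu: "j \<in> {1..n} \<Longrightarrow> l \<in> {1..n} \<Longrightarrow> j < l \<Longrightarrow> qcomm q (u j) (u l)"
  using qcomm_inverse_left[OF qcomm_inverse_right[OF tt[of j l] _ tu(1)[of l] tu(2)[of l]]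
    _ tu(1)[of j] tu(2)[of j]] q by simp

lemma uu': "j \<in> {1..n} \<Longrightarrow> l \<in> {1..n} \<Longrightarrow> j < l \<Longrightarrow> qcomm (1/q) (u l) (u j)"
  using qcomm_swap[OF uu] q by simp

lemma Yu: "i \<in> {1..k} \<Longrightarrow> j \<in> {1..n} \<Longrightarrow> l \<in> {1..n} \<Longrightarrow>
      qcomm (if j = l then 1/q else 1) (Y (i,j)) (u l)"
  using qcomm_inverse_right[OF Yt _ tu, of i j l] q by (auto split: if_splits)

lemma uY: "i \<in> {1..k} \<Longrightarrow> j \<in> {1..n} \<Longrightarrow> l \<in> {1..n} \<Longrightarrow>
      qcomm (if j = l then q else 1) (u l) (Y (i,j))"
  using qcomm_swap[OF Yu, of i j l] q by (auto split: if_splits)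

lemma ut: "j \<in> {1..n} \<Longrightarrow> l \<in> {1..n} \<Longrightarrow> j < l \<Longrightarrow> qcomm (1/q) (u j) (t l)"
  using qcomm_inverse_left[OF tt _ tu, of j l] q by simp

lemma ut': "j \<in> {1..n} \<Longrightarrow> l \<in> {1..n} \<Longrightarrow> j < l \<Longrightarrow> qcomm q (u l) (t j)"
  using qcomm_swap[OF qcomm_inverse_right[OF tt _ tu, of j l]] q by simp

lemma wt: 
  assumes "i \<in> {1..k}" "l \<in> {1..n}" "j \<in> {1..n}"
  shows "qcomm (if l < j then 1/q else q) (w i l) (t j)"
proof -
  consider "l < j" | "l = j" | "l > j" by linarith
  then show ?thesis
  proof cases
    case 1
    then show ?thesis unfolding w_def
      using qcomm_mult_left[OF Yt[OF assms] ut[of l j]] assms by simp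
  next
    case 2
    then have "qcomm 1 (u l) (t l)" using tu[of l] assms by (simp add: qcomm_def)
    from qcomm_mult_left[OF Yt[OF assms(1,2,2)] this] 2
    show ?thesis unfolding w_def by simp
  next
    case 3
    then show ?thesis unfolding w_def
      using qcomm_mult_left[OF Yt[OF assms] ut'[of j l]] assms by simp
  qed
qed

lemma Wt: "i \<in> {1..k} \<Longrightarrow> m \<in> {1..n} \<Longrightarrow> m \<le> j \<Longrightarrow> qcomm q (W i j) (t m)"
  unfolding W_def
  by (rule qcomm_sum_left, rule qcomm_eq[OF wt]) auto

lemma tW: "i \<in> {1..k} \<Longrightarrow> m \<in> {1..n} \<Longrightarrow> m \<le> j \<Longrightarrow> qcomm (1/q) (t m) (W i j)"
  using qcomm_swap[OF Wt] q by blast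

lemma Vt: "i \<in> {1..k} \<Longrightarrow> 1 \<le> j \<Longrightarrow> l \<in> {1..n} \<Longrightarrow> qcomm (1/q) (V i j l) (t l)"
  unfolding V_def
  by (rule qcomm_sum_left, rule qcomm_eq[OF wt]) auto

lemma tV: "i \<in> {1..k} \<Longrightarrow> 1 \<le> j \<Longrightarrow> l \<in> {1..n} \<Longrightarrow> qcomm q (t l) (V i j l)"
  using qcomm_swap[OF Vt] q by fastforce

lemma ww_row:
  assumes "i \<in> {1..k}" "j \<in> {1..n}" "l \<in> {1..n}" "j < l"
  shows "qcomm (q * q) (w i j) (w i l)"
  unfolding w_def
  by (rule qcomm_eq[OF qcomm_mult[OF qmatrixD(2)[OF Y] Yu uY uu]]) (use assms q in auto)

lemma ww_col:
  assumes "i \<in> {1..k}" "m \<in> {1..k}" "j \<in> {1..n}" "i < m"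
  shows "qcomm q (w i j) (w m j)"
  unfolding w_def
  by (rule qcomm_eq[OF qcomm_mult[OF qmatrixD(1)[OF Y] Yu uY qcomm_self]]) (use assms q in auto)

lemma ww_anti:
  assumes "i \<in> {1..k}" "m \<in> {1..k}" "j \<in> {1..n}" "l \<in> {1..n}" "i < m" "l < j"
  shows "qcomm (1/q) (w i j) (w m l)"
  unfolding w_def
  by (rule qcomm_eq[OF qcomm_mult[OF qmatrixD(3)[OF Y] Yu uY uu']]) (use assms q in auto)

lemma ww_diag:
  assumes "i \<in> {1..k}" "m \<in> {1..k}" "j \<in> {1..n}" "l \<in> {1..n}" "i < m" "j < l"
  shows "w i j * w m l = q \<bullet> (w m l * w i j) + (q * q - 1) \<bullet> (w i l * w m j)"
proof -
  have comm: "u j * Y (m,l) = Y (m,l) * u j" "u l * Y (i,j) = Y (i,j) * u l"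
     "u l * Y (m,j) = Y (m,j) * u l"
    using uY[of m l j] uY[of i j l] uY[of m j l] assms by (auto simp: qcomm_def)
  have uul: "u j * u l = q \<bullet> (u l * u j)"
    using uu[of j l] assms by (auto simp: qcomm_def)
  have Yd: "Y (i,j) * Y (m,l) = Y (m,l) * Y (i,j) + (q - 1 / q) \<bullet> (Y (i,l) * Y (m,j))"
    using qmatrixD(4)[OF Y, of i j m l] assms by (simp add: algebra_simps)
  have "w i j * w m l = Y (i,j) * (u j * Y (m,l)) * u l"
    by (simp add: w_def mult.assoc)
  also have "\<dots> = Y (i,j) * Y (m,l) * (u j * u l)"
    by (simp add: comm mult.assoc)
  also have "\<dots> = q \<bullet> (Y (m,l) * Y (i,j) * (u l * u j))
      + (q * (q - 1 / q)) \<bullet> (Y (i,l) * Y (m,j) * (u l * u j))"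
    by (simp add: uul Yd distrib_right smul_add)
  also have "q * (q - 1 / q) = q * q - 1"
    using q by (simp add: field_simps)
  also have "Y (m,l) * Y (i,j) * (u l * u j) = Y (m,l) * (u l * Y (i,j)) * u j"
    by (simp add: comm mult.assoc)
  also have "Y (i,l) * Y (m,j) * (u l * u j) = Y (i,l) * (u l * Y (m,j)) * u j"
    by (simp add: comm mult.assoc)
  finally show ?thesis by (simp add: w_def mult.assoc)
qed

lemma VW_row:
  assumes "i \<in> {1..k}" "1 \<le> j" "l \<in> {1..n}"
  shows "qcomm (q * q) (V i j l) (W i l)"
  unfolding V_def W_def
  by (intro qcomm_sum_left qcomm_sum_right ww_row) (use assms in auto)

lemma WV_anti:
  assumes "i \<in> {1..k}" "m \<in> {1..k}" "1 \<le> l" "j \<in> {1..n}" "i < m"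
  shows "qcomm (1/q) (W i j) (V m l j)"
  unfolding V_def W_def
  by (intro qcomm_sum_left qcomm_sum_right ww_anti) (use assms in auto)

lemma VW_diag:
  assumes "i \<in> {1..k}" "m \<in> {1..k}" "1 \<le> j" "l \<in> {1..n}" "i < m"
  shows "V i j l * W m l = q \<bullet> (W m l * V i j l) + (q * q - 1) \<bullet> (W i l * V m j l)"
proof -
  have "V i j l * W m l = (\<Sum>a\<in>{j..<l}. \<Sum>b\<in>{l..n}. w i a * w m b)"
    by (simp add: V_def W_def sum_product)
  also have "\<dots> = (\<Sum>a\<in>{j..<l}. \<Sum>b\<in>{l..n}.
      q \<bullet> (w m b * w i a) + (q * q - 1) \<bullet> (w i b * w m a))"
    by (intro sum.cong refl ww_diag) (use assms in auto)
  also have "\<dots> = q \<bullet> (\<Sum>a\<in>{j..<l}. \<Sum>b\<in>{l..n}. w m b * w i a)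
      + (q * q - 1) \<bullet> (\<Sum>a\<in>{j..<l}. \<Sum>b\<in>{l..n}. w i b * w m a)"
    by (simp add: sum.distrib smul_sum)
  also have "(\<Sum>a\<in>{j..<l}. \<Sum>b\<in>{l..n}. w m b * w i a) = W m l * V i j l"
    unfolding V_def W_def sum_product by (rule sum.swap)
  also have "(\<Sum>a\<in>{j..<l}. \<Sum>b\<in>{l..n}. w i b * w m a) = W i l * V m j l"
    unfolding V_def W_def sum_product by (rule sum.swap)
  finally show ?thesis .
qed

text \<open>Each pair of columns contributes \<open>q\<inverse>\<close> from one order and \<open>q\<^sup>2 - 1\<close> times \<open>q\<inverse>\<close> from the correction term of the
  other, which add up to \<open>q\<close>; the induction peels off one column.\<close>

lemma WW_col:
  assumes "i \<in> {1..k}" "m \<in> {1..k}" "i < m" "j \<in> {1..n}"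
  shows "qcomm q (W i j) (W m j)"
  using assms(4)
proof (induction "n - j" arbitrary: j)
  case 0
  then have "W i j = w i j" "W m j = w m j" by (auto simp: W_def)
  then show ?case using ww_col[of i m j] assms 0 by simp
next
  case (Suc d)
  have j: "j \<le> Suc j" "Suc j \<in> {1..n}" using Suc by auto
  have IH: "W i (Suc j) * W m (Suc j) = q \<bullet> (W m (Suc j) * W i (Suc j))"
    using Suc(1)[of "Suc j"] Suc(2,3) j by (simp add: qcomm_def)
  have V: "V i j (Suc j) = w i j" "V m j (Suc j) = w m j" by (simp_all add: V_def)
  have W: "W i j = w i j + W i (Suc j)" "W m j = w m j + W m (Suc j)"
    using W_split[of j "Suc j" i] W_split[of j "Suc j" m] j V by auto
  have 1: "w i j * w m j = q \<bullet> (w m j * w i j)"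
    using ww_col[of i m j] assms Suc by (simp add: qcomm_def)
  have 2: "w m j * W i (Suc j) = q \<bullet> (W i (Suc j) * w m j)"
    using qcomm_swap[OF WV_anti[of i m j "Suc j"]] assms Suc j q by (simp add: V qcomm_def)
  have 3: "w i j * W m (Suc j) = q \<bullet> (W m (Suc j) * w i j)
      + ((q * q) \<bullet> (W i (Suc j) * w m j) - W i (Suc j) * w m j)"
    using VW_diag[of i m j "Suc j"] assms Suc j by (simp add: V diff_smul)
  show ?case
    by (simp add: qcomm_def W distrib_left distrib_right smul_add IH 1 2 3)
qed

lemma X_old: "i \<in> {1..k} \<Longrightarrow> X (i,j) = W i j * t j"
  by (simp add: X_def)

lemma X_new: "X (Suc k,j) = t j"
  by (simp add: X_def)

lemma X_row:
  assumes i: "i \<in> {1..k}" and j: "j \<in> {1..n}" and l: "l \<in> {1..n}" and jl: "j < l"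
  shows "qcomm q (X (i,j)) (X (i,l))"
proof -
  have 1: "qcomm q (V i j l * t j) (W i l * t l)"
    by (rule qcomm_eq[OF qcomm_mult[OF VW_row Vt tW tt]]) (use assms q in auto)
  have Wj: "t j * W i l = (1/q) \<bullet> (W i l * t j)" "t l * W i l = (1/q) \<bullet> (W i l * t l)"
    using tW[of i j l] tW[of i l l] assms by (auto simp: qcomm_def)
  have tt': "t j * t l = q \<bullet> (t l * t j)" using tt assms by (auto simp: qcomm_def)
  have "(W i l * t j) * (W i l * t l) = W i l * (t j * W i l) * t l"
    by (simp add: mult.assoc)
  also have "\<dots> = W i l * W i l * (t l * t j)"
    using q by (simp add: Wj mult.assoc tt')
  also have "\<dots> = q \<bullet> (W i l * (t l * W i l) * t j)"
    using q by (simp add: Wj mult.assoc)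
  finally have 2: "qcomm q (W i l * t j) (W i l * t l)"
    by (simp add: qcomm_def mult.assoc)
  show ?thesis
    using 1 2 W_split[of j l i] assms
    by (simp add: X_old qcomm_def distrib_left distrib_right smul_add)
qed

lemma X_col:
  assumes "i \<in> {1..k}" "m \<in> {1..k}" "i < m" "j \<in> {1..n}"
  shows "qcomm q (X (i,j)) (X (m,j))"
  unfolding X_old[OF assms(1)] X_old[OF assms(2)]
  by (rule qcomm_eq[OF qcomm_mult[OF WW_col Wt tW qcomm_self]]) (use assms q in auto)

lemma X_anti:
  assumes "i \<in> {1..k}" "m \<in> {1..k}" "i < m" "j \<in> {1..n}" "l \<in> {1..n}" "l < j"
  shows "qcomm 1 (X (i,j)) (X (m,l))"
proof -
  have tj: "qcomm (1/q) (t j) (t l)"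
    using qcomm_swap[OF tt, of l j] assms q by auto
  have 1: "qcomm 1 (W i j * t j) (V m l j * t l)"
    by (rule qcomm_eq[OF qcomm_mult[OF WV_anti Wt tV tj]]) (use assms q in auto)
  have 2: "qcomm 1 (W i j * t j) (W m j * t l)"
    by (rule qcomm_eq[OF qcomm_mult[OF WW_col Wt tW tj]]) (use assms q in auto)
  show ?thesis
    using 1 2 W_split[of l j m] assms
    by (simp add: X_old qcomm_def distrib_left distrib_right smul_add)
qed

lemma X_diag:
  assumes i: "i \<in> {1..k}" and m: "m \<in> {1..k}" and im: "i < m"
    and j: "j \<in> {1..n}" and l: "l \<in> {1..n}" and jl: "j < l"
  shows "X (i,j) * X (m,l) - X (m,l) * X (i,j) = (q - 1 / q) \<bullet> (X (i,l) * X (m,j))"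
proof -
  let ?P = "W m l * V i j l * (t l * t j)" and ?R = "W i l * V m j l * (t l * t j)"
    and ?S = "W i l * W m l * (t l * t j)" and ?S' = "W m l * W i l * (t l * t j)"
  have tj: "t j * t l = q \<bullet> (t l * t j)" using tt j l jl by (auto simp: qcomm_def)
  have tWm: "t j * W m l = (1/q) \<bullet> (W m l * t j)" "t l * W m l = (1/q) \<bullet> (W m l * t l)"
    using tW[of m _ l] assms by (auto simp: qcomm_def)
  have tWi: "t l * W i l = (1/q) \<bullet> (W i l * t l)" using tW[of i l l] assms by (auto simp: qcomm_def)
  have tVm: "t l * V m j l = q \<bullet> (V m j l * t l)" "t l * V i j l = q \<bullet> (V i j l * t l)"
    using tV[of _ j l] assms by (auto simp: qcomm_def)
  have WW: "W i l * W m l = q \<bullet> (W m l * W i l)" using WW_col[of i m l] assms by (auto simp: qcomm_def)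
  have "V i j l * t j * (W m l * t l) = V i j l * (t j * W m l) * t l"
    by (simp add: mult.assoc)
  also have "\<dots> = V i j l * W m l * (t l * t j)"
    using q by (simp add: tWm mult.assoc tj)
  also have "\<dots> = q \<bullet> ?P + (q * q - 1) \<bullet> ?R"
    by (subst VW_diag) (use assms in \<open>auto simp: distrib_right\<close>)
  finally have 1: "V i j l * t j * (W m l * t l) = q \<bullet> ?P + (q * q - 1) \<bullet> ?R" .
  have "W i l * t j * (W m l * t l) = W i l * (t j * W m l) * t l"
    by (simp add: mult.assoc)
  also have "\<dots> = ?S" using q by (simp add: tWm mult.assoc tj)
  finally have 2: "W i l * t j * (W m l * t l) = ?S" .
  have "W m l * t l * (V i j l * t j) = W m l * (t l * V i j l) * t j" by (simp add: mult.assoc)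
  also have "\<dots> = q \<bullet> ?P" by (simp add: tVm mult.assoc)
  finally have 3: "W m l * t l * (V i j l * t j) = q \<bullet> ?P" .
  have "W m l * t l * (W i l * t j) = W m l * (t l * W i l) * t j" by (simp add: mult.assoc)
  also have "\<dots> = (1/q) \<bullet> ?S'" by (simp add: tWi mult.assoc)
  also have "?S' = (1/q) \<bullet> ?S" using q by (simp add: WW)
  finally have 4: "W m l * t l * (W i l * t j) = (1/q * (1/q)) \<bullet> ?S" by simp
  have "W i l * t l * (V m j l * t j) = W i l * (t l * V m j l) * t j" by (simp add: mult.assoc)
  also have "\<dots> = q \<bullet> ?R" by (simp add: tVm mult.assoc)
  finally have 5: "W i l * t l * (V m j l * t j) = q \<bullet> ?R" .
  have "W i l * t l * (W m l * t j) = W i l * (t l * W m l) * t j" by (simp add: mult.assoc)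
  also have "\<dots> = (1/q) \<bullet> ?S" by (simp add: tWm mult.assoc)
  finally have 6: "W i l * t l * (W m l * t j) = (1/q) \<bullet> ?S" .
  have "X (i,j) * X (m,l) - X (m,l) * X (i,j) = (q * q - 1) \<bullet> ?R + (?S - (1/q * (1/q)) \<bullet> ?S)"
    using W_split[of j l i] assms by (simp add: X_old distrib_left distrib_right 1 2 3 4)
  also have "?S - (1/q * (1/q)) \<bullet> ?S = (1 - 1/q * (1/q)) \<bullet> ?S"
    by (simp add: diff_smul)
  also have "q * q - 1 = (q - 1/q) * q"
    using q by (simp add: field_simps)
  also have "1 - 1/q * (1/q) = (q - 1/q) * (1/q)"
    using q by (simp add: field_simps)
  also have "((q - 1/q) * q) \<bullet> ?R + ((q - 1/q) * (1/q)) \<bullet> ?S = (q - 1/q) \<bullet> (X (i,l) * X (m,j))"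
    using W_split[of j l m] assms by (simp add: X_old distrib_left distrib_right 5 6 smul_add)
  finally show ?thesis .
qed

lemma X_col_new:
  assumes "i \<in> {1..k}" "j \<in> {1..n}"
  shows "qcomm q (X (i,j)) (X (Suc k,j))"
  unfolding X_old[OF assms(1)] X_new
  by (rule qcomm_eq[OF qcomm_mult_left[OF Wt qcomm_self]]) (use assms q in auto)

lemma X_anti_new:
  assumes "i \<in> {1..k}" "j \<in> {1..n}" "l \<in> {1..n}" "l < j"
  shows "qcomm 1 (X (i,j)) (X (Suc k,l))"
  unfolding X_old[OF assms(1)] X_new
  by (rule qcomm_eq[OF qcomm_mult_left[OF Wt qcomm_swap[OF tt]]]) (use assms q in auto)

lemma X_diag_new:
  assumes "i \<in> {1..k}" "j \<in> {1..n}" "l \<in> {1..n}" "j < l"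
  shows "X (i,j) * X (Suc k,l) - X (Suc k,l) * X (i,j) = (q - 1 / q) \<bullet> (X (i,l) * X (Suc k,j))"
proof -
  have 1: "qcomm 1 (V i j l * t j) (t l)"
    by (rule qcomm_eq[OF qcomm_mult_left[OF Vt tt]]) (use assms q in auto)
  have 2: "qcomm (q * q) (W i l * t j) (t l)"
    by (rule qcomm_eq[OF qcomm_mult_left[OF Wt tt]]) (use assms q in auto)
  have 3: "W i l * t l = q \<bullet> (t l * W i l)" using Wt[of i l l] assms by (simp add: qcomm_def)
  have "X (i,j) * X (Suc k,l) - X (Suc k,l) * X (i,j)
      = (q * q) \<bullet> (t l * (W i l * t j)) - t l * (W i l * t j)"
    using W_split[of j l i] assms 1 2
    by (simp add: X_old X_new qcomm_def distrib_left distrib_right)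
  also have "\<dots> = (q * q - 1) \<bullet> (t l * (W i l * t j))" by (simp add: diff_smul)
  also have "q * q - 1 = (q - 1/q) * q" using q by (simp add: field_simps)
  also have "((q - 1/q) * q) \<bullet> (t l * (W i l * t j)) = (q - 1/q) \<bullet> (W i l * t l * t j)"
    by (simp add: 3 mult.assoc)
  finally show ?thesis using assms by (simp add: X_old X_new mult.assoc)
qed

theorem qmatrix_X: "qmatrix q (Suc k) n X"
  unfolding qmatrix_def
proof (intro conjI ballI impI)
  have rows: "i = Suc k \<or> i \<in> {1..k}" if "i \<in> {1..Suc k}" for i
    using that by auto
  fix i j l assume i: "i \<in> {1..Suc k}" and j: "j \<in> {1..n}" and l: "l \<in> {1..n}" and "j < l"
  then show "qcomm q (X (i,j)) (X (i,l))"
    using rows[OF i] X_row[of i j l] tt[of j l] by (auto simp: X_new)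
next
  have rows: "m = Suc k \<or> m \<in> {1..k}" if "m \<in> {1..Suc k}" for m
    using that by auto
  fix i m j assume i: "i \<in> {1..Suc k}" and m: "m \<in> {1..Suc k}" and j: "j \<in> {1..n}" and im: "i < m"
  have i': "i \<in> {1..k}" using i m im by auto
  show "qcomm q (X (i,j)) (X (m,j))"
    using rows[OF m] X_col[of i m j] X_col_new[of i j] i' im j by auto
  fix l assume l: "l \<in> {1..n}"
  show "qcomm 1 (X (i,j)) (X (m,l))" if "l < j"
    using rows[OF m] X_anti[of i m j l] X_anti_new[of i j l] i' im j l that by auto
  show "X (i,j) * X (m,l) - X (m,l) * X (i,j) = (q - 1 / q) \<bullet> (X (i,l) * X (m,j))" if "j < l"
    using rows[OF m] X_diag[of i m j l] X_diag_new[of i j l] i' im j l that by auto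
qed

end


section \<open>Leading monomials in a quantum torus\<close>

definition unit :: "nat \<times> nat \<Rightarrow> expo" where
  "unit p = (\<lambda>r. if r = p then 1 else 0)"

lemma unit_apply: "unit p r = (if r = p then 1 else 0)"
  by (simp add: unit_def)

definition supported :: "nat \<Rightarrow> expo \<Rightarrow> bool" where
  "supported n a \<longleftrightarrow> (\<forall>p. p \<notin> grid n \<longrightarrow> a p = 0)"

lemma supported_simps [simp]:
  "supported n 0"
  "supported n a \<Longrightarrow> supported n b \<Longrightarrow> supported n (a + b)"
  "supported n a \<Longrightarrow> supported n (- a)"
  "supported n a \<Longrightarrow> supported n b \<Longrightarrow> supported n (a - b)"
  "p \<in> grid n \<Longrightarrow> supported n (unit p)"
  by (auto simp: supported_def unit_def)

lemma twist_minus_left: "twist n (- a) c = - twist n a c"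
  using twist_add_left[of n a "- a" c] by simp

lemma twist_minus_right: "twist n c (- a) = - twist n c a"
  using twist_add_right[of n c a "- a"] by simp

lemma twist_unit_left:
  assumes "p \<in> grid n"
  shows "twist n (unit p) a = (\<Sum>r\<in>grid n. if precedes p r then a r else 0)"
proof -
  have "twist n (unit p) a
      = (\<Sum>p'\<in>grid n. if p' = p then (\<Sum>r\<in>grid n. if precedes p r then a r else 0) else 0)"
    unfolding twist_def unit_def by (intro sum.cong refl) (auto intro!: sum.neutral sum.cong)
  then show ?thesis using assms by simp
qed

lemma twist_unit_right:
  assumes "p \<in> grid n"
  shows "twist n a (unit p) = (\<Sum>r\<in>grid n. if precedes r p then a r else 0)"
  unfolding twist_def unit_def
proof (intro sum.cong refl)
  fix r
  have "(\<Sum>p'\<in>grid n. if precedes r p' then a r * (if p' = p then 1 else 0) else 0)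
      = (\<Sum>p'\<in>grid n. if p' = p then (if precedes r p then a r else 0) else 0)"
    by (intro sum.cong) auto
  then show "(\<Sum>p'\<in>grid n. if precedes r p' then a r * (if p' = p then 1 else 0) else 0)
      = (if precedes r p then a r else 0)"
    using assms by simp
qed

lemma sum_grid_after:
  assumes "(i,j) \<in> grid n"
  shows "(\<Sum>r\<in>grid n. if precedes (i,j) r then a r else 0)
    = (\<Sum>k\<in>{i<..n}. a (k,j)) + (\<Sum>l\<in>{j<..n}. a (i,l) :: int)"
proof -
  let ?A = "(\<lambda>k. (k,j)) ` {i<..n}" and ?B = "(\<lambda>l. (i,l)) ` {j<..n}"
  have "(\<Sum>r\<in>grid n. if precedes (i,j) r then a r else 0) = (\<Sum>r\<in>?A \<union> ?B. a r)"
    by (subst sum.inter_filter[symmetric])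
       (use assms in \<open>auto simp: grid_def precedes_def intro!: sum.cong\<close>)
  also have "\<dots> = sum a ?A + sum a ?B"
    by (rule sum.union_disjoint) auto
  also have "\<dots> = (\<Sum>k\<in>{i<..n}. a (k,j)) + (\<Sum>l\<in>{j<..n}. a (i,l))"
    by (subst (1 2) sum.reindex) (auto simp: inj_on_def)
  finally show ?thesis .
qed

lemma sum_grid_before:
  assumes "(i,j) \<in> grid n"
  shows "(\<Sum>r\<in>grid n. if precedes r (i,j) then a r else 0)
    = (\<Sum>k\<in>{1..<i}. a (k,j)) + (\<Sum>l\<in>{1..<j}. a (i,l) :: int)"
proof -
  let ?A = "(\<lambda>k. (k,j)) ` {1..<i}" and ?B = "(\<lambda>l. (i,l)) ` {1..<j}"
  have "(\<Sum>r\<in>grid n. if precedes r (i,j) then a r else 0) = (\<Sum>r\<in>?A \<union> ?B. a r)"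
    by (subst sum.inter_filter[symmetric])
       (use assms in \<open>auto simp: grid_def precedes_def intro!: sum.cong\<close>)
  also have "\<dots> = sum a ?A + sum a ?B"
    by (rule sum.union_disjoint) auto
  also have "\<dots> = (\<Sum>k\<in>{1..<i}. a (k,j)) + (\<Sum>l\<in>{1..<j}. a (i,l))"
    by (subst (1 2) sum.reindex) (auto simp: inj_on_def)
  finally show ?thesis .
qed

lemma comm_exp_unit_left:
  assumes "(i,j) \<in> grid n"
  shows "comm_exp n (unit (i,j)) a =
    (\<Sum>k\<in>{i<..n}. a (k,j)) + (\<Sum>l\<in>{j<..n}. a (i,l))
    - (\<Sum>k\<in>{1..<i}. a (k,j)) - (\<Sum>l\<in>{1..<j}. a (i,l))"
  using assms
  by (simp add: comm_exp_def twist_unit_left twist_unit_right sum_grid_after sum_grid_before)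

lemma comm_exp_add_left: "comm_exp n (a + b) c = comm_exp n a c + comm_exp n b c"
  by (simp add: comm_exp_def twist_add_left twist_add_right)

lemma comm_exp_add_right: "comm_exp n c (a + b) = comm_exp n c a + comm_exp n c b"
  by (simp add: comm_exp_def twist_add_left twist_add_right)

lemma comm_exp_anti: "comm_exp n a b = - comm_exp n b a"
  by (simp add: comm_exp_def)

lemma comm_exp_self [simp]: "comm_exp n a a = 0"
  by (simp add: comm_exp_def)

locale quantum_torus =
  fixes q :: "'k::field" and n :: nat
  assumes q: "q \<noteq> 0"
begin

abbreviation M :: "expo \<Rightarrow> 'k lin_op" where "M a \<equiv> monomial q n a"

lemma M_mult: "M a * M b = scal (q powi twist n a b) * M (a + b)"
  by (rule mono_mult[OF q])

lemma M_qcomm: "op_scalars.qcomm (q powi comm_exp n a b) (M a) (M b)"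
  using q
  by (simp add: op_scalars.qcomm_def op_scalars.smul_def M_mult comm_exp_def add.commute[of b a]
      power_int_diff mult.assoc[symmetric] op_scalars.s_mult[symmetric])

lemma scal_M_mult: "scal c * M a * (scal d * M b) = scal (c * d * q powi twist n a b) * M (a + b)"
proof -
  have "op_scalars.smul c (M a) * op_scalars.smul d (M b)
      = op_scalars.smul (c * d * q powi twist n a b) (M (a + b))"
    by (simp add: M_mult op_scalars.smul_def[symmetric] mult_ac)
  then show ?thesis by (simp only: op_scalars.smul_def)
qed

text \<open>The span of the monomials whose exponents satisfy \<open>P\<close>. All estimates of supports are statements of
  membership in such a span.\<close>

inductive_set mspan :: "(expo \<Rightarrow> bool) \<Rightarrow> 'k lin_op set" for P where
  zero: "0 \<in> mspan P"
| step: "supported n a \<Longrightarrow> P a \<Longrightarrow> f \<in> mspan P \<Longrightarrow> scal c * M a + f \<in> mspan P"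

lemma mspan_M: "supported n a \<Longrightarrow> P a \<Longrightarrow> scal c * M a \<in> mspan P"
  using mspan.step[OF _ _ mspan.zero, of a P c] by simp

lemma mspan_M1: "supported n a \<Longrightarrow> P a \<Longrightarrow> M a \<in> mspan P"
  using mspan_M[of a P 1] by simp

lemma mspan_add: "f \<in> mspan P \<Longrightarrow> g \<in> mspan P \<Longrightarrow> f + g \<in> mspan P"
  by (induction rule: mspan.induct) (auto simp: add.assoc intro: mspan.step)

lemma mspan_scal: "f \<in> mspan P \<Longrightarrow> scal d * f \<in> mspan P"
  by (induction rule: mspan.induct)
     (auto simp: distrib_left mult.assoc[symmetric] op_scalars.s_mult[symmetric] intro: mspan.intros)

lemma mspan_minus: "f \<in> mspan P \<Longrightarrow> - f \<in> mspan P"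
  using mspan_scal[of f P "-1"] by (simp add: op_scalars.s_minus)

lemma mspan_diff: "f \<in> mspan P \<Longrightarrow> g \<in> mspan P \<Longrightarrow> f - g \<in> mspan P"
  using mspan_add[OF _ mspan_minus, of f P g] by simp

lemma mspan_sum: "(\<And>i. i \<in> A \<Longrightarrow> f i \<in> mspan P) \<Longrightarrow> (\<Sum>i\<in>A. f i) \<in> mspan P"
  by (induction A rule: infinite_finite_induct) (auto intro: mspan_add mspan.zero)

lemma mspan_mono: "f \<in> mspan P \<Longrightarrow> (\<And>a. supported n a \<Longrightarrow> P a \<Longrightarrow> Q a) \<Longrightarrow> f \<in> mspan Q"
  by (induction rule: mspan.induct) (auto intro: mspan.intros)

lemma mspan_mult:
  assumes "f \<in> mspan P" "g \<in> mspan Q"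
    and "\<And>a b. supported n a \<Longrightarrow> supported n b \<Longrightarrow> P a \<Longrightarrow> Q b \<Longrightarrow> R (a + b)"
  shows "f * g \<in> mspan R"
  using assms(1)
proof (induction rule: mspan.induct)
  case (step a f c)
  have "scal c * M a * g \<in> mspan R"
    using assms(2)
  proof (induction rule: mspan.induct)
    case (step b g d)
    then show ?case using step assms(3)[of a b] \<open>supported n a\<close> \<open>P a\<close>
      by (auto simp: distrib_left scal_M_mult intro!: mspan.step)
  qed (auto intro: mspan.intros)
  then show ?case using step by (auto simp: distrib_right intro: mspan_add)
qed (auto intro: mspan.intros)

lemma coef_mspan:
  assumes "f \<in> mspan P" "coef f b \<noteq> 0"
  shows "P b" "supported n b"
proof -
  have "coef f b \<noteq> 0 \<longrightarrow> P b \<and> supported n b"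
    using assms(1) by (induction rule: mspan.induct) (auto simp: coef_mono)
  then show "P b" "supported n b" using assms(2) by auto
qed

text \<open>An element commutes with a monomial up to a factor as soon as all of its monomials do so with the same
  factor.\<close>

lemma mspan_qcomm:
  assumes "f \<in> mspan (\<lambda>a. comm_exp n a b = m)"
  shows "op_scalars.qcomm (q powi m) f (M b)"
  using assms
proof (induction rule: mspan.induct)
  case (step a f c)
  have "M a * M b = scal (q powi m) * (M b * M a)"
    using M_qcomm[of a b] step by (simp add: op_scalars.qcomm_def op_scalars.smul_def)
  then have "op_scalars.smul c (M a) * M b
      = op_scalars.smul (q powi m) (M b * op_scalars.smul c (M a))"
    by (simp add: op_scalars.smul_def[symmetric] mult.commute)
  then have "scal c * M a * M b = scal (q powi m) * (M b * (scal c * M a))"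
    by (simp only: op_scalars.smul_def)
  then show ?case using step.IH
    by (simp add: op_scalars.qcomm_def op_scalars.smul_def distrib_left distrib_right)
qed (simp add: op_scalars.qcomm_def op_scalars.smul_def)

text \<open>The term \<open>c M_a\<close> strictly dominates the rest of \<open>f\<close>. The coefficient \<open>c\<close> may vanish, so a leading
  exponent is meaningful only together with \<open>c \<noteq> 0\<close>.\<close>

definition lead :: "(expo \<Rightarrow> 'g::linordered_ab_group_add) \<Rightarrow> 'k lin_op \<Rightarrow> expo \<Rightarrow> 'k \<Rightarrow> bool" where
  "lead h f a c \<longleftrightarrow> supported n a \<and> f - scal c * M a \<in> mspan (\<lambda>b. h b < h a)"

lemma lead_coef: "lead h f a c \<Longrightarrow> coef f a = c"
  using coef_mspan(1)[of "f - scal c * M a" "\<lambda>b. h b < h a" a]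
  by (auto simp: lead_def coef_mono)

lemma lead_coef_le: "lead h f a c \<Longrightarrow> coef f b \<noteq> 0 \<Longrightarrow> b \<noteq> a \<Longrightarrow> h b < h a"
  using coef_mspan(1)[of "f - scal c * M a" "\<lambda>b. h b < h a" b]
  by (auto simp: lead_def coef_mono)

lemma lead_supported: "lead h f a c \<Longrightarrow> supported n a"
  by (simp add: lead_def)

lemma lead_unique: "lead h f a c \<Longrightarrow> lead h f b d \<Longrightarrow> c \<noteq> 0 \<Longrightarrow> d \<noteq> 0 \<Longrightarrow> a = b"
  by (metis lead_coef lead_coef_le less_asym)

lemma lead_M: "supported n a \<Longrightarrow> lead h (M a) a 1"
  by (simp add: lead_def mspan.zero)

lemma lead_mspan_le: "lead h f a c \<Longrightarrow> f \<in> mspan (\<lambda>b. h b \<le> h a)"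
  using mspan_add[OF mspan_mono[of "f - scal c * M a" "\<lambda>b. h b < h a"
      "\<lambda>b. h b \<le> h a"] mspan_M[of a "\<lambda>b. h b \<le> h a" c]]
  by (auto simp: lead_def)

lemma lead_add_lower:
  assumes "lead h f a c" "g \<in> mspan (\<lambda>b. h b < h a)"
  shows "lead h (f + g) a c"
  using mspan_add[of "f - scal c * M a" "\<lambda>b. h b < h a" g] assms
  by (simp add: lead_def algebra_simps)

lemma lead_scal: "lead h f a c \<Longrightarrow> lead h (scal d * f) a (d * c)"
  using mspan_scal[of "f - scal c * M a" "\<lambda>b. h b < h a" d]
  by (simp add: lead_def right_diff_distrib op_scalars.s_mult mult.assoc)

lemma lead_mult:
  assumes h: "\<And>a b. h (a + b) = h a + (h b :: 'g::linordered_ab_group_add)"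
    and "lead h f a c" "lead h g b d"
  shows "lead h (f * g) (a + b) (c * d * q powi twist n a b)"
proof -
  have "f * g = scal c * M a * (scal d * M b)
     + ((f - scal c * M a) * g + scal c * M a * (g - scal d * M b))"
    by (simp add: algebra_simps)
  moreover have "(f - scal c * M a) * g \<in> mspan (\<lambda>e. h e < h (a + b))"
    using assms(2) unfolding lead_def
    by (intro mspan_mult[OF _ lead_mspan_le[OF assms(3)], where P = "\<lambda>e. h e < h a"])
       (auto simp: h intro: add_less_le_mono)
  moreover have "scal c * M a * (g - scal d * M b) \<in> mspan (\<lambda>e. h e < h (a + b))"
    using assms(2,3) unfolding lead_def
    by (intro mspan_mult[OF mspan_M[of a "\<lambda>e. e = a"], where Q = "\<lambda>e. h e < h b"])
       (auto simp: h)
  ultimately show ?thesis using assms(2,3)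
    by (auto simp: lead_def scal_M_mult intro: mspan_add)
qed

end


section \<open>Quantum matrices in a quantum torus\<close>

definition colsum :: "nat \<Rightarrow> expo \<Rightarrow> nat \<Rightarrow> int" where
  "colsum n a l = (\<Sum>i\<in>{1..n}. a (i,l))"

lemma colsum_simps [simp]:
  "colsum n (a + b) l = colsum n a l + colsum n b l"
  "colsum n (- a) l = - colsum n a l"
  "colsum n (a - b) l = colsum n a l - colsum n b l"
  "i \<in> {1..n} \<Longrightarrow> colsum n (unit (i,j)) l = (if l = j then 1 else 0)"
  by (auto simp: colsum_def sum.distrib sum_negf sum_subtractf unit_def)

definition deg :: "nat \<Rightarrow> expo \<Rightarrow> int" where
  "deg n a = (\<Sum>p\<in>grid n. a p)"

lemma deg_simps [simp]:
  "deg n (a + b) = deg n a + deg n b" "deg n (- a) = - deg n a" "deg n (a - b) = deg n a - deg n b"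
  "deg n 0 = 0"
  "p \<in> grid n \<Longrightarrow> deg n (unit p) = 1"
  by (auto simp: deg_def sum.distrib sum_negf sum_subtractf unit_def)

lemma deg_colsum: "deg n a = (\<Sum>l\<in>{1..n}. colsum n a l)"
proof -
  have "deg n a = (\<Sum>i\<in>{1..n}. \<Sum>l\<in>{1..n}. a (i,l))"
    by (simp add: deg_def grid_def sum.cartesian_product)
  also have "\<dots> = (\<Sum>l\<in>{1..n}. colsum n a l)"
    unfolding colsum_def by (rule sum.swap)
  finally show ?thesis .
qed

definition box :: "nat \<Rightarrow> nat \<Rightarrow> nat \<Rightarrow> nat \<Rightarrow> expo" where
  "box i j k l = unit (i,j) + unit (k,l) - unit (i,l) - unit (k,j)"

text \<open>Positivity on boxes says that \<open>x_{il} x_{kj}\<close> is smaller than \<open>x_{ij} x_{kl}\<close>, so that the four-term relation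
  becomes commutation of leading terms.\<close>

definition admissible :: "nat \<Rightarrow> (expo \<Rightarrow> 'g::linordered_ab_group_add) \<Rightarrow> bool" where
  "admissible n h \<longleftrightarrow> (\<forall>a b. h (a + b) = h a + h b) \<and>
    (\<forall>i j k l. (i,j) \<in> grid n \<longrightarrow> (k,l) \<in> grid n \<longrightarrow> i < k \<longrightarrow> j < l \<longrightarrow> 0 < h (box i j k l))"

lemma admissible_add: "admissible n h \<Longrightarrow> h (a + b) = h a + h b"
  by (simp add: admissible_def)

lemma admissible_0: "admissible n h \<Longrightarrow> h 0 = 0"
  using admissible_add[of n h 0 0] by simp

lemma admissible_minus: "admissible n h \<Longrightarrow> h (- a) = - h a"
  using admissible_add[of n h a "- a"] admissible_0[of n h]
  by (simp add: eq_neg_iff_add_eq_0 add.commute)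

lemma admissible_diff: "admissible n h \<Longrightarrow> h (a - b) = h a - h b"
  using admissible_add[of n h a "- b"] by (simp add: admissible_minus)

lemma admissible_box:
  assumes "admissible n h" "(i,j) \<in> grid n" "(k,l) \<in> grid n" "i < k" "j < l"
  shows "h (unit (i,l)) + h (unit (k,j)) < h (unit (i,j)) + h (unit (k,l))"
proof -
  have "0 < h (box i j k l)" using assms by (simp add: admissible_def)
  also have "h (box i j k l) = h (unit (i,j)) + h (unit (k,l)) - (h (unit (i,l)) + h (unit (k,j)))"
    using assms(1) by (simp add: box_def admissible_diff admissible_add algebra_simps)
  finally show ?thesis by simp
qed

context quantum_torus
begin

text \<open>The quantum matrix in the torus, built by adding rows; row \<open>k\<close> enters as the monomials
  \<^term>\<open>monomial q n (unit (k, j))\<close>.\<close>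

primrec tmat :: "nat \<Rightarrow> nat \<times> nat \<Rightarrow> 'k lin_op" where
  "tmat 0 p = 0"
| "tmat (Suc k) p = (if fst p = Suc k then M (unit p)
     else (\<Sum>l\<in>{snd p..n}. tmat k (fst p, l) * M (- unit (Suc k, l))) * M (unit (Suc k, snd p)))"

lemma twist_unit_self: "p \<in> grid n \<Longrightarrow> twist n (unit p) (unit p) = 0"
  by (subst twist_unit_left) (auto simp: unit_def precedes_def intro!: sum.neutral)

lemma M_unit_inverse:
  "p \<in> grid n \<Longrightarrow> M (unit p) * M (- unit p) = 1"
  "p \<in> grid n \<Longrightarrow> M (- unit p) * M (unit p) = 1"
  by (simp_all add: M_mult twist_minus_left twist_minus_right twist_unit_self)

text \<open>Passing to a new row preserves column sums, because \<open>e_{il} - e_{k+1,l} + e_{k+1,j}\<close> trades column \<open>l\<close> for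
  column \<open>j\<close>. The column sums are all that the next row feels.\<close>

lemma tmat_mspan:
  assumes "k \<le> n" "i \<in> {1..k}" "j \<in> {1..n}"
  shows "tmat k (i,j) \<in> mspan (\<lambda>a. (\<forall>p. k < fst p \<longrightarrow> a p = 0) \<and>
    (\<forall>l. colsum n a l = (if l = j then 1 else 0)))"
  using assms
proof (induction k arbitrary: i j)
  case (Suc k)
  show ?case
  proof (cases "i = Suc k")
    case True
    then show ?thesis using Suc
      by (auto intro!: mspan_M1 simp: grid_def) (auto simp: unit_def)
  next
    case False
    then have i: "i \<in> {1..k}" using Suc by auto
    have "tmat k (i,l) * M (- unit (Suc k, l)) * M (unit (Suc k, j)) \<in>
      mspan (\<lambda>a. (\<forall>p. Suc k < fst p \<longrightarrow> a p = 0) \<and>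
        (\<forall>l. colsum n a l = (if l = j then 1 else 0)))" if l: "l \<in> {j..n}" for l
    proof -
      have g: "(Suc k, l) \<in> grid n" "(Suc k, j) \<in> grid n" "Suc k \<in> {1..n}"
        using l Suc by (auto simp: grid_def)
      have "tmat k (i,l) * M (- unit (Suc k, l)) \<in> mspan (\<lambda>a. (\<forall>p. Suc k < fst p \<longrightarrow> a p = 0) \<and>
          (\<forall>l. colsum n a l = 0))"
        by (rule mspan_mult[OF Suc.IH[OF _ i] mspan_M1[of "- unit (Suc k, l)" "\<lambda>a. a = - unit (Suc k, l)"]])
           (use g l Suc in \<open>auto simp: unit_apply\<close>)
      then show ?thesis
        by (rule mspan_mult[OF _ mspan_M1[of "unit (Suc k, j)" "\<lambda>a. a = unit (Suc k, j)"]])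
           (use g l Suc in \<open>auto simp: unit_apply\<close>)
    qed
    then have "(\<Sum>l\<in>{j..n}. tmat k (i,l) * M (- unit (Suc k, l)) * M (unit (Suc k, j))) \<in>
      mspan (\<lambda>a. (\<forall>p. Suc k < fst p \<longrightarrow> a p = 0) \<and>
        (\<forall>l. colsum n a l = (if l = j then 1 else 0)))"
      by (rule mspan_sum)
    then show ?thesis using False by (simp add: sum_distrib_right)
  qed
qed simp

lemma tmat_qcomm:
  assumes "Suc k \<le> n" "i \<in> {1..k}" "j \<in> {1..n}" "l \<in> {1..n}"
  shows "op_scalars.qcomm (if j = l then q else 1) (tmat k (i,j)) (M (unit (Suc k,l)))"
proof -
  have "tmat k (i,j) \<in> mspan (\<lambda>a. comm_exp n a (unit (Suc k,l)) = (if j = l then 1 else 0))"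
  proof (rule mspan_mono[OF tmat_mspan], goal_cases)
    case (4 a)
    have g: "(Suc k, l) \<in> grid n" using assms by (simp add: grid_def)
    have "(\<Sum>i\<in>{1..<Suc k}. a (i,l)) = colsum n a l"
      unfolding colsum_def by (rule sum.mono_neutral_left) (use 4 assms in auto)
    moreover have "(\<Sum>j\<in>A. a (Suc k, j)) = 0" "(\<Sum>i\<in>{Suc k<..n}. a (i,l)) = 0" for A
      using 4 by (auto intro!: sum.neutral)
    ultimately have "comm_exp n (unit (Suc k,l)) a = - colsum n a l"
      by (subst comm_exp_unit_left[OF g]) simp
    then show ?case using 4 by (subst comm_exp_anti) simp
  qed (use assms in auto)
  from mspan_qcomm[OF this] show ?thesis by (auto split: if_splits)
qed

lemma M_unit_qcomm_row:
  assumes "i \<in> {1..n}" "j \<in> {1..n}" "l \<in> {1..n}" "j < l"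
  shows "op_scalars.qcomm q (M (unit (i,j))) (M (unit (i,l)))"
proof -
  have "comm_exp n (unit (i,j)) (unit (i,l)) = 1"
    by (subst comm_exp_unit_left) (use assms in \<open>auto simp: grid_def unit_def\<close>)
  then show ?thesis using M_qcomm[of "unit (i,j)" "unit (i,l)"] by simp
qed

lemma qmatrix_tmat: "k \<le> n \<Longrightarrow> op_scalars.qmatrix q k n (tmat k)"
proof (induction k)
  case 0
  then show ?case by (simp add: op_scalars.qmatrix_def)
next
  case (Suc k)
  interpret E: row_extension scal q k n "tmat k" "\<lambda>j. M (unit (Suc k, j))"
    "\<lambda>j. M (- unit (Suc k, j))"
  proof
    fix j assume "j \<in> {1..n}"
    then have "(Suc k, j) \<in> grid n" using Suc by (auto simp: grid_def)
    then show "M (unit (Suc k, j)) * M (- unit (Suc k, j)) = 1"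
      and "M (- unit (Suc k, j)) * M (unit (Suc k, j)) = 1"
      using M_unit_inverse by blast+
  qed (use Suc q tmat_qcomm[of k] M_unit_qcomm_row[of "Suc k"] in auto)
  have "E.X p = tmat (Suc k) p" for p
    by (cases p) (simp add: E.X_def E.W_def E.w_def)
  then have "E.X = tmat (Suc k)" by (rule ext)
  with E.qmatrix_X show ?case by (simp only:)
qed

text \<open>The summand \<open>l = j\<close> reproduces the old entry; the summand \<open>l\<close> with \<open>j < l\<close> lowers the exponent by the box on
  rows \<open>i, k + 1\<close> and columns \<open>j, l\<close>.\<close>

lemma lead_tmat:
  assumes h: "admissible n h"
  shows "k \<le> n \<Longrightarrow> i \<in> {1..k} \<Longrightarrow> j \<in> {1..n} \<Longrightarrow> lead h (tmat k (i,j)) (unit (i,j)) 1"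
proof (induction k arbitrary: i j)
  case (Suc k)
  show ?case
  proof (cases "i = Suc k")
    case True
    then show ?thesis using Suc by (auto intro!: lead_M simp: grid_def)
  next
    case False
    then have i: "i \<in> {1..k}" using Suc by auto
    let ?f = "\<lambda>l. tmat k (i,l) * M (- unit (Suc k, l)) * M (unit (Suc k, j))"
    have g: "(Suc k, l) \<in> grid n" if "l \<in> {1..n}" for l using that Suc by (auto simp: grid_def)
    have low: "?f l \<in> mspan (\<lambda>b. h b < h (unit (i,j)))" if l: "l \<in> {j<..n}" for l
    proof -
      have lt: "h (unit (i,l)) + h (unit (Suc k,j)) < h (unit (i,j)) + h (unit (Suc k,l))"
        by (rule admissible_box[OF h]) (use i l Suc in \<open>auto simp: grid_def\<close>)
      have IH: "tmat k (i,l) \<in> mspan (\<lambda>b. h b \<le> h (unit (i,l)))"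
        by (rule lead_mspan_le[OF Suc.IH]) (use i l Suc in auto)
      have low: "tmat k (i,l) * M (- unit (Suc k, l)) \<in>
          mspan (\<lambda>b. h b \<le> h (unit (i,l)) - h (unit (Suc k, l)))"
        by (rule mspan_mult[OF IH mspan_M1[of "- unit (Suc k, l)" "\<lambda>a. a = - unit (Suc k, l)"]])
           (use g[of l] l in \<open>auto simp: admissible_diff[OF h]\<close>)
      have "h (unit (i,l)) - h (unit (Suc k,l)) + h (unit (Suc k,j)) < h (unit (i,j))"
        using lt by (simp add: algebra_simps)
      then show ?thesis
        by (intro mspan_mult[OF low mspan_M1[of "unit (Suc k, j)" "\<lambda>a. a = unit (Suc k, j)"]])
           (use g[of j] l Suc.prems in \<open>auto simp: admissible_add[OF h]
              intro: order.strict_trans1[OF add_right_mono]\<close>)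
    qed
    have "tmat (Suc k) (i,j) = (\<Sum>l\<in>{j..n}. ?f l)"
      using False by (simp add: sum_distrib_right)
    also have "\<dots> = ?f j + (\<Sum>l\<in>{j<..n}. ?f l)"
      using Suc.prems by (subst sum.head) auto
    also have "?f j = tmat k (i,j)"
      using M_unit_inverse(2)[OF g[OF Suc.prems(3)]] by (simp add: mult.assoc)
    finally have eq: "tmat (Suc k) (i,j) = tmat k (i,j) + (\<Sum>l\<in>{j<..n}. ?f l)" .
    show ?thesis unfolding eq
      by (intro lead_add_lower Suc.IH i mspan_sum low) (use Suc.prems in auto)
  qed
qed simp

definition x :: "nat \<times> nat \<Rightarrow> 'k lin_op" where "x = tmat n"

lemma qmatrix_x: "op_scalars.qmatrix q n n x"
  unfolding x_def by (rule qmatrix_tmat) simp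

lemma lead_x: "admissible n h \<Longrightarrow> p \<in> grid n \<Longrightarrow> lead h (x p) (unit p) 1"
  unfolding x_def by (cases p) (simp add: lead_tmat grid_def)

lemma x_deg: "p \<in> grid n \<Longrightarrow> x p \<in> mspan (\<lambda>a. deg n a = 1)"
proof (cases p)
  case (Pair i j)
  assume p: "p \<in> grid n"
  then show ?thesis unfolding x_def Pair
    by (intro mspan_mono[OF tmat_mspan]) (auto simp: grid_def Pair deg_colsum)
qed

end


section \<open>Standard words\<close>

text \<open>The total exponent of a word when the letter \<open>p\<close> has exponent \<open>f p\<close>. With \<^const>\<open>unit\<close> this counts letters;
  with the leading exponents of a family it gives leading exponents of the substituted words.\<close>

definition wexp :: "(nat \<times> nat \<Rightarrow> expo) \<Rightarrow> (nat \<times> nat) free_monoid \<Rightarrow> expo" where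
  "wexp f w = sum_list (map f (letters w))"

lemma wexp_unit_Word: "wexp unit (Word ps) r = int (count_list ps r)"
  by (induction ps) (auto simp: wexp_def unit_def)

lemma wexp_unit: "wexp unit w r = int (count_list (letters w) r)"
  by (cases w) (simp add: wexp_unit_Word)

lemma wexp_unit_nonneg: "0 \<le> wexp unit w r"
  by (simp add: wexp_unit)

text \<open>Sorted in reading order: rows from top to bottom, each row from left to right.\<close>

definition standard :: "nat \<Rightarrow> (nat \<times> nat) free_monoid \<Rightarrow> bool" where
  "standard n w \<longleftrightarrow> sorted (letters w) \<and> set (letters w) \<subseteq> grid n"

lemma standard_eqI:
  assumes "standard n v" "standard n w" "wexp unit v = wexp unit w"
  shows "v = w"
proof -
  have "mset (letters v) = mset (letters w)"
  proof (rule multiset_eqI)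
    fix r
    show "count (mset (letters v)) r = count (mset (letters w)) r"
      using fun_cong[OF assms(3), of r]
      by (simp add: wexp_unit count_mset count_list_eq_length_filter)
  qed
  then have "letters v = letters w"
    using assms(1,2) by (metis standard_def properties_for_sort)
  then show ?thesis by (cases v; cases w) simp
qed

lemma standard_gen [simp]: "p \<in> grid n \<Longrightarrow> standard n (Word [p])"
  by (simp add: standard_def)

lemma supported_wexp:
  "(\<And>p. p \<in> grid n \<Longrightarrow> supported n (f p)) \<Longrightarrow> set (letters w) \<subseteq> grid n \<Longrightarrow> supported n (wexp f w)"
proof -
  assume f: "\<And>p. p \<in> grid n \<Longrightarrow> supported n (f p)"
  have "set ps \<subseteq> grid n \<Longrightarrow> supported n (sum_list (map f ps))" for ps
    by (induction ps) (simp_all add: f)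
  then show "set (letters w) \<subseteq> grid n \<Longrightarrow> supported n (wexp f w)"
    by (simp add: wexp_def)
qed

lemma deg_wexp_unit:
  assumes "set (letters w) \<subseteq> grid n"
  shows "deg n (wexp unit w) = int (word_length w)"
proof -
  have "set ps \<subseteq> grid n \<Longrightarrow> deg n (sum_list (map unit ps)) = int (length ps)" for ps
    by (induction ps) auto
  then show ?thesis using assms by (simp add: wexp_def)
qed

lemma wexp_eq_sum:
  assumes "set (letters w) \<subseteq> grid n"
  shows "wexp f w r = (\<Sum>p\<in>grid n. wexp unit w p * f p r)"
proof -
  have "set ps \<subseteq> grid n \<Longrightarrow>
    sum_list (map f ps) r = (\<Sum>p\<in>grid n. sum_list (map unit ps) p * f p r)" for ps
  proof (induction ps)
    case (Cons p ps)
    then have "(\<Sum>p'\<in>grid n. sum_list (map unit (p # ps)) p' * f p' r)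
      = (\<Sum>p'\<in>grid n. (if p' = p then f p r else 0))
        + (\<Sum>p'\<in>grid n. sum_list (map unit ps) p' * f p' r)"
      by (subst sum.distrib[symmetric]) (auto intro!: sum.cong simp: unit_def algebra_simps)
    with Cons show ?case by simp
  qed simp
  then show ?thesis using assms by (simp add: wexp_def)
qed

lemma finite_max_image:
  fixes f :: "'a \<Rightarrow> 'g::linorder"
  assumes "finite A" "A \<noteq> {}"
  obtains a where "a \<in> A" "\<And>b. b \<in> A \<Longrightarrow> f b \<le> f a"
proof -
  have "Max (f ` A) \<in> f ` A" using assms by (intro Max_in) auto
  then obtain a where "a \<in> A" "f a = Max (f ` A)" by auto
  moreover have "f b \<le> Max (f ` A)" if "b \<in> A" for b using assms that by auto
  ultimately show ?thesis using that[of a] by simp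
qed

context quantum_torus
begin

lemma lead_word_val:
  assumes h: "\<And>a b. h (a + b) = h a + (h b :: 'g::linordered_ab_group_add)"
    and X: "\<And>p. p \<in> grid n \<Longrightarrow> \<exists>c. c \<noteq> 0 \<and> lead h (X p) (f p) c"
    and w: "set (letters w) \<subseteq> grid n"
  shows "\<exists>c. c \<noteq> 0 \<and> lead h (word_val X w) (wexp f w) c"
proof -
  have "set ps \<subseteq> grid n \<Longrightarrow> \<exists>c. c \<noteq> 0 \<and> lead h (prod_list (map X ps)) (sum_list (map f ps)) c" for ps
  proof (induction ps)
    case Nil
    have "lead h 1 0 1" using lead_M[OF supported_simps(1), of h] by simp
    moreover have "(1::'k) \<noteq> 0" by simp
    ultimately show ?case unfolding list.map sum_list.Nil prod_list.Nil by blast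
  next
    case (Cons p ps)
    then have p: "p \<in> grid n" "set ps \<subseteq> grid n" by auto
    obtain c where "c \<noteq> 0" "lead h (X p) (f p) c" using X[OF p(1)] by blast
    moreover obtain d where "d \<noteq> 0" "lead h (prod_list (map X ps)) (sum_list (map f ps)) d"
      using Cons.IH[OF p(2)] by blast
    ultimately have "c \<noteq> 0" "d \<noteq> 0" "lead h (X p) (f p) c"
      "lead h (prod_list (map X ps)) (sum_list (map f ps)) d" by blast+
    then have "lead h (X p * prod_list (map X ps)) (f p + sum_list (map f ps))
        (c * d * q powi twist n (f p) (sum_list (map f ps)))"
      by (intro lead_mult[OF h])
    moreover have "c * d * q powi twist n (f p) (sum_list (map f ps)) \<noteq> 0"
      using q \<open>c \<noteq> 0\<close> \<open>d \<noteq> 0\<close> by simp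
    ultimately show ?case unfolding list.map prod_list.Cons sum_list.Cons by blast
  qed
  then show ?thesis using w by (simp add: word_val_def wexp_def)
qed

text \<open>Without coincidences among the leading exponents of its words, a combination cannot cancel at the top.\<close>

lemma lead_eval:
  assumes h: "\<And>a b. h (a + b) = h a + (h b :: 'g::linordered_ab_group_add)"
    and X: "\<And>p. p \<in> grid n \<Longrightarrow> \<exists>c. c \<noteq> 0 \<and> lead h (X p) (f p) c"
    and P: "P \<noteq> 0" "\<And>w. w \<in> keys P \<Longrightarrow> set (letters w) \<subseteq> grid n"
    and inj: "inj_on (\<lambda>w. h (wexp f w)) (keys P)"
  obtains w c where "w \<in> keys P"
    "\<And>v. v \<in> keys P \<Longrightarrow> h (wexp f v) \<le> h (wexp f w)"
    "c \<noteq> 0" "lead h (eval scal X P) (wexp f w) c"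
proof -
  obtain w where w: "w \<in> keys P"
    "\<And>v. v \<in> keys P \<Longrightarrow> h (wexp f v) \<le> h (wexp f w)"
    using finite_max_image[of "keys P" "\<lambda>w. h (wexp f w)"] P by auto
  obtain c where c: "c \<noteq> 0" "lead h (word_val X w) (wexp f w) c"
    using lead_word_val[OF h _ P(2)[OF w(1)], of X f] X by blast
  let ?l = "lookup P"
  have "eval scal X P = scal (?l w) * word_val X w
      + (\<Sum>v\<in>keys P - {w}. scal (?l v) * word_val X v)"
    unfolding eval_def using w by (subst sum.remove[of _ w]) auto
  moreover have "(\<Sum>v\<in>keys P - {w}. scal (?l v) * word_val X v)
      \<in> mspan (\<lambda>b. h b < h (wexp f w))"
  proof (intro mspan_sum mspan_scal)
    fix v assume v: "v \<in> keys P - {w}"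
    then obtain d where "lead h (word_val X v) (wexp f v) d"
      using lead_word_val[OF h _ P(2)[of v], of X f] X by blast
    moreover have "h (wexp f v) < h (wexp f w)"
      using w v inj by (auto simp: inj_on_def order.strict_iff_order)
    ultimately show "word_val X v \<in> mspan (\<lambda>b. h b < h (wexp f w))"
      by (intro mspan_mono[OF lead_mspan_le]) auto
  qed
  ultimately have "lead h (eval scal X P) (wexp f w) (?l w * c)"
    using lead_add_lower[OF lead_scal[OF c(2)]] by simp
  moreover have "?l w * c \<noteq> 0" using w c by (simp add: in_keys_iff)
  ultimately show ?thesis using that w by blast
qed

end


section \<open>Straightening\<close>

lemma not_sorted_split:
  fixes xs :: "'a::linorder list"
  assumes "\<not> sorted xs"
  obtains us a b vs where "xs = us @ a # b # vs" "b < a"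
proof -
  have "\<not> sorted xs \<Longrightarrow> \<exists>us a b vs. xs = us @ a # b # vs \<and> b < a"
  proof (induction xs)
    case (Cons a xs)
    show ?case
    proof (cases "sorted xs")
      case True
      with Cons.prems obtain b vs where "xs = b # vs" "\<not> a \<le> b"
        by (cases xs) (auto intro: order_trans)
      then have "a # xs = [] @ a # b # vs \<and> b < a" by auto
      then show ?thesis by blast
    next
      case False
      with Cons.IH obtain us c b vs where "xs = us @ c # b # vs" "b < c" by blast
      then have "a # xs = (a # us) @ c # b # vs \<and> b < c" by simp
      then show ?thesis by blast
    qed
  qed simp
  then show ?thesis using assms that by blast
qed

lemma lex_append_less: "(a, b) \<in> r \<Longrightarrow> length xs = length ys \<Longrightarrow> (us @ a # xs, us @ b # ys) \<in> lex r"
  by (auto simp: lex_conv)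

locale quantum_matrices = quantum_torus q n for q :: "'k::field" and n :: nat +
  assumes q_power: "\<And>m::nat. m > 0 \<Longrightarrow> q ^ m \<noteq> 1"
    and n: "n \<ge> 1"
begin

abbreviation J :: "((nat \<times> nat) free_monoid \<Rightarrow>\<^sub>0 'k) set" where "J \<equiv> qmat_ideal q n"
abbreviation F :: "('k, (nat \<times> nat) free_monoid \<Rightarrow>\<^sub>0 'k) module" where "F \<equiv> free_mat n"

lemma J_closed: "p \<in> J \<Longrightarrow> p \<in> carrier F"
  using ideal.Icarr[OF ideal_qmat_ideal] .

lemma J_add: "p \<in> J \<Longrightarrow> p' \<in> J \<Longrightarrow> p + p' \<in> J"
  using additive_subgroup.a_closed[OF ideal.axioms(1)[OF ideal_qmat_ideal], where x = p and y = p'] by simp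

lemma J_0: "0 \<in> J"
  using additive_subgroup.zero_closed[OF ideal.axioms(1)[OF ideal_qmat_ideal]] by fastforce

lemma J_mult_left: "p \<in> J \<Longrightarrow> u \<in> carrier F \<Longrightarrow> u * p \<in> J"
  using ideal.I_l_closed[OF ideal_qmat_ideal, where a = p and x = u] by (simp del: free_algebra_simps(1))

lemma J_mult_right: "p \<in> J \<Longrightarrow> u \<in> carrier F \<Longrightarrow> p * u \<in> J"
  using ideal.I_r_closed[OF ideal_qmat_ideal, where a = p and x = u] by (simp del: free_algebra_simps(1))

lemma J_scal: "p \<in> J \<Longrightarrow> scalar c * p \<in> J"
  by (intro J_mult_left scalar_closed)

lemma J_minus: "p \<in> J \<Longrightarrow> - p \<in> J"
  using J_scal[of p "-1"] by (simp add: free_scalars.s_minus)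

lemma J_rels: "p \<in> qmat_rels q n \<Longrightarrow> p \<in> J"
  unfolding qmat_ideal_def
  using ring.genideal_self[OF ring_free_algebra qmat_rels_closed] by blast

lemma J_rel_col: "i \<in> {1..n} \<Longrightarrow> j \<in> {1..n} \<Longrightarrow> k \<in> {1..n} \<Longrightarrow> i < k \<Longrightarrow>
   gen (i,j) * gen (k,j) - scalar q * (gen (k,j) * gen (i,j)) \<in> J"
  by (rule J_rels) (unfold qmat_rels_def, blast)

lemma J_rel_row: "i \<in> {1..n} \<Longrightarrow> j \<in> {1..n} \<Longrightarrow> l \<in> {1..n} \<Longrightarrow> j < l \<Longrightarrow>
   gen (i,j) * gen (i,l) - scalar q * (gen (i,l) * gen (i,j)) \<in> J"
  by (rule J_rels) (unfold qmat_rels_def, blast)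

lemma J_rel_anti: "i \<in> {1..n} \<Longrightarrow> j \<in> {1..n} \<Longrightarrow> k \<in> {1..n} \<Longrightarrow> l \<in> {1..n} \<Longrightarrow> i < k \<Longrightarrow> j > l \<Longrightarrow>
   gen (i,j) * gen (k,l) - gen (k,l) * gen (i,j) \<in> J"
  by (rule J_rels) (unfold qmat_rels_def, blast)

lemma J_rel_diag: "i \<in> {1..n} \<Longrightarrow> j \<in> {1..n} \<Longrightarrow> k \<in> {1..n} \<Longrightarrow> l \<in> {1..n} \<Longrightarrow> i < k \<Longrightarrow> j < l \<Longrightarrow>
   gen (i,j) * gen (k,l) - gen (k,l) * gen (i,j)
     - scalar (q - inverse q) * (gen (i,l) * gen (k,j)) \<in> J"
  by (rule J_rels) (unfold qmat_rels_def, blast)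

lemma J_qcomm_swap:
  assumes "g * g' - scalar q * (g' * g) \<in> J"
  shows "g' * g - scalar (1 / q) * (g * g') \<in> J"
proof -
  have "scalar (1 / q) * (scalar q * (g' * g)) = g' * g"
    using q by (simp add: mult.assoc[symmetric] free_scalars.s_mult[symmetric])
  then have "g' * g - scalar (1 / q) * (g * g') = scalar (- (1 / q)) * (g * g' - scalar q * (g' * g))"
    by (simp add: free_scalars.s_minus right_diff_distrib)
  then show ?thesis using J_scal[OF assms, of "- (1 / q)"] by simp
qed

text \<open>The correction term of the four-term relation starts with a letter in the same row as \<open>b\<close>, hence before \<open>a\<close>.\<close>

lemma straighten_pair:
  assumes "a \<in> grid n" "b \<in> grid n" "b < a"
  shows "\<exists>c d a' b'. a' \<in> grid n \<and> b' \<in> grid n \<and> a' < a \<and>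
    gen a * gen b - scalar c * (gen b * gen a) - scalar d * (gen a' * gen b') \<in> J"
proof -
  obtain k l i j where ab: "a = (k,l)" "b = (i,j)" by (metis surj_pair)
  have g: "i \<in> {1..n}" "j \<in> {1..n}" "k \<in> {1..n}" "l \<in> {1..n}" using assms by (auto simp: ab grid_def)
  consider "i = k" "j < l" | "i < k" "j = l" | "i < k" "l < j" | "i < k" "j < l"
    using assms(3) by (auto simp: ab less_prod_def') (metis nat_neq_iff)
  then show ?thesis
  proof cases
    case 1
    have "gen a * gen b - scalar (1/q) * (gen b * gen a) - scalar 0 * (gen b * gen b) \<in> J"
      using J_qcomm_swap[OF J_rel_row[of i j l]] g 1 by (simp add: ab)
    then show ?thesis using assms by blast
  next
    case 2
    have "gen a * gen b - scalar (1/q) * (gen b * gen a) - scalar 0 * (gen b * gen b) \<in> J"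
      using J_qcomm_swap[OF J_rel_col[of i j k]] g 2 by (simp add: ab)
    then show ?thesis using assms by blast
  next
    case 3
    have "gen a * gen b - scalar 1 * (gen b * gen a) - scalar 0 * (gen b * gen b) \<in> J"
      using J_minus[OF J_rel_anti[of i j k l]] g 3 by (simp add: ab)
    then show ?thesis using assms by blast
  next
    case 4
    have "gen a * gen b - scalar 1 * (gen b * gen a)
        - scalar (- (q - inverse q)) * (gen (i,l) * gen (k,j)) \<in> J"
      using J_minus[OF J_rel_diag[of i j k l]] g 4
      by (simp add: ab free_scalars.s_minus free_scalars.s_diff algebra_simps)
    moreover have "(i,l) < a" "(i,l) \<in> grid n" "(k,j) \<in> grid n"
      using 4 g by (auto simp: ab less_prod_def' grid_def)
    ultimately show ?thesis by blast
  qed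
qed

definition word :: "(nat \<times> nat) list \<Rightarrow> (nat \<times> nat) free_monoid \<Rightarrow>\<^sub>0 'k" where
  "word ps = Poly_Mapping.single (Word ps) 1"

lemma word_append: "word (us @ vs) = word us * word vs"
  by (simp add: word_def mult_single plus_free_monoid_def)

lemma word_Cons: "word (p # ps) = gen p * word ps"
  by (simp add: word_def gen_def mult_single plus_free_monoid_def)

lemma word_closed: "set ps \<subseteq> grid n \<Longrightarrow> word ps \<in> carrier F"
  by (auto simp: word_def grid_def)

definition normal :: "((nat \<times> nat) free_monoid \<Rightarrow>\<^sub>0 'k) \<Rightarrow> bool" where
  "normal P \<longleftrightarrow> (\<forall>w\<in>keys P. standard n w)"

lemma normal_add: "normal P \<Longrightarrow> normal P' \<Longrightarrow> normal (P + P')"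
  using keys_add[of P P'] by (auto simp: normal_def)

lemma keys_scalar_mult: "keys (scalar c * P) \<subseteq> keys P"
  using keys_mult[of "scalar c" P] by (auto simp: scalar_def split: if_splits)

lemma normal_scal: "normal P \<Longrightarrow> normal (scalar c * P)"
  using keys_scalar_mult[of c P] by (auto simp: normal_def)

lemma normal_0 [simp]: "normal 0"
  by (simp add: normal_def)

lemma normal_closed: "normal P \<Longrightarrow> P \<in> carrier F"
  by (auto simp: normal_def standard_def grid_def)

text \<open>Straightening an adjacent inversion keeps the length and makes the word lexicographically smaller, even
  where it creates new inversions to the right.\<close>

lemma straighten_word:
  "set ps \<subseteq> grid n \<Longrightarrow> \<exists>P. normal P \<and> word ps - P \<in> J"
proof (induction ps rule: wf_induct[OF wf_lex[OF wf], consumes 0])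
  case (1 ps)
  show ?case
  proof (cases "sorted ps")
    case True
    then have "normal (word ps)" using 1 by (auto simp: normal_def word_def standard_def)
    then show ?thesis using J_0 by (intro exI[of _ "word ps"]) simp
  next
    case False
    then obtain us a b vs where ps: "ps = us @ a # b # vs" and ba: "b < a"
      by (rule not_sorted_split)
    have g: "a \<in> grid n" "b \<in> grid n" "set us \<subseteq> grid n" "set vs \<subseteq> grid n" using 1(2) ps by auto
    from straighten_pair[OF g(1,2) ba] obtain c d a' b'
      where a': "a' \<in> grid n" "b' \<in> grid n" "a' < a"
        and r: "gen a * gen b - scalar c * (gen b * gen a) - scalar d * (gen a' * gen b') \<in> J"
      by blast
    let ?u = "us @ b # a # vs" and ?v = "us @ a' # b' # vs"
    have "(?u, ps) \<in> lex {(x, y). x < y}" "(?v, ps) \<in> lex {(x, y). x < y}"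
      unfolding ps using ba a' by (auto simp del: append.simps intro!: lex_append_less)
    moreover have "set ?u \<subseteq> grid n" "set ?v \<subseteq> grid n" using g a' by auto
    ultimately obtain P P' where P: "normal P" "word ?u - P \<in> J" and P': "normal P'" "word ?v - P' \<in> J"
      using 1(1) by meson
    let ?Q = "scalar c * P + scalar d * P'"
    have "word us * (gen a * gen b - scalar c * (gen b * gen a) - scalar d * (gen a' * gen b')) * word vs
        \<in> J"
      by (intro J_mult_left J_mult_right r word_closed g)
    also have "word us * (gen a * gen b - scalar c * (gen b * gen a) - scalar d * (gen a' * gen b')) * word vs
      = word ps - scalar c * word ?u - scalar d * word ?v"
    proof -
      have *: "word us * (scalar e * (y * z)) * word vs = scalar e * (word us * (y * (z * word vs)))"
        for e y z
      proof -
        have "word us * free_scalars.smul e (y * z) * word vs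
            = free_scalars.smul e (word us * (y * (z * word vs)))"
          by (simp add: mult.assoc)
        then show ?thesis by (simp only: free_scalars.smul_def)
      qed
      show ?thesis
        by (simp only: ps word_append word_Cons right_diff_distrib left_diff_distrib *)
           (simp add: mult.assoc)
    qed
    finally have "word ps - scalar c * word ?u - scalar d * word ?v
        + (scalar c * (word ?u - P) + scalar d * (word ?v - P')) \<in> J"
      by (intro J_add J_scal P P')
    then have "word ps - ?Q \<in> J" by (simp add: algebra_simps)
    moreover have "normal ?Q" using P P' by (intro normal_add normal_scal)
    ultimately show ?thesis by blast
  qed
qed

theorem straighten:
  assumes "p \<in> carrier F"
  shows "\<exists>P. normal P \<and> p - P \<in> J"
proof -
  have "\<exists>P. normal P \<and> (\<Sum>w\<in>A. Poly_Mapping.single w (c w)) - P \<in> J"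
    if "finite A" "\<And>w. w \<in> A \<Longrightarrow> set (letters w) \<subseteq> grid n" for A and c :: "_ \<Rightarrow> 'k"
    using that
  proof (induction A)
    case empty
    show ?case using J_0 by (intro exI[of _ 0]) simp
  next
    case (insert w A)
    then obtain P where P: "normal P" "(\<Sum>w\<in>A. Poly_Mapping.single w (c w)) - P \<in> J" by auto
    obtain Q where Q: "normal Q" "word (letters w) - Q \<in> J"
      using straighten_word[of "letters w"] insert by auto
    have "Poly_Mapping.single w (c w) = scalar (c w) * word (letters w)"
      by (simp add: word_def scalar_def mult_single)
    then have "(\<Sum>w\<in>insert w A. Poly_Mapping.single w (c w)) - (scalar (c w) * Q + P)
      = scalar (c w) * (word (letters w) - Q) + ((\<Sum>w\<in>A. Poly_Mapping.single w (c w)) - P)"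
      using insert by (simp add: algebra_simps)
    also have "\<dots> \<in> J" by (intro J_add J_scal P Q)
    finally show ?case using P Q by (blast intro: normal_add normal_scal)
  qed
  from this[OF finite_keys, of p "lookup p"] show ?thesis
    using assms by (simp add: poly_mapping_eq_sum grid_def)
qed

end


section \<open>Central exponents\<close>

text \<open>Mixed second differences of the linear equations cancel all sums and leave twice the difference of two
  neighbours on a diagonal.\<close>

lemma central_exponent_diagonal:
  assumes central: "\<And>p. p \<in> grid n \<Longrightarrow> comm_exp n (unit p) v = 0"
    and ij: "1 \<le> i" "1 \<le> j" "Suc i \<le> n" "Suc j \<le> n"
  shows "v (Suc i, Suc j) = v (i, j)"
proof -
  define A where "A i j = (\<Sum>k\<in>{i<..n}. v (k,j)) - (\<Sum>k\<in>{1..<i}. v (k,j))" for i j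
  define B where "B i j = (\<Sum>l\<in>{j<..n}. v (i,l)) - (\<Sum>l\<in>{1..<j}. v (i,l))" for i j
  have L: "A i j + B i j = 0" if "i \<in> {1..n}" "j \<in> {1..n}" for i j
    using central[of "(i,j)"] comm_exp_unit_left[of i j n v] that
    by (simp add: grid_def A_def B_def)
  have step: "(\<Sum>k\<in>{m<..n}. g k) = g (Suc m) + (\<Sum>k\<in>{Suc m<..n}. g k)"
    "(\<Sum>k\<in>{1..<Suc m}. g k) = g m + (\<Sum>k\<in>{1..<m}. g k)"
    if "1 \<le> m" "Suc m \<le> n" for m and g :: "nat \<Rightarrow> int"
  proof -
    have "{m<..n} = insert (Suc m) {Suc m<..n}" "{1..<Suc m} = insert m {1..<m}"
      using that by auto
    then show "(\<Sum>k\<in>{m<..n}. g k) = g (Suc m) + (\<Sum>k\<in>{Suc m<..n}. g k)"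
      "(\<Sum>k\<in>{1..<Suc m}. g k) = g m + (\<Sum>k\<in>{1..<m}. g k)" by simp_all
  qed
  have "A (Suc i) m = A i m - v (Suc i, m) - v (i, m)" for m
    using step[of i] ij by (simp add: A_def)
  moreover have "B m (Suc j) = B m j - v (m, Suc j) - v (m, j)" for m
    using step[of j] ij by (simp add: B_def)
  ultimately show ?thesis
    using L[of i j] L[of "Suc i" j] L[of i "Suc j"] L[of "Suc i" "Suc j"] ij by simp
qed

text \<open>The difference of the equations at \<open>(i,1)\<close> and \<open>(i+1,1)\<close>, simplified by constancy on diagonals.\<close>

lemma central_exponent_edge:
  assumes central: "\<And>p. p \<in> grid n \<Longrightarrow> comm_exp n (unit p) v = 0"
    and i: "1 \<le> i" "Suc i \<le> n"
  shows "v (Suc i, 1) = - v (i, n)"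
proof -
  have L: "(\<Sum>k\<in>{i<..n}. v (k,1)) - (\<Sum>k\<in>{1..<i}. v (k,1)) + (\<Sum>l\<in>{1<..n}. v (i,l)) = 0"
    if "i \<in> {1..n}" for i
    using central[of "(i,1)"] comm_exp_unit_left[of i 1 n v] that by (simp add: grid_def)
  have "{i<..n} = insert (Suc i) {Suc i<..n}" "{1..<Suc i} = insert i {1..<i}"
    using i by auto
  then have "(\<Sum>k\<in>{i<..n}. v (k,1)) = v (Suc i,1) + (\<Sum>k\<in>{Suc i<..n}. v (k,1))"
    "(\<Sum>k\<in>{1..<Suc i}. v (k,1)) = v (i,1) + (\<Sum>k\<in>{1..<i}. v (k,1))" by simp_all
  moreover have "(\<Sum>l\<in>{1<..n}. v (Suc i,l)) = v (i,1) + (\<Sum>l\<in>{1<..n}. v (i,l)) - v (i,n)"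
  proof -
    have "(\<Sum>l\<in>{1<..n}. v (Suc i,l)) = (\<Sum>l\<in>{1..<n}. v (Suc i,Suc l))"
      by (rule sum.reindex_bij_witness[of _ Suc "\<lambda>l. l - 1"]) auto
    also have "\<dots> = (\<Sum>l\<in>{1..<n}. v (i,l))"
      by (rule sum.cong) (use i in \<open>auto intro!: central_exponent_diagonal[OF central]\<close>)
    also have "\<dots> = (\<Sum>l\<in>{1..n}. v (i,l)) - v (i,n)"
    proof -
      have "{1..n} = insert n {1..<n}" using i by auto
      then show ?thesis by simp
    qed
    also have "(\<Sum>l\<in>{1..n}. v (i,l)) = v (i,1) + (\<Sum>l\<in>{1<..n}. v (i,l))"
    proof -
      have "{1..n} = insert 1 {1<..n}" using i by auto
      then show ?thesis by simp
    qed
    finally show ?thesis .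
  qed
  ultimately show ?thesis using L[of i] L[of "Suc i"] i by simp
qed

text \<open>A diagonal through \<open>p\<close> carries the constant \<open>-1\<close>, so it has only one point. The antiperiodicity pairs the
  adjacent diagonal with one on the other side, and both are nonnegative, hence zero.\<close>

lemma central_exponent_corner:
  assumes central: "\<And>p. p \<in> grid n \<Longrightarrow> comm_exp n (unit p) v = 0"
    and p: "p \<in> grid n" "v p = - 1"
    and nonneg: "\<And>r. r \<in> grid n \<Longrightarrow> r \<noteq> p \<Longrightarrow> 0 \<le> v r"
    and deg: "0 < deg n v"
  shows "n \<ge> 2" "p = (1,n) \<or> p = (n,1)"
    and "n \<ge> 3 \<Longrightarrow> p = (1,n) \<Longrightarrow> v (1,n-1) = 0 \<and> v (2,n) = 0"
    and "n \<ge> 3 \<Longrightarrow> p = (n,1) \<Longrightarrow> v (n-1,1) = 0 \<and> v (n,2) = 0"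
proof -
  note diag = central_exponent_diagonal[OF central] and edge = central_exponent_edge[OF central]
  obtain i j where ij: "p = (i,j)" by (cases p)
  have g: "1 \<le> i" "i \<le> n" "1 \<le> j" "j \<le> n" using p by (auto simp: ij grid_def)
  show n2: "n \<ge> 2"
  proof (rule ccontr)
    assume "\<not> n \<ge> 2"
    then have "n = 1" using g by simp
    then have "grid n = {p}" using g by (auto simp: grid_def ij)
    then show False using deg p by (simp add: deg_def)
  qed
  have 1: "i = n \<or> j = n"
  proof (rule ccontr)
    assume "\<not> (i = n \<or> j = n)"
    then have "v (Suc i, Suc j) = v (i,j)" "(Suc i, Suc j) \<in> grid n"
      using g diag[of i j] by (auto simp: grid_def)
    then show False using nonneg[of "(Suc i, Suc j)"] p by (simp add: ij)
  qed
  have 2: "i = 1 \<or> j = 1"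
  proof (rule ccontr)
    assume "\<not> (i = 1 \<or> j = 1)"
    then have "v (i, j) = v (i-1,j-1)" "(i-1, j-1) \<in> grid n"
      using g diag[of "i-1" "j-1"] by (auto simp: grid_def)
    then show False using nonneg[of "(i-1, j-1)"] p g by (simp add: ij)
  qed
  show "p = (1,n) \<or> p = (n,1)" using 1 2 n2 by (auto simp: ij)
  show "v (1,n-1) = 0 \<and> v (2,n) = 0" if "n \<ge> 3" "p = (1,n)"
  proof -
    have "v (2,n) = v (1,n-1)" using diag[of 1 "n-1"] that by (simp add: numeral_2_eq_2)
    moreover have "v (3,1) = - v (2,n)" using edge[of 2] that by (simp add: numeral_3_eq_3)
    moreover have "0 \<le> v (3,1)" "0 \<le> v (2,n)" using nonneg[of "(3,1)"] nonneg[of "(2,n)"] that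
      by (auto simp: grid_def)
    ultimately show ?thesis by simp
  qed
  show "v (n-1,1) = 0 \<and> v (n,2) = 0" if "n \<ge> 3" "p = (n,1)"
  proof -
    have "v (n,2) = v (n-1,1)" using diag[of "n-1" 1] that by (simp add: numeral_2_eq_2)
    moreover have "v (n-1,1) = - v (n-2,n)" using edge[of "n-2"] that by (simp add: Suc_diff_Suc numeral_2_eq_2)
    moreover have "0 \<le> v (n-1,1)" "0 \<le> v (n-2,n)" using nonneg[of "(n-1,1)"] nonneg[of "(n-2,n)"] that
      by (auto simp: grid_def)
    ultimately show ?thesis by simp
  qed
qed

lemma twist_scale_left: "twist n (\<lambda>p. k * a p) b = k * twist n a b"
  unfolding twist_def sum_distrib_left by (intro sum.cong) auto

lemma twist_scale_right: "twist n a (\<lambda>p. k * b p) = k * twist n a b"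
  unfolding twist_def sum_distrib_left by (intro sum.cong) auto

lemma comm_exp_scale:
  "comm_exp n (\<lambda>p. k * a p) b = k * comm_exp n a b"
  "comm_exp n a (\<lambda>p. k * b p) = k * comm_exp n a b"
  by (simp_all add: comm_exp_def twist_scale_left twist_scale_right algebra_simps)

lemma comm_exp_eq_sum: "comm_exp n a b = (\<Sum>p\<in>grid n. a p * comm_exp n (unit p) b)"
proof -
  have 1: "twist n a b = (\<Sum>p\<in>grid n. a p * twist n (unit p) b)"
    unfolding twist_def[of n a b]
    by (intro sum.cong refl) (simp add: twist_unit_left sum_distrib_left if_distrib cong: if_cong)
  have 2: "twist n b a = (\<Sum>p\<in>grid n. a p * twist n b (unit p))"
    unfolding twist_def[of n b a]
    by (subst sum.swap, intro sum.cong refl)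
       (simp add: twist_unit_right sum_distrib_left mult.commute if_distrib cong: if_cong)
  show ?thesis
    by (simp add: comm_exp_def 1 2 sum_subtractf right_diff_distrib)
qed

lemma twist_unit_unit:
  assumes "p \<in> grid n" "r \<in> grid n"
  shows "twist n (unit p) (unit r) = (if precedes p r then 1 else 0)"
proof -
  have "twist n (unit p) (unit r)
      = (\<Sum>r'\<in>grid n. if r' = r then (if precedes p r then 1 else 0) else 0)"
    unfolding twist_unit_left[OF assms(1)] by (intro sum.cong refl) (auto simp: unit_def)
  then show ?thesis using assms by simp
qed

lemma comm_exp_unit_unit:
  assumes "p \<in> grid n" "r \<in> grid n"
  shows "comm_exp n (unit p) (unit r) = (if precedes p r then 1 else if precedes r p then - 1 else 0)"
  using assms by (auto simp: comm_exp_def twist_unit_unit precedes_def)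


section \<open>Term orders\<close>

lemma pCons_less_iff: "pCons a p < pCons b r \<longleftrightarrow> p < r \<or> p = r \<and> a < (b::int)"
  by (auto simp: less_poly_def pos_poly_pCons)

lemma pCons_le_iff: "pCons a p \<le> pCons b r \<longleftrightarrow> p < r \<or> p = r \<and> a \<le> (b::int)"
  by (auto simp: less_eq_poly_def pos_poly_pCons less_poly_def)

lemma smult_less_0_iff: "0 < k \<Longrightarrow> 0 < smult k p \<longleftrightarrow> 0 < (p :: int poly)"
  by (simp add: less_poly_def pos_poly_def zero_less_mult_iff)

lemma smult_less_cancel: "0 < k \<Longrightarrow> smult k p < smult k r \<longleftrightarrow> p < (r :: int poly)"
  using smult_less_0_iff[of k "r - p"] by (simp add: smult_diff_right)

lemma smult_le_cancel: "0 < k \<Longrightarrow> smult k p \<le> smult k r \<longleftrightarrow> p \<le> (r :: int poly)"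
  by (meson not_less smult_less_cancel)

text \<open>Integer polynomials, ordered by their leading coefficients, serve as values: they form a linearly ordered
  group in which lexicographic orders and infinitesimals are easy to build.\<close>

definition term_order :: "nat \<Rightarrow> (expo \<Rightarrow> int poly) \<Rightarrow> bool" where
  "term_order n h \<longleftrightarrow> admissible n h \<and> (\<forall>k a. h (\<lambda>p. k * a p) = smult k (h a)) \<and>
    (\<forall>a. supported n a \<longrightarrow> h a = 0 \<longrightarrow> a = 0)"

lemma term_orderD:
  assumes "term_order n h"
  shows "admissible n h" "h (a + b) = h a + h b" "h (a - b) = h a - h b" "h (- a) = - h a" "h 0 = 0"
    "h (\<lambda>p. k * a p) = smult k (h a)"
    "supported n a \<Longrightarrow> supported n b \<Longrightarrow> h a = h b \<Longrightarrow> a = b"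
proof -
  show ad: "admissible n h" using assms by (simp add: term_order_def)
  show "h (a + b) = h a + h b" "h (a - b) = h a - h b" "h (- a) = - h a" "h 0 = 0"
    using ad by (simp_all add: admissible_add admissible_diff admissible_minus admissible_0)
  show "h (\<lambda>p. k * a p) = smult k (h a)" using assms by (simp add: term_order_def)
  show "a = b" if "supported n a" "supported n b" "h a = h b"
  proof -
    have "h (a - b) = 0" using that by (simp add: admissible_diff[OF ad])
    then have "a - b = 0" using assms that supported_simps(4)[of n a b] unfolding term_order_def by blast
    then show ?thesis by simp
  qed
qed

lemma deg_box: "(i,j) \<in> grid n \<Longrightarrow> (k,l) \<in> grid n \<Longrightarrow> deg n (box i j k l) = 0"
  by (auto simp: box_def grid_def)

lemma deg_scale: "deg n (\<lambda>p. k * a p) = k * deg n a"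
  by (simp add: deg_def sum_distrib_left)

lemma inj_on_standard:
  assumes h: "term_order n h" and S: "\<And>w. w \<in> S \<Longrightarrow> standard n w"
  shows "inj_on (\<lambda>w. h (wexp unit w)) S"
proof (rule inj_onI)
  fix v w assume vw: "v \<in> S" "w \<in> S" "h (wexp unit v) = h (wexp unit w)"
  have "supported n (wexp unit v)" "supported n (wexp unit w)"
    using S vw by (simp_all add: supported_wexp standard_def)
  then have "wexp unit v = wexp unit w" using term_orderD(7)[OF h] vw(3) by blast
  then show "v = w" using S vw(1,2) standard_eqI by blast
qed

text \<open>The exponent \<open>a\<close> is first projected along \<open>s\<close>, with denominators cleared, and then measured by \<open>h\<close>; the degree
  breaks ties among points on a line parallel to \<open>s\<close>.\<close>

definition tilt :: "nat \<Rightarrow> (expo \<Rightarrow> int poly) \<Rightarrow> expo \<Rightarrow> expo \<Rightarrow> int poly" where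
  "tilt n h s a = pCons (deg n a) (smult (deg n s) (h a) - smult (deg n a) (h s))"

lemma term_order_tilt:
  assumes h: "term_order n h" and s: "0 < deg n s"
  shows "term_order n (tilt n h s)"
  unfolding term_order_def admissible_def
proof (intro conjI allI impI)
  fix a b k
  show "tilt n h s (a + b) = tilt n h s a + tilt n h s b"
    by (simp add: tilt_def term_orderD(2)[OF h] smult_add_right smult_add_left)
  show "tilt n h s (\<lambda>p. k * a p) = smult k (tilt n h s a)"
    by (simp add: tilt_def term_orderD(6)[OF h] deg_scale smult_diff_right mult.commute)
  show "a = 0" if "supported n a" "tilt n h s a = 0"
  proof -
    have "deg n a = 0" using that(2) by (simp add: tilt_def)
    then have "smult (deg n s) (h a) = 0" using that(2) by (simp add: tilt_def)
    then have "h a = h 0" using s by (simp add: term_orderD(5)[OF h])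
    then show ?thesis using term_orderD(7)[OF h, of a 0] that by simp
  qed
next
  fix i j k l assume g: "(i,j) \<in> grid n" "(k,l) \<in> grid n" "i < k" "j < l"
  then have "0 < h (box i j k l)" using h by (simp add: term_order_def admissible_def)
  then show "0 < tilt n h s (box i j k l)"
    using g s by (simp add: tilt_def deg_box smult_less_0_iff pCons_less_iff[of 0 0, simplified])
qed


section \<open>Extremal shifts\<close>

context quantum_matrices
begin

lemma q_powi_eq_1: "q powi m = 1 \<Longrightarrow> m = 0"
proof (rule ccontr)
  assume m: "q powi m = 1" "m \<noteq> 0"
  show False
  proof (cases "m > 0")
    case True
    then have "q ^ nat m = 1" using m by (simp add: power_int_def)
    then show False using q_power[of "nat m"] True by simp
  next
    case False
    then have "q ^ nat (- m) = 1" using m by (simp add: power_int_def power_inverse)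
    then show False using q_power[of "nat (- m)"] False m by simp
  qed
qed

lemma q_powi_inj: "q powi m = q powi k \<Longrightarrow> m = k"
  using q_powi_eq_1[of "m - k"] q by (simp add: power_int_diff)

lemma q_not_inverse: "q - 1 / q \<noteq> 0"
proof
  assume "q - 1 / q = 0"
  then have "q ^ 2 = 1" using q by (simp add: field_simps power2_eq_square)
  then show False using q_power[of 2] by simp
qed

text \<open>The coefficients of \<open>P R\<close> and \<open>R P\<close> at the sum of the leading exponents differ by a power of \<open>q\<close>, which is
  determined by the relation up to lower terms.\<close>

lemma lead_commutator:
  assumes h: "\<And>a b. h (a + b) = h a + (h b :: 'g::linordered_ab_group_add)"
    and "lead h P a c" "c \<noteq> 0" "lead h R b d" "d \<noteq> 0"
    and "P * R - scal (q powi m) * (R * P) \<in> mspan (\<lambda>z. h z < h a + h b)"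
  shows "comm_exp n a b = m"
proof -
  have "coef (P * R) (a + b) = c * d * q powi twist n a b"
    by (rule lead_coef[OF lead_mult[OF h assms(2,4)]])
  moreover have "coef (R * P) (a + b) = d * c * q powi twist n b a"
    using lead_coef[OF lead_mult[OF h assms(4,2)]] by (simp add: add.commute)
  moreover have "coef (P * R - scal (q powi m) * (R * P)) (a + b) = 0"
    using coef_mspan(1)[OF assms(6), of "a + b"] h by fastforce
  ultimately have "q powi twist n a b = q powi (m + twist n b a)"
    using assms(3,5) q by (simp add: power_int_add)
  then show ?thesis using q_powi_inj by (fastforce simp: comm_exp_def)
qed

end

definition image_family :: "'k::field \<Rightarrow> nat \<Rightarrow>
    (nat \<times> nat \<Rightarrow> ((nat \<times> nat) free_monoid \<Rightarrow>\<^sub>0 'k)) \<Rightarrow> nat \<times> nat \<Rightarrow> 'k lin_op" where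
  "image_family q n b p = eval scal (quantum_torus.x q n) (b p)"

text \<open>Lifts \<open>b p\<close> of the images of the generators, in sorted words: the word \<open>p\<close> itself with coefficient one, and longer
  words.\<close>

locale unipotent_half = quantum_matrices q n for q :: "'k::field" and n :: nat +
  fixes b :: "nat \<times> nat \<Rightarrow> ((nat \<times> nat) free_monoid \<Rightarrow>\<^sub>0 'k)"
  assumes normal_b: "p \<in> grid n \<Longrightarrow> normal (b p)"
    and qmatrix_image: "op_scalars.qmatrix q n n (image_family q n b)"
    and lookup_b: "p \<in> grid n \<Longrightarrow> lookup (b p) (Word [p]) = 1"
    and long_b: "p \<in> grid n \<Longrightarrow> w \<in> keys (b p) \<Longrightarrow> w \<noteq> Word [p] \<Longrightarrow> 2 \<le> word_length w"
begin

abbreviation X :: "nat \<times> nat \<Rightarrow> 'k lin_op" where "X \<equiv> image_family q n b"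

lemma standard_b: "p \<in> grid n \<Longrightarrow> w \<in> keys (b p) \<Longrightarrow> standard n w"
  using normal_b by (auto simp: normal_def)

lemma letters_b: "p \<in> grid n \<Longrightarrow> w \<in> keys (b p) \<Longrightarrow> set (letters w) \<subseteq> grid n"
  using standard_b by (auto simp: standard_def)

lemma gen_in_b: "p \<in> grid n \<Longrightarrow> Word [p] \<in> keys (b p)"
  using lookup_b by (simp add: in_keys_iff)

lemma long_b': "p \<in> grid n \<Longrightarrow> w \<in> keys (b p) \<Longrightarrow> 1 \<le> word_length w"
  using long_b[of p w] by (cases "w = Word [p]") auto

lemma lead_X:
  assumes h: "term_order n h" and p: "p \<in> grid n"
  obtains w c where "w \<in> keys (b p)"
    "\<And>v. v \<in> keys (b p) \<Longrightarrow> h (wexp unit v) \<le> h (wexp unit w)"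
    "c \<noteq> 0" "lead h (X p) (wexp unit w) c"
proof -
  have "inj_on (\<lambda>w. h (wexp unit w)) (keys (b p))"
    using standard_b[OF p] by (rule inj_on_standard[OF h])
  moreover have "b p \<noteq> 0" using gen_in_b[OF p] by auto
  moreover have "\<exists>c. c \<noteq> 0 \<and> lead h (x r) (unit r) c" if "r \<in> grid n" for r
    using lead_x[OF term_orderD(1)[OF h] that] by (intro exI[of _ 1]) simp
  ultimately show ?thesis
    using lead_eval[of h x unit "b p"] term_orderD(2)[OF h] letters_b[OF p] that
    unfolding image_family_def by metis
qed

lemma wexp_gen [simp]: "wexp unit (Word [p]) = unit p"
  by (simp add: wexp_def)

text \<open>Every monomial of \<open>X p - x p\<close> is bounded by the exponent of one of the long words.\<close>

lemma higher_mspan: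
  assumes p: "p \<in> grid n" and h: "admissible n h"
    and P: "\<And>w. w \<in> keys (b p) \<Longrightarrow> w \<noteq> Word [p] \<Longrightarrow>
      (\<And>a. h a \<le> h (wexp unit w) \<Longrightarrow> P a)"
  shows "X p - x p \<in> mspan P"
proof -
  have "X p - x p = eval scal x (b p - gen p)"
    by (simp add: image_family_def op_scalars.eval_diff)
  also have "\<dots> \<in> mspan P"
    unfolding eval_def
  proof (intro mspan_sum mspan_scal)
    fix w assume "w \<in> keys (b p - gen p)"
    then have w: "w \<in> keys (b p)" "w \<noteq> Word [p]"
      using lookup_b[OF p]
      by (auto simp: in_keys_iff lookup_minus gen_def lookup_single when_def split: if_splits)
    have "\<exists>c. c \<noteq> 0 \<and> lead h (x r) (unit r) c" if "r \<in> grid n" for r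
      using lead_x[OF h that] by (intro exI[of _ 1]) simp
    then obtain c where "lead h (word_val x w) (wexp unit w) c"
      using lead_word_val[of h x unit w] admissible_add[OF h] letters_b[OF p w(1)] by metis
    then show "word_val x w \<in> mspan P"
      by (intro mspan_mono[OF lead_mspan_le] P[OF w])
  qed
  finally show ?thesis .
qed

end

text \<open>Two families that are inverse to each other under substitution. The roles of \<open>b\<close> and \<open>c\<close> are interchangeable, and
  the argument uses both.\<close>

locale unipotent_pair = quantum_matrices q n + B: unipotent_half q n b + C: unipotent_half q n c
  for q :: "'k::field" and n :: nat and b c +
  assumes eval_c: "p \<in> grid n \<Longrightarrow> eval scal (image_family q n b) (c p) = quantum_torus.x q n p"
    and eval_b: "p \<in> grid n \<Longrightarrow> eval scal (image_family q n c) (b p) = quantum_torus.x q n p"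
begin

definition words :: "nat \<times> nat \<Rightarrow> (nat \<times> nat) free_monoid set" where
  "words p = keys (b p) \<union> keys (c p)"

end

text \<open>The slopes \<open>s / deg s\<close> of two shifts are compared after multiplication with both degrees.\<close>

locale extremal_shift = unipotent_pair q n b c
  for q :: "'k::field" and n :: nat and b c +
  fixes h :: "expo \<Rightarrow> int poly" and p0 :: "nat \<times> nat" and w0 :: "(nat \<times> nat) free_monoid"
  assumes h: "term_order n h"
    and p0: "p0 \<in> grid n" and w0: "w0 \<in> words p0" "w0 \<noteq> Word [p0]"
    and extremal: "\<And>p w. p \<in> grid n \<Longrightarrow> w \<in> words p \<Longrightarrow>
      smult (int (word_length w0) - 1) (h (wexp unit w - unit p))
        \<le> smult (int (word_length w) - 1) (h (wexp unit w0 - unit p0))"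
begin

definition s :: expo where "s = wexp unit w0 - unit p0"
abbreviation D :: int where "D \<equiv> deg n s"
abbreviation hs :: "expo \<Rightarrow> int poly" where "hs \<equiv> tilt n h s"

lemma standard_words: "p \<in> grid n \<Longrightarrow> w \<in> words p \<Longrightarrow> standard n w"
  unfolding words_def using B.standard_b C.standard_b by blast

lemma letters_words: "p \<in> grid n \<Longrightarrow> w \<in> words p \<Longrightarrow> set (letters w) \<subseteq> grid n"
  using standard_words by (auto simp: standard_def)

lemma supported_words: "p \<in> grid n \<Longrightarrow> w \<in> words p \<Longrightarrow> supported n (wexp unit w)"
  using letters_words by (intro supported_wexp) auto

lemma supported_s: "supported n s"
  using supported_words[OF p0 w0(1)] p0 by (simp add: s_def)

lemma D_eq: "D = int (word_length w0) - 1"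
  using deg_wexp_unit[OF letters_words[OF p0 w0(1)]] p0 by (simp add: s_def)

lemma D_pos: "0 < D"
proof -
  have "2 \<le> word_length w0"
    using w0 p0 B.long_b[of p0 w0] C.long_b[of p0 w0] by (auto simp: words_def)
  then show ?thesis by (simp add: D_eq)
qed

lemma hs: "term_order n hs"
  by (rule term_order_tilt[OF h D_pos])

lemma hs_s: "hs s = [:D:]"
  by (simp add: tilt_def)

lemma deg_words: "p \<in> grid n \<Longrightarrow> w \<in> words p \<Longrightarrow> deg n (wexp unit w) = int (word_length w)"
  using deg_wexp_unit[OF letters_words] by blast

lemma tilt_words:
  assumes "p \<in> grid n" "w \<in> words p"
  shows "smult D (h (wexp unit w)) - smult (int (word_length w)) (h s) \<le> smult D (h (unit p)) - h s"
  using extremal[OF assms] unfolding D_eq[symmetric] s_def[symmetric]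
  by (simp add: term_orderD(3)[OF h] smult_diff_right smult_diff_left algebra_simps)

lemma swap: "extremal_shift q n c b h p0 w0"
proof -
  have "unipotent_pair q n c b"
    by unfold_locales (auto simp: eval_b eval_c)
  moreover have "unipotent_pair.words c b = words"
    using \<open>unipotent_pair q n c b\<close>
    by (auto simp: unipotent_pair.words_def words_def)
  ultimately show ?thesis
    using h p0 w0 extremal by (simp add: extremal_shift_def extremal_shift_axioms_def)
qed

text \<open>By extremality no word of \<open>b p\<close> exceeds \<open>unit p\<close> before the tie break, and \<open>unit p\<close> itself occurs. So the leading
  exponent differs from \<open>unit p\<close> by a nonnegative rational multiple of \<open>s\<close>, namely \<open>d p / D\<close>.\<close>

lemma lead_family:
  obtains f d where
    "\<And>p. p \<in> grid n \<Longrightarrow> \<exists>e. e \<noteq> 0 \<and> lead hs (B.X p) (f p) e"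
    "\<And>p. p \<in> grid n \<Longrightarrow> \<exists>w\<in>keys (b p). f p = wexp unit w"
    "\<And>p v. p \<in> grid n \<Longrightarrow> v \<in> keys (b p) \<Longrightarrow> hs (wexp unit v) \<le> hs (f p)"
    "\<And>p r. p \<in> grid n \<Longrightarrow> D * f p r = D * unit p r + d p * s r"
    "\<And>p. p \<in> grid n \<Longrightarrow> 0 \<le> (d p :: int)"
proof -
  have "\<exists>w. w \<in> keys (b p) \<and>
     (\<forall>v \<in> keys (b p). hs (wexp unit v) \<le> hs (wexp unit w)) \<and>
     (\<exists>e. e \<noteq> 0 \<and> lead hs (B.X p) (wexp unit w) e)" if p: "p \<in> grid n" for p
    by (rule B.lead_X[OF hs p]) blast
  then obtain W where W: "\<And>p. p \<in> grid n \<Longrightarrow> W p \<in> keys (b p)"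
     "\<And>p v. p \<in> grid n \<Longrightarrow> v \<in> keys (b p) \<Longrightarrow> hs (wexp unit v) \<le> hs (wexp unit (W p))"
     "\<And>p. p \<in> grid n \<Longrightarrow> \<exists>e. e \<noteq> 0 \<and> lead hs (B.X p) (wexp unit (W p)) e"
    by metis
  define d where "d p = int (word_length (W p)) - 1" for p
  have "D * wexp unit (W p) r = D * unit p r + d p * s r \<and> 0 \<le> d p" if p: "p \<in> grid n" for p r
  proof -
    have Wp: "W p \<in> words p" using W(1)[OF p] by (simp add: words_def)
    have "hs (unit p) \<le> hs (wexp unit (W p))"
      using W(2)[OF p B.gen_in_b[OF p]] by simp
    then have "smult D (h (unit p)) - h s \<le> smult D (h (wexp unit (W p))) - smult (int (word_length (W p))) (h s)"
      using p deg_words[OF p Wp] by (auto simp: tilt_def pCons_le_iff)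
    with tilt_words[OF p Wp]
    have "smult D (h (wexp unit (W p))) - smult (int (word_length (W p))) (h s) = smult D (h (unit p)) - h s"
      by simp
    then have "h (\<lambda>r. D * wexp unit (W p) r) = h ((\<lambda>r. D * unit p r) + (\<lambda>r. d p * s r))"
      unfolding term_orderD(2,6)[OF h] d_def by (simp add: smult_diff_left algebra_simps)
    moreover have "supported n (\<lambda>r. D * wexp unit (W p) r)"
      "supported n ((\<lambda>r. D * unit p r) + (\<lambda>r. d p * s r))"
      using supported_words[OF p Wp] supported_s p by (auto simp: supported_def unit_def)
    ultimately have "(\<lambda>r. D * wexp unit (W p) r) = (\<lambda>r. D * unit p r) + (\<lambda>r. d p * s r)"
      using term_orderD(7)[OF h] by blast
    then have "D * wexp unit (W p) r = D * unit p r + d p * s r" by (auto dest: fun_cong[of _ _ r])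
    moreover have "0 \<le> d p" using B.long_b'[OF p W(1)[OF p]] unfolding d_def by linarith
    ultimately show ?thesis by simp
  qed
  then show ?thesis using that[of "\<lambda>p. wexp unit (W p)" d] W by blast
qed

lemma hs_box: "(i,j) \<in> grid n \<Longrightarrow> (k,l) \<in> grid n \<Longrightarrow> i < k \<Longrightarrow> j < l \<Longrightarrow>
    smult D (h (unit (i,l)) + h (unit (k,j))) < smult D (h (unit (i,j)) + h (unit (k,l)))"
  using admissible_box[OF term_orderD(1)[OF h]] smult_less_cancel[OF D_pos] by blast

text \<open>For the four-term relation the right hand side is lower than both products on the left, since moving
  along \<open>s\<close> does not change the first component of the tilted order; hence the leading terms commute.\<close>

lemma comm_exp_family:
  assumes f: "\<And>p. p \<in> grid n \<Longrightarrow> \<exists>e. e \<noteq> 0 \<and> lead hs (B.X p) (f p) e"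
    and fd: "\<And>p r. p \<in> grid n \<Longrightarrow> D * f p r = D * unit p r + d p * s r"
    and p: "p \<in> grid n" and r: "r \<in> grid n"
  shows "comm_exp n (f p) (f r) = comm_exp n (unit p) (unit r)"
proof -
  note hs_add = term_orderD(2)[OF hs]
  have qc: "comm_exp n (f p) (f r) = m"
    if pr: "p \<in> grid n" "r \<in> grid n" "op_scalars.qcomm (q powi m) (B.X p) (B.X r)" for p r m
  proof -
    obtain e e' where "e \<noteq> 0" "lead hs (B.X p) (f p) e" "e' \<noteq> 0" "lead hs (B.X r) (f r) e'"
      using f[OF pr(1)] f[OF pr(2)] by blast
    moreover have "B.X p * B.X r - scal (q powi m) * (B.X r * B.X p) \<in> mspan (\<lambda>z. hs z < hs (f p) + hs (f r))"
      using pr(3) by (simp add: op_scalars.qcomm_def op_scalars.smul_def mspan.zero)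
    ultimately show ?thesis by (intro lead_commutator[OF hs_add])
  qed
  \<comment> \<open>the first component of the tilted order does not see multiples of \<open>s\<close>\<close>
  have level: "smult D (h (f p)) - smult (deg n (f p)) (h s) = smult D (h (unit p)) - h s"
    if p: "p \<in> grid n" for p
  proof -
    have eq: "(\<lambda>r. D * f p r) = (\<lambda>r. D * unit p r) + (\<lambda>r. d p * s r)"
      using fd[OF p] by (simp add: fun_eq_iff)
    have 1: "smult D (h (f p)) = smult D (h (unit p)) + smult (d p) (h s)"
      using arg_cong[OF eq, of h] by (simp add: term_orderD(2,6)[OF h])
    have "D * deg n (f p) = D * deg n (unit p) + d p * D"
      using arg_cong[OF eq, of "deg n"] unfolding deg_simps(1) deg_scale .
    then have "D * deg n (f p) = D * (1 + d p)"
      using p by (simp add: algebra_simps)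
    then have "deg n (f p) = 1 + d p" using D_pos by simp
    then show ?thesis by (simp add: 1 smult_add_left)
  qed
  have diag: "comm_exp n (f (i,j)) (f (k,l)) = 0"
    if g: "(i,j) \<in> grid n" "(k,l) \<in> grid n" "i < k" "j < l" for i j k l
  proof -
    have g': "(i,l) \<in> grid n" "(k,j) \<in> grid n" using g by (auto simp: grid_def)
    obtain e1 e2 e3 e4 where e: "e1 \<noteq> 0" "lead hs (B.X (i,j)) (f (i,j)) e1"
      "e2 \<noteq> 0" "lead hs (B.X (k,l)) (f (k,l)) e2"
      "e3 \<noteq> 0" "lead hs (B.X (i,l)) (f (i,l)) e3" "e4 \<noteq> 0" "lead hs (B.X (k,j)) (f (k,j)) e4"
      using f g g' by metis
    have "hs (f (i,l) + f (k,j)) < hs (f (i,j) + f (k,l))"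
    proof -
      have "smult D (h (f (i,l) + f (k,j))) - smult (deg n (f (i,l) + f (k,j))) (h s)
        = (smult D (h (f (i,l))) - smult (deg n (f (i,l))) (h s))
          + (smult D (h (f (k,j))) - smult (deg n (f (k,j))) (h s))"
        by (simp add: term_orderD(2)[OF h] smult_add_right smult_add_left)
      also have "\<dots> < (smult D (h (f (i,j))) - smult (deg n (f (i,j))) (h s))
          + (smult D (h (f (k,l))) - smult (deg n (f (k,l))) (h s))"
        using hs_box[OF g] g g' by (simp add: level smult_add_right)
      also have "\<dots> = smult D (h (f (i,j) + f (k,l))) - smult (deg n (f (i,j) + f (k,l))) (h s)"
        by (simp add: term_orderD(2)[OF h] smult_add_right smult_add_left)
      finally show ?thesis unfolding tilt_def pCons_less_iff by blast
    qed
    then have lt: "hs (f (i,l)) + hs (f (k,j)) < hs (f (i,j)) + hs (f (k,l))"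
      by (simp add: hs_add)
    have "B.X (i,j) * B.X (k,l) - B.X (k,l) * B.X (i,j) = scal (q - 1/q) * (B.X (i,l) * B.X (k,j))"
      using op_scalars.qmatrixD(4)[OF B.qmatrix_image, of i j k l] g
      by (simp add: grid_def op_scalars.smul_def)
    moreover have "scal (q - 1/q) * (B.X (i,l) * B.X (k,j)) \<in> mspan (\<lambda>z. hs z < hs (f (i,j)) + hs (f (k,l)))"
      by (rule mspan_scal, rule mspan_mono[OF lead_mspan_le[OF lead_mult[OF hs_add e(6) e(8)]]])
         (use lt in \<open>auto simp: hs_add\<close>)
    ultimately show ?thesis
      using lead_commutator[OF hs_add e(2,1) e(4,3), of 0] by simp
  qed
  have main: "comm_exp n (f p) (f r) = comm_exp n (unit p) (unit r)"
    if p: "p \<in> grid n" and r: "r \<in> grid n" and pr: "p < r" for p r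
  proof -
    obtain i j k l where ij: "p = (i,j)" "r = (k,l)" by (metis surj_pair)
    have g: "i \<in> {1..n}" "j \<in> {1..n}" "k \<in> {1..n}" "l \<in> {1..n}" using p r by (auto simp: ij grid_def)
    note D = op_scalars.qmatrixD[OF B.qmatrix_image g(1,2)]
    consider "i = k" "j < l" | "i < k" "j = l" | "i < k" "l < j" | "i < k" "j < l"
      using pr by (auto simp: ij less_prod_def') (metis nat_neq_iff)
    then show ?thesis
    proof cases
      case 1
      then show ?thesis using qc[OF p r, of 1] D(2)[of l] g p r
        by (simp add: comm_exp_unit_unit ij precedes_def)
    next
      case 2
      then show ?thesis using qc[OF p r, of 1] D(1)[of k] g p r
        by (simp add: comm_exp_unit_unit ij precedes_def)
    next
      case 3
      then show ?thesis using qc[OF p r, of 0] D(3)[of k l] g p r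
        by (simp add: comm_exp_unit_unit ij precedes_def)
    next
      case 4
      then show ?thesis using diag[of i j k l] p r
        by (simp add: comm_exp_unit_unit ij precedes_def)
    qed
  qed
  consider "p < r" | "p = r" | "r < p" by force
  then show ?thesis
  proof cases
    case 3
    then show ?thesis
      using main[OF r p] comm_exp_anti[of n "f p" "f r"] comm_exp_anti[of n "unit p" "unit r"] by simp
  qed (use main[OF p r] in auto)
qed

lemma mono_words:
  assumes f: "\<And>p. p \<in> grid n \<Longrightarrow> hs (unit p) \<le> hs (f p)" and w: "set (letters w) \<subseteq> grid n"
  shows "hs (wexp unit w) \<le> hs (wexp f w)"
proof -
  have "set ps \<subseteq> grid n \<Longrightarrow> hs (sum_list (map unit ps)) \<le> hs (sum_list (map f ps))" for ps
    by (induction ps) (use f in \<open>simp_all add: term_orderD(2)[OF hs] add_mono\<close>)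
  then show ?thesis using w by (simp add: wexp_def)
qed

text \<open>Substituting the \<open>X p\<close> into \<open>c p\<close> yields \<open>x p\<close>, whose leading exponent is \<open>unit p\<close>. Without cancellation every
  word of \<open>c p\<close> then has substituted exponent at most \<open>unit p\<close>, and substitution only raises exponents.\<close>

lemma bounded_if_injective:
  assumes f: "\<And>p. p \<in> grid n \<Longrightarrow> \<exists>e. e \<noteq> 0 \<and> lead hs (B.X p) (f p) e"
    and fge: "\<And>p. p \<in> grid n \<Longrightarrow> hs (unit p) \<le> hs (f p)"
    and inj: "\<And>v w. standard n v \<Longrightarrow> standard n w \<Longrightarrow> wexp f v = wexp f w \<Longrightarrow> v = w"
    and p: "p \<in> grid n" and w: "w \<in> keys (c p)"
  shows "hs (wexp unit w) \<le> hs (unit p)"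
proof -
  have supp: "supported n (wexp f v)" if "v \<in> keys (c p)" for v
    using f C.letters_b[OF p that] by (intro supported_wexp) (auto dest: lead_supported)
  have 1: "inj_on (\<lambda>w. hs (wexp f w)) (keys (c p))"
  proof (rule inj_onI)
    fix v w assume vw: "v \<in> keys (c p)" "w \<in> keys (c p)"
      "hs (wexp f v) = hs (wexp f w)"
    then have "wexp f v = wexp f w" using term_orderD(7)[OF hs] supp by blast
    then show "v = w" using C.standard_b[OF p] vw(1,2) inj by blast
  qed
  have 2: "c p \<noteq> 0" using C.gen_in_b[OF p] by auto
  have letters: "\<And>w. w \<in> keys (c p) \<Longrightarrow> set (letters w) \<subseteq> grid n"
    using C.letters_b[OF p] by blast
  obtain w1 e where w1: "w1 \<in> keys (c p)"
    "\<And>v. v \<in> keys (c p) \<Longrightarrow> hs (wexp f v) \<le> hs (wexp f w1)"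
    "e \<noteq> 0" "lead hs (eval scal B.X (c p)) (wexp f w1) e"
    using lead_eval[of hs B.X f "c p" thesis, OF term_orderD(2)[OF hs] f 2 letters 1] by fast
  have "lead hs (x p) (unit p) 1" by (rule lead_x[OF term_orderD(1)[OF hs] p])
  then have "wexp f w1 = unit p"
    using lead_unique[OF w1(4) _ w1(3)] by (simp add: eval_c[OF p])
  then have "hs (wexp f w) \<le> hs (unit p)" using w1(2)[OF w] by simp
  with mono_words[OF fge C.letters_b[OF p w]] show ?thesis by (rule order_trans)
qed

lemma not_both_bounded:
  assumes "\<And>p w. p \<in> grid n \<Longrightarrow> w \<in> words p \<Longrightarrow> hs (wexp unit w) \<le> hs (unit p)"
  shows False
proof -
  have "hs (wexp unit w0) \<le> hs (unit p0)" using assms p0 w0 by blast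
  moreover have "wexp unit w0 = s + unit p0" by (simp add: s_def)
  ultimately have "hs s \<le> 0" by (simp add: term_orderD(2)[OF hs])
  then show False using D_pos pCons_le_iff[of D 0 0 0] by (simp add: hs_s)
qed

lemma unit_if_bounded:
  assumes "\<And>w. w \<in> keys (b p) \<Longrightarrow> hs (wexp unit w) \<le> hs (unit p)"
    and p: "p \<in> grid n" and f: "f \<in> wexp unit ` keys (b p)" "hs (unit p) \<le> hs f"
  shows "f = unit p"
proof -
  have "hs f \<le> hs (unit p)" using assms(1) f(1) by blast
  then have "hs f = hs (unit p)" using f(2) by (rule antisym)
  moreover have "supported n f" using f(1) B.letters_b[OF p] by (auto intro!: supported_wexp)
  ultimately show ?thesis using term_orderD(7)[OF hs] p by simp
qed

text \<open>Injectivity would bound the words of \<open>c\<close>, so the leading exponents of the inverse family are the unit vectors.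
  These are injective again, which bounds the words of \<open>b\<close> and leaves no room for \<open>s\<close>.\<close>

lemma not_injective:
  assumes f: "\<And>p. p \<in> grid n \<Longrightarrow> \<exists>e. e \<noteq> 0 \<and> lead hs (B.X p) (f p) e"
    and fge: "\<And>p. p \<in> grid n \<Longrightarrow> hs (unit p) \<le> hs (f p)"
  shows "\<exists>v w. standard n v \<and> standard n w \<and> wexp f v = wexp f w \<and> v \<noteq> w"
proof (rule ccontr)
  assume "\<not> ?thesis"
  then have inj: "\<And>v w. standard n v \<Longrightarrow> standard n w \<Longrightarrow> wexp f v = wexp f w \<Longrightarrow> v = w" by blast
  have c: "hs (wexp unit w) \<le> hs (unit p)" if "p \<in> grid n" "w \<in> keys (c p)" for p w
    by (rule bounded_if_injective[OF f fge inj that])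
  interpret S: extremal_shift q n c b h p0 w0 by (rule swap)
  have b: "hs (wexp unit w) \<le> hs (unit p)" if p: "p \<in> grid n" and w: "w \<in> keys (b p)" for p w
  proof (rule S.bounded_if_injective[of unit, OF _ _ _ p w])
    fix r assume r: "r \<in> grid n"
    obtain v e where v: "v \<in> keys (c r)"
      "\<And>u. u \<in> keys (c r) \<Longrightarrow> hs (wexp unit u) \<le> hs (wexp unit v)"
      "e \<noteq> 0" "lead hs (C.X r) (wexp unit v) e"
    proof (rule C.lead_X[OF hs r], goal_cases)
      case (1 w e)
      show ?case by (rule 1(1)[OF 1(2-)])
    qed
    have "wexp unit v = unit r"
      by (rule S.unit_if_bounded[OF c[OF r] r])
         (use v(1) v(2)[OF C.gen_in_b[OF r]] in simp_all)
    then show "\<exists>e. e \<noteq> 0 \<and> lead hs (C.X r) (unit r) e" using v(3,4) by auto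
  next
    fix v w assume "standard n v" "standard n w" "wexp unit v = wexp unit w"
    then show "v = w" by (rule standard_eqI)
  qed simp
  show False by (rule not_both_bounded) (use b c in \<open>unfold words_def, blast\<close>)
qed

text \<open>Write \<open>\<lambda> p\<close> for the pairing of \<open>unit p\<close> with \<open>s\<close>. Invariance of the skew form gives \<open>d r \<lambda> p = d p \<lambda> r\<close>. A
  coincidence of leading exponents gives \<open>\<Sum> s p d p = - D\<close>. If some \<open>\<lambda> r\<close> were nonzero, \<open>d\<close> would be proportional to
  \<open>\<lambda>\<close>, and the sum would be a multiple of the pairing of \<open>s\<close> with itself, which is zero. So \<open>s\<close> is central; as
  \<open>d \<ge> 0\<close>, the negative sum needs a negative entry of \<open>s\<close>, which is only possible at \<open>p0\<close>. A leading exponent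
  other than that at \<open>p0\<close> cannot involve \<open>s\<close>, because its entry at \<open>p0\<close> would be negative.\<close>

theorem extremal_central:
  shows "\<forall>p\<in>grid n. comm_exp n (unit p) s = 0" and "s p0 = -1"
    and "\<And>p. p \<in> grid n \<Longrightarrow> \<exists>e. e \<noteq> 0 \<and> lead hs (B.X p) (if p = p0 then unit p0 + s else unit p) e"
    and "\<And>p w. p \<in> grid n \<Longrightarrow> p \<noteq> p0 \<Longrightarrow> w \<in> keys (b p) \<Longrightarrow> hs (wexp unit w) \<le> hs (unit p)"
proof -
  obtain f d where f: "\<And>p. p \<in> grid n \<Longrightarrow> \<exists>e. e \<noteq> 0 \<and> lead hs (B.X p) (f p) e"
    and fw: "\<And>p. p \<in> grid n \<Longrightarrow> \<exists>w\<in>keys (b p). f p = wexp unit w"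
    and fmax: "\<And>p v. p \<in> grid n \<Longrightarrow> v \<in> keys (b p) \<Longrightarrow> hs (wexp unit v) \<le> hs (f p)"
    and fd: "\<And>p r. p \<in> grid n \<Longrightarrow> D * f p r = D * unit p r + d p * s r"
    and d: "\<And>p. p \<in> grid n \<Longrightarrow> 0 \<le> (d p :: int)"
  proof (rule lead_family, goal_cases)
    case (1 f d)
    show ?case by (rule 1(1)[OF 1(2-6)])
  qed
  have fge: "hs (unit p) \<le> hs (f p)" if "p \<in> grid n" for p
    using fmax[OF that B.gen_in_b[OF that]] by simp
  define lam where "lam p = comm_exp n (unit p) s" for p
  define ds where "ds = (\<Sum>p\<in>grid n. s p * d p)"
  have proportional: "d r * lam p = d p * lam r" if p: "p \<in> grid n" and r: "r \<in> grid n" for p r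
  proof -
    have eq: "(\<lambda>z. D * f p z) = (\<lambda>z. D * unit p z) + (\<lambda>z. d p * s z)" if "p \<in> grid n" for p
      using fd[OF that] by (simp add: fun_eq_iff)
    have "comm_exp n (\<lambda>z. D * f p z) (\<lambda>z. D * f r z) = D * (D * comm_exp n (unit p) (unit r))"
      by (simp only: comm_exp_scale comm_exp_family[OF f fd p r])
    moreover have "comm_exp n (\<lambda>z. D * f p z) (\<lambda>z. D * f r z)
      = D * (D * comm_exp n (unit p) (unit r)) + D * (d r * lam p) - D * (d p * lam r)"
      unfolding eq[OF p] eq[OF r]
      by (simp add: comm_exp_add_left comm_exp_add_right comm_exp_scale lam_def
        comm_exp_anti[of n s "unit r"] right_diff_distrib)
    ultimately have "D * (d r * lam p) = D * (d p * lam r)" by simp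
    then show ?thesis using D_pos by simp
  qed
  \<comment> \<open>a coincidence of leading exponents forces the shift to cancel against itself\<close>
  have ds: "ds = - D"
  proof -
    obtain v w where vw: "standard n v" "standard n w" "wexp f v = wexp f w" "v \<noteq> w"
      using not_injective[OF f fge] by blast
    have lw: "set (letters v) \<subseteq> grid n" "set (letters w) \<subseteq> grid n"
      using vw by (auto simp: standard_def)
    define u where "u = wexp unit v - wexp unit w"
    define du where "du = (\<Sum>p\<in>grid n. u p * d p)"
    have su: "supported n u" using lw by (simp add: u_def supported_wexp)
    have key: "D * u r + du * s r = 0" for r
    proof -
      have "(\<Sum>p\<in>grid n. u p * f p r) = 0"
        using fun_cong[OF vw(3), of r] wexp_eq_sum[OF lw(1), of f r] wexp_eq_sum[OF lw(2), of f r]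
        by (simp add: u_def left_diff_distrib sum_subtractf)
      then have "0 = D * (\<Sum>p\<in>grid n. u p * f p r)" by simp
      also have "\<dots> = (\<Sum>p\<in>grid n. u p * (D * f p r))"
        unfolding sum_distrib_left by (intro sum.cong refl) (rule mult.left_commute)
      also have "\<dots> = (\<Sum>p\<in>grid n. D * (u p * unit p r) + u p * d p * s r)"
        by (intro sum.cong refl, subst fd) (simp_all add: algebra_simps)
      also have "\<dots> = D * (\<Sum>p\<in>grid n. u p * unit p r) + du * s r"
        by (simp add: sum.distrib sum_distrib_left sum_distrib_right du_def)
      also have "(\<Sum>p\<in>grid n. u p * unit p r) = (\<Sum>p\<in>grid n. if p = r then u r else 0)"
        by (intro sum.cong) (auto simp: unit_def)
      also have "\<dots> = u r" using su[unfolded supported_def, rule_format, of r] by auto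
      finally show ?thesis by simp
    qed
    have "u \<noteq> 0"
    proof
      assume "u = 0"
      then have "wexp unit v = wexp unit w" by (simp add: u_def)
      with vw(4) standard_eqI[OF vw(1,2)] show False by blast
    qed
    then obtain r where "u r \<noteq> 0" by (auto simp: fun_eq_iff)
    then have "du \<noteq> 0" using key[of r] D_pos by auto
    have "(\<Sum>r\<in>grid n. (D * u r + du * s r) * d r)
        = (\<Sum>r\<in>grid n. D * (u r * d r)) + (\<Sum>r\<in>grid n. du * (s r * d r))"
      unfolding sum.distrib[symmetric] by (intro sum.cong refl) (simp add: algebra_simps)
    also have "\<dots> = D * du + du * ds"
      by (simp only: du_def ds_def sum_distrib_left)
    finally have "(\<Sum>r\<in>grid n. (D * u r + du * s r) * d r) = D * du + du * ds" .
    moreover have "(\<Sum>r\<in>grid n. (D * u r + du * s r) * d r) = 0"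
      by (simp only: key mult_zero_left sum.neutral_const)
    ultimately have "du * (D + ds) = 0" by (simp add: algebra_simps)
    with \<open>du \<noteq> 0\<close> show ?thesis by simp
  qed
  have lam0: "lam r = 0" if r: "r \<in> grid n" for r
  proof -
    have "ds * lam r = (\<Sum>p\<in>grid n. s p * (d p * lam r))"
      by (simp add: ds_def sum_distrib_right mult.assoc)
    also have "\<dots> = (\<Sum>p\<in>grid n. d r * (s p * lam p))"
      by (intro sum.cong refl) (use proportional[OF _ r] in \<open>simp add: algebra_simps\<close>)
    also have "\<dots> = d r * comm_exp n s s"
      unfolding comm_exp_eq_sum[of n s s] by (simp add: sum_distrib_left lam_def)
    finally show ?thesis using ds D_pos by simp
  qed
  then show "\<forall>p\<in>grid n. comm_exp n (unit p) s = 0" by (simp add: lam_def)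
  obtain r where r: "r \<in> grid n" "s r * d r < 0"
  proof -
    have "\<not> (\<forall>r\<in>grid n. 0 \<le> s r * d r)"
      using sum_nonneg[of "grid n" "\<lambda>r. s r * d r"] ds D_pos by (auto simp: ds_def)
    then show ?thesis using that by force
  qed
  then have "s r < 0" using d[OF r(1)] by (simp add: mult_less_0_iff)
  moreover have s_ge: "0 \<le> s r" if "r \<noteq> p0" for r
    using that wexp_unit_nonneg[of w0 r] by (simp add: s_def unit_def)
  moreover have "- 1 \<le> s p0" using wexp_unit_nonneg[of w0 p0] by (simp add: s_def unit_def)
  ultimately have "r = p0" using s_ge[of r] by linarith
  then show s0: "s p0 = -1" using \<open>s r < 0\<close> \<open>- 1 \<le> s p0\<close> by simp
  have d0: "d p = 0" if p: "p \<in> grid n" "p \<noteq> p0" for p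
  proof -
    obtain w where "f p = wexp unit w" using fw p by blast
    then have "0 \<le> D * f p p0" using wexp_unit_nonneg[of w p0] D_pos by simp
    then show ?thesis using fd[OF p(1), of p0] p s0 d[OF p(1)] by (simp add: unit_def)
  qed
  have f_old: "f p = unit p" if p: "p \<in> grid n" "p \<noteq> p0" for p
    using fd[OF p(1)] d0[OF p] D_pos by (auto simp: fun_eq_iff)
  have "ds = s p0 * d p0 + (\<Sum>p\<in>grid n - {p0}. s p * d p)"
    unfolding ds_def using p0 by (simp add: sum.remove)
  also have "(\<Sum>p\<in>grid n - {p0}. s p * d p) = 0" using d0 by (intro sum.neutral) auto
  finally have "d p0 = D" using s0 ds by simp
  then have "D * f p0 r = D * (unit p0 r + s r)" for r
    using fd[OF p0, of r] by (simp add: algebra_simps)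
  then have f_new: "f p0 = unit p0 + s" using D_pos by (auto simp: fun_eq_iff)
  show "\<exists>e. e \<noteq> 0 \<and> lead hs (B.X p) (if p = p0 then unit p0 + s else unit p) e"
    if "p \<in> grid n" for p
    using f[OF that] f_old[OF that] f_new by auto
  show "hs (wexp unit w) \<le> hs (unit p)"
    if "p \<in> grid n" "p \<noteq> p0" "w \<in> keys (b p)" for p w
    using fmax[OF that(1,3)] f_old[OF that(1,2)] by simp
qed

end


section \<open>Excluding shifts of the corner generators\<close>

context extremal_shift
begin

text \<open>Apply the automorphism to the four-term relation on the box with corners \<open>\<alpha>\<close>, \<open>\<beta>\<close>, \<open>p0\<close>, \<open>p'\<close>. The right hand side
  has leading exponent \<open>E = unit p0 + s + unit p'\<close>. On the left, a word \<open>w\<close> of \<open>X \<alpha>\<close> could only reach \<open>E\<close> if its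
  shift, projected along \<open>s\<close>, lay between minus the box and zero. The assumption \<open>wall\<close> (the box is
  infinitesimal) then makes the projection agree at the three corners with a nonpositive multiple of the
  box, and the entries at the opposite corner and at \<open>p0\<close>, which are nonnegative for \<open>w\<close>, exclude this.\<close>

lemma no_corner_shift:
  assumes grid: "\<alpha> \<in> grid n" "\<beta> \<in> grid n" "p' \<in> grid n"
    and distinct: "\<alpha> \<noteq> p0" "\<beta> \<noteq> p0" "p' \<noteq> p0" "\<alpha> \<noteq> \<beta>"
    and relX: "B.X \<alpha> * B.X \<beta> - B.X \<beta> * B.X \<alpha> = scal (q - 1/q) * (B.X p0 * B.X p')"
    and relx: "x \<alpha> * x \<beta> - x \<beta> * x \<alpha> = scal (q - 1/q) * (x p0 * x p')"
    and s0: "s \<alpha> = 0" "s \<beta> = 0"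
    and wall: "\<And>v. supported n v \<Longrightarrow>
        - smult D (h (unit \<alpha> + unit \<beta> - unit p0 - unit p')) \<le> h v \<Longrightarrow> h v \<le> 0 \<Longrightarrow>
        v \<alpha> = - v p0 \<and> v \<beta> = - v p0 \<and> 0 \<le> v p0"
  shows False
proof -
  define E where "E = unit p0 + s + unit p'"
  note hs_add = term_orderD(2)[OF hs]
  have small: "hs (wexp unit w) + hs (unit \<delta>) < hs E"
    if \<gamma>: "\<gamma> \<in> grid n" "\<delta> \<in> grid n" "\<delta> \<noteq> \<gamma>" "\<gamma> \<noteq> p0" "s \<delta> = 0"
      "unit \<gamma> + unit \<delta> = unit \<alpha> + unit \<beta>"
      "\<And>v::expo. v \<alpha> = - v p0 \<Longrightarrow> v \<beta> = - v p0 \<Longrightarrow> v \<delta> = - v p0"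
      and w: "w \<in> keys (b \<gamma>)" "w \<noteq> Word [\<gamma>]" for \<gamma> \<delta> w
  proof (rule ccontr)
    assume "\<not> ?thesis"
    then have le: "hs E \<le> hs (wexp unit w + unit \<delta>)" by (simp add: hs_add)
    define v where "v = (\<lambda>r. D * (wexp unit w - unit \<gamma>) r) - (\<lambda>r. (int (word_length w) - 1) * s r)"
    have ww: "w \<in> words \<gamma>" using w by (simp add: words_def)
    have hv: "h v = smult D (h (wexp unit w)) - smult D (h (unit \<gamma>))
        - smult (int (word_length w)) (h s) + h s"
      unfolding v_def term_orderD(3)[OF h] term_orderD(6)[OF h]
      by (simp add: smult_diff_right smult_diff_left)
    have "smult D (h E) - smult (deg n E) (h s)
        \<le> smult D (h (wexp unit w + unit \<delta>)) - smult (deg n (wexp unit w + unit \<delta>)) (h s)"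
      using le unfolding tilt_def pCons_le_iff by auto
    moreover have "deg n E = D + 2" using p0 grid by (simp add: E_def)
    moreover have "deg n (wexp unit w + unit \<delta>) = int (word_length w) + 1"
      using deg_words[OF \<gamma>(1) ww] \<gamma>(2) by simp
    ultimately have "smult D (h E) - smult (D + 2) (h s)
        \<le> smult D (h (wexp unit w + unit \<delta>)) - smult (int (word_length w) + 1) (h s)"
      by (simp only:)
    moreover have "smult (D + 2) (h s) = smult D (h s) + h s + h s"
      using smult_add_left[of D 2 "h s"] smult_add_left[of 1 1 "h s"] by simp
    moreover have "smult (int (word_length w) + 1) (h s) = smult (int (word_length w)) (h s) + h s"
      by (simp only: smult_add_left smult_1_left)
    ultimately have "smult D (h (unit p0)) + smult D (h (unit p')) - smult D (h (unit \<gamma>)) - smult D (h (unit \<delta>)) \<le> h v"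
      by (simp only: E_def term_orderD(2)[OF h] smult_add_right hv)
    moreover have "h (unit \<gamma>) + h (unit \<delta>) = h (unit \<alpha>) + h (unit \<beta>)"
      using arg_cong[OF \<gamma>(6), of h] by (simp add: term_orderD(2)[OF h])
    then have "smult D (h (unit \<gamma>)) + smult D (h (unit \<delta>)) = smult D (h (unit \<alpha>)) + smult D (h (unit \<beta>))"
      by (simp flip: smult_add_right)
    ultimately have "- smult D (h (unit \<alpha> + unit \<beta> - unit p0 - unit p')) \<le> h v"
      by (simp add: term_orderD(2,3)[OF h] smult_add_right smult_diff_right algebra_simps)
    moreover have "h v \<le> 0"
      using tilt_words[OF \<gamma>(1) ww] by (simp add: hv algebra_simps)
    moreover have "supported n v"
      using supported_words[OF \<gamma>(1) ww] supported_s \<gamma>(1)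
      by (simp add: supported_def v_def unit_def)
    ultimately have v: "v \<alpha> = - v p0" "v \<beta> = - v p0" "0 \<le> v p0" using wall by blast+
    have "v \<delta> = D * wexp unit w \<delta>" using \<gamma>(3,5) by (simp add: v_def unit_def)
    then have "0 \<le> v \<delta>" using D_pos wexp_unit_nonneg[of w \<delta>] by simp
    then have "v p0 = 0" using \<gamma>(7)[OF v(1,2)] v(3) by simp
    moreover have "v p0 = D * wexp unit w p0 + (int (word_length w) - 1)"
      using \<gamma>(4) extremal_central(2) by (simp add: v_def unit_def)
    moreover have "2 \<le> word_length w" by (rule B.long_b[OF \<gamma>(1) w])
    moreover have "0 \<le> D * wexp unit w p0" using D_pos wexp_unit_nonneg[of w p0] by simp
    ultimately show False by simp
  qed
  have smallA: "hs (wexp unit w) + hs (unit \<beta>) < hs E"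
    if "w \<in> keys (b \<alpha>)" "w \<noteq> Word [\<alpha>]" for w
    using distinct(4) by (intro small[OF grid(1,2) _ distinct(1) s0(2) refl _ that]) simp_all
  have smallB: "hs (wexp unit w) + hs (unit \<alpha>) < hs E"
    if "w \<in> keys (b \<beta>)" "w \<noteq> Word [\<beta>]" for w
    using distinct(4) by (intro small[OF grid(2,1) _ distinct(2) s0(1) add.commute _ that]) simp_all
  have lead_old: "\<exists>e. e \<noteq> 0 \<and> lead hs (B.X p) (unit p) e" if "p \<in> grid n" "p \<noteq> p0" for p
    using extremal_central(3)[OF that(1)] that(2) by simp
  obtain e where e: "e \<noteq> 0" "lead hs (B.X p0) (unit p0 + s) e"
    using extremal_central(3)[OF p0] by auto
  obtain e' where e': "e' \<noteq> 0" "lead hs (B.X p') (unit p') e'"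
    using lead_old[OF grid(3) distinct(3)] by auto
  obtain e'' where e'': "lead hs (B.X \<beta>) (unit \<beta>) e''"
    using lead_old[OF grid(2) distinct(2)] by auto
  have "lead hs (B.X p0 * B.X p') E (e * e' * q powi twist n (unit p0 + s) (unit p'))"
    unfolding E_def by (rule lead_mult[OF hs_add e(2) e'(2)])
  then have 1: "coef (scal (q - 1/q) * (B.X p0 * B.X p')) E \<noteq> 0"
    using e e' q q_not_inverse by (simp add: lead_coef)
  let ?L = "mspan (\<lambda>a. hs a < hs E)"
  define u where "u = B.X \<alpha> - x \<alpha>"
  define w where "w = B.X \<beta> - x \<beta>"
  have u: "u \<in> mspan (\<lambda>a. hs a + hs (unit \<beta>) < hs E)"
    unfolding u_def
    by (rule B.higher_mspan[OF grid(1) term_orderD(1)[OF hs]])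
       (rule order.strict_trans1[OF add_right_mono smallA])
  have w: "w \<in> mspan (\<lambda>a. hs a + hs (unit \<alpha>) < hs E)"
    unfolding w_def
    by (rule B.higher_mspan[OF grid(2) term_orderD(1)[OF hs]])
       (rule order.strict_trans1[OF add_right_mono smallB])
  have X\<beta>: "B.X \<beta> \<in> mspan (\<lambda>a. hs a \<le> hs (unit \<beta>))" by (rule lead_mspan_le[OF e''])
  have x\<alpha>: "x \<alpha> \<in> mspan (\<lambda>a. hs a \<le> hs (unit \<alpha>))"
    by (rule lead_mspan_le[OF lead_x[OF term_orderD(1)[OF hs] grid(1)]])
  have lt: "a1 + a2 < z" "a2 + a1 < z" if "a1 + y < z" "a2 \<le> y" for a1 a2 y z :: "int poly"
  proof -
    have "a1 + a2 \<le> a1 + y" using that(2) by (rule add_left_mono)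
    then show "a1 + a2 < z" using that(1) by (rule order.strict_trans1)
    then show "a2 + a1 < z" by (simp only: add.commute)
  qed
  have "u * B.X \<beta> - B.X \<beta> * u \<in> ?L"
  proof (rule mspan_diff)
    show "u * B.X \<beta> \<in> ?L"
      by (rule mspan_mult[OF u X\<beta>], unfold hs_add, erule lt(1), assumption)
    show "B.X \<beta> * u \<in> ?L"
      by (rule mspan_mult[OF X\<beta> u], unfold hs_add, rule lt(2), assumption+)
  qed
  moreover have "x \<alpha> * w - w * x \<alpha> \<in> ?L"
  proof (rule mspan_diff)
    show "x \<alpha> * w \<in> ?L"
      by (rule mspan_mult[OF x\<alpha> w], unfold hs_add, rule lt(2), assumption+)
    show "w * x \<alpha> \<in> ?L"
      by (rule mspan_mult[OF w x\<alpha>], unfold hs_add, erule lt(1), assumption)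
  qed
  moreover have "x \<alpha> * x \<beta> - x \<beta> * x \<alpha> \<in> ?L"
  proof -
    have "lead hs (x p0 * x p') (unit p0 + unit p') (1 * 1 * q powi twist n (unit p0) (unit p'))"
      by (intro lead_mult[OF hs_add] lead_x[OF term_orderD(1)[OF hs]] p0 grid)
    moreover have "0 < hs s" using D_pos pCons_less_iff[of 0 0 D 0] by (simp add: hs_s)
    then have "hs (unit p0 + unit p') < hs E" by (simp add: E_def hs_add)
    ultimately have "x p0 * x p' \<in> ?L"
      by (intro mspan_mono[OF lead_mspan_le]) (auto intro: order.strict_trans1)
    then show ?thesis unfolding relx by (rule mspan_scal)
  qed
  ultimately have "(u * B.X \<beta> - B.X \<beta> * u) + (x \<alpha> * w - w * x \<alpha>) + (x \<alpha> * x \<beta> - x \<beta> * x \<alpha>) \<in> ?L"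
    by (intro mspan_add)
  also have "(u * B.X \<beta> - B.X \<beta> * u) + (x \<alpha> * w - w * x \<alpha>) + (x \<alpha> * x \<beta> - x \<beta> * x \<alpha>)
      = scal (q - 1/q) * (B.X p0 * B.X p')"
    unfolding relX[symmetric] u_def w_def by (simp add: algebra_simps)
  finally show False using coef_mspan(1)[OF _ 1] by blast
qed

end


section \<open>Lexicographic term orders\<close>

text \<open>The last key of the list has the highest priority, as its value is the highest coefficient.\<close>

primrec lex_poly :: "(expo \<Rightarrow> int) list \<Rightarrow> expo \<Rightarrow> int poly" where
  "lex_poly [] a = 0"
| "lex_poly (k # ks) a = pCons (k a) (lex_poly ks a)"

definition linear_key :: "(expo \<Rightarrow> int) \<Rightarrow> bool" where
  "linear_key k \<longleftrightarrow> (\<forall>a b. k (a + b) = k a + k b) \<and> (\<forall>c a. k (\<lambda>p. c * a p) = c * k a)"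

lemma lex_poly_eq_0: "lex_poly ks a = 0 \<longleftrightarrow> (\<forall>k\<in>set ks. k a = 0)"
  by (induction ks) auto

lemma lex_poly_linear:
  assumes "\<forall>k\<in>set ks. linear_key k"
  shows "lex_poly ks (a + b) = lex_poly ks a + lex_poly ks b"
    and "lex_poly ks (\<lambda>p. c * a p) = smult c (lex_poly ks a)"
  using assms by (induction ks) (auto simp: linear_key_def)

lemma lex_poly_snoc_0: "k a = 0 \<Longrightarrow> lex_poly (ks @ [k]) a = lex_poly ks a"
  by (induction ks) auto

lemma pCons_pos: "0 < p \<Longrightarrow> 0 < pCons (a::int) p"
  using pCons_less_iff[of 0 0 a p] by simp

lemma pCons_0_pos: "0 < a \<Longrightarrow> 0 < pCons (a::int) 0"
  using pCons_less_iff[of 0 0 a 0] by simp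

lemma lex_poly_snoc_pos: "0 < k a \<Longrightarrow> 0 < lex_poly (ks @ [k]) a"
  by (induction ks) (auto simp: pCons_pos pCons_0_pos)

lemma term_order_lex_poly:
  assumes lin: "\<forall>k\<in>set ks. linear_key k"
    and inj: "\<And>a. supported n a \<Longrightarrow> (\<And>k. k \<in> set ks \<Longrightarrow> k a = 0) \<Longrightarrow> a = 0"
    and pos: "\<And>i j k l. (i,j) \<in> grid n \<Longrightarrow> (k,l) \<in> grid n \<Longrightarrow> i < k \<Longrightarrow> j < l \<Longrightarrow>
      0 < lex_poly ks (box i j k l)"
  shows "term_order n (lex_poly ks)"
  using lex_poly_linear[OF lin] inj pos
  by (auto simp: term_order_def admissible_def lex_poly_eq_0)

definition coords :: "nat \<Rightarrow> (expo \<Rightarrow> int) list" where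
  "coords n = map (\<lambda>p a. a p) (sorted_list_of_set (grid n))"

lemma coords_eq_0: "supported n a \<Longrightarrow> (\<And>k. k \<in> set (coords n) \<Longrightarrow> k a = 0) \<Longrightarrow> a = 0"
  unfolding coords_def supported_def fun_eq_iff by (metis (no_types, lifting) finite_grid image_eqI
    list.set_map set_sorted_list_of_set zero_fun_apply)

lemma linear_key_coord [simp]: "linear_key (\<lambda>a. a p)"
  by (simp add: linear_key_def)

lemma linear_coords [simp]: "k \<in> set (coords n) \<Longrightarrow> linear_key k"
  by (auto simp: coords_def)

text \<open>The product \<open>i j\<close> is strictly supermodular, which makes boxes positive.\<close>

definition weight :: "nat \<Rightarrow> expo \<Rightarrow> int" where
  "weight n a = (\<Sum>p\<in>grid n. int (fst p * snd p) * a p)"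

lemma linear_weight [simp]: "linear_key (weight n)"
  by (simp add: linear_key_def weight_def algebra_simps sum.distrib sum_distrib_left)

lemma linear_deg [simp]: "linear_key (deg n)"
  by (simp add: linear_key_def deg_scale)

lemma linear_key_diff: "linear_key k \<Longrightarrow> k (a - b) = k a - k b"
proof -
  assume k: "linear_key k"
  then have "k a = k (a - b) + k b" unfolding linear_key_def by (metis diff_add_cancel)
  then show ?thesis by simp
qed

lemma weight_unit: "p \<in> grid n \<Longrightarrow> weight n (unit p) = int (fst p * snd p)"
proof -
  assume p: "p \<in> grid n"
  have "weight n (unit p) = (\<Sum>r\<in>grid n. if r = p then int (fst p * snd p) else 0)"
    unfolding weight_def by (intro sum.cong) (auto simp: unit_def)
  then show ?thesis using p by simp
qed

lemma linear_key_box: "linear_key f \<Longrightarrow>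
   f (box i j k l) = f (unit (i,j)) + f (unit (k,l)) - f (unit (i,l)) - f (unit (k,j))"
  unfolding box_def by (simp add: linear_key_diff) (simp add: linear_key_def)

lemma weight_box:
  assumes "(i,j) \<in> grid n" "(k,l) \<in> grid n"
  shows "weight n (box i j k l) = (int k - int i) * (int l - int j)"
proof -
  have "(i,l) \<in> grid n" "(k,j) \<in> grid n" using assms by (auto simp: grid_def)
  then show ?thesis using assms
    by (simp add: linear_key_box weight_unit algebra_simps)
qed

text \<open>A key of top priority that vanishes on boxes, such as a combination of row and column degrees, does not
  disturb admissibility.\<close>

lemma term_order_with_key:
  assumes "linear_key k"
    and "\<And>i j i' j'. (i,j) \<in> grid n \<Longrightarrow> (i',j') \<in> grid n \<Longrightarrow> i < i' \<Longrightarrow> j < j' \<Longrightarrow> k (box i j i' j') = 0"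
  shows "term_order n (lex_poly ((coords n @ [weight n]) @ [k]))"
proof (rule term_order_lex_poly)
  fix a assume "supported n a" "\<And>f. f \<in> set ((coords n @ [weight n]) @ [k]) \<Longrightarrow> f a = 0"
  then show "a = 0" using coords_eq_0[of n a] by simp
next
  fix i j i' j' assume g: "(i,j) \<in> grid n" "(i',j') \<in> grid n" "i < i'" "j < j'"
  then have "0 < weight n (box i j i' j')" by (simp add: weight_box)
  then show "0 < lex_poly ((coords n @ [weight n]) @ [k]) (box i j i' j')"
    using assms(2)[OF g] lex_poly_snoc_0[of k "box i j i' j'"] lex_poly_snoc_pos[of "weight n"] by metis
qed (use assms(1) in auto)

lemma top_key_le:
  assumes lin: "\<forall>f\<in>set (ks @ [k]). linear_key f"
    and le: "smult c (lex_poly (ks @ [k]) a) \<le> smult d (lex_poly (ks @ [k]) b)"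
  shows "c * k a \<le> d * k b"
proof (rule ccontr)
  let ?z = "(\<lambda>p. c * a p) - (\<lambda>p. d * b p)"
  have k: "linear_key k" using lin by simp
  assume "\<not> ?thesis"
  then have "0 < k ?z" using k by (simp add: linear_key_diff) (simp add: linear_key_def)
  then have "0 < lex_poly (ks @ [k]) ?z" by (rule lex_poly_snoc_pos)
  moreover have "lex_poly (ks @ [k]) ?z = lex_poly (ks @ [k]) (\<lambda>p. c * a p) - lex_poly (ks @ [k]) (\<lambda>p. d * b p)"
    using lex_poly_linear(1)[OF lin, of ?z "\<lambda>p. d * b p"] by simp
  ultimately show False using le by (simp add: lex_poly_linear(2)[OF lin])
qed

definition deg_order :: "nat \<Rightarrow> expo \<Rightarrow> int poly" where
  "deg_order n = lex_poly ((coords n @ [weight n]) @ [deg n])"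

lemma term_order_deg: "term_order n (deg_order n)"
  unfolding deg_order_def by (rule term_order_with_key) (simp_all add: deg_box)

lemma deg_order_le: "deg_order n a \<le> deg_order n a' \<Longrightarrow> deg n a \<le> deg n a'"
  using top_key_le[of "coords n @ [weight n]" "deg n" 1 a 1 a'] by (simp add: deg_order_def)

text \<open>Maximising \<open>g / N\<close> without division.\<close>

lemma exists_max_slope:
  fixes g :: "'a \<Rightarrow> int poly" and N :: "'a \<Rightarrow> int"
  assumes "finite A" "A \<noteq> {}" "\<And>a. a \<in> A \<Longrightarrow> 0 < N a"
  shows "\<exists>a\<in>A. \<forall>b\<in>A. smult (N a) (g b) \<le> smult (N b) (g a)"
  using assms
proof (induction rule: finite_ne_induct)
  case (singleton x)
  then show ?case by simp
next
  case (insert z A)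
  then obtain a where a: "a \<in> A" "\<And>b. b \<in> A \<Longrightarrow> smult (N a) (g b) \<le> smult (N b) (g a)" by auto
  show ?case
  proof (cases "smult (N a) (g z) \<le> smult (N z) (g a)")
    case True
    then show ?thesis using a by (intro bexI[of _ a]) auto
  next
    case False
    have "smult (N z) (g b) \<le> smult (N b) (g z)" if b: "b \<in> A" for b
    proof -
      have pos: "0 < N a" "0 < N b" "0 < N z" using insert.prems a b by auto
      have "smult (N a) (smult (N z) (g b)) = smult (N z) (smult (N a) (g b))" by (simp add: mult.commute)
      also have "\<dots> \<le> smult (N z) (smult (N b) (g a))"
        using a(2)[OF b] pos by (simp only: smult_le_cancel)
      also have "\<dots> = smult (N b) (smult (N z) (g a))" by (simp add: mult.commute)
      also have "\<dots> \<le> smult (N b) (smult (N a) (g z))"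
        using False pos by (simp only: smult_le_cancel linorder_not_le less_imp_le)
      also have "\<dots> = smult (N a) (smult (N b) (g z))" by (simp add: mult.commute)
      finally show ?thesis using pos by (simp only: smult_le_cancel)
    qed
    then show ?thesis by (intro bexI[of _ z]) auto
  qed
qed

context unipotent_pair
begin

lemma extremal_exists:
  assumes h: "term_order n h" and p: "p \<in> grid n" and w: "w \<in> words p" "w \<noteq> Word [p]"
  obtains p0 w0 where "extremal_shift q n b c h p0 w0"
proof -
  let ?A = "{(p, w). p \<in> grid n \<and> w \<in> words p \<and> w \<noteq> Word [p]}"
  let ?N = "\<lambda>(p, w). int (word_length w) - 1"
  have long: "0 < int (word_length w) - 1" if "p \<in> grid n" "w \<in> words p" "w \<noteq> Word [p]" for p w
  proof -
    have "2 \<le> word_length w"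
      using that B.long_b[of p w] C.long_b[of p w] by (auto simp: words_def)
    then show ?thesis by simp
  qed
  have "?A \<subseteq> Sigma (grid n) words" by auto
  moreover have "finite (Sigma (grid n) words)" by (auto simp: words_def)
  ultimately have "finite ?A" by (rule finite_subset)
  moreover have "(p, w) \<in> ?A" using p w by simp
  then have "?A \<noteq> {}" by blast
  ultimately have "\<exists>a\<in>?A. \<forall>z\<in>?A. smult (?N a) (h (wexp unit (snd z) - unit (fst z)))
      \<le> smult (?N z) (h (wexp unit (snd a) - unit (fst a)))"
    by (rule exists_max_slope) (use long in auto)
  then obtain p0 w0 where p0: "p0 \<in> grid n" "w0 \<in> words p0" "w0 \<noteq> Word [p0]"
    and max: "\<And>p w. p \<in> grid n \<Longrightarrow> w \<in> words p \<Longrightarrow> w \<noteq> Word [p] \<Longrightarrow>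
       smult (int (word_length w0) - 1) (h (wexp unit w - unit p))
         \<le> smult (int (word_length w) - 1) (h (wexp unit w0 - unit p0))" by auto
  have "extremal_shift q n b c h p0 w0"
  proof unfold_locales
    fix p w assume "p \<in> grid n" "w \<in> words p"
    then show "smult (int (word_length w0) - 1) (h (wexp unit w - unit p))
        \<le> smult (int (word_length w) - 1) (h (wexp unit w0 - unit p0))"
      using max[of p w] by (cases "w = Word [p]") (simp_all add: term_orderD(5)[OF h])
  qed (use h p0 in auto)
  then show ?thesis by (rule that)
qed

end


section \<open>Rigidity of unipotent pairs\<close>

text \<open>The two boxes at the corners \<open>(1,n)\<close> and \<open>(n,1)\<close> span the common kernel of these keys. The last key raises the
  weights of the two corners by one, which lowers the boxes there from one to zero and keeps all others positive.
  The remaining keys are the coordinates of the projection along the two boxes.\<close>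

definition corner_rest :: "nat \<Rightarrow> (expo \<Rightarrow> int) list" where
  "corner_rest n = map (\<lambda>p a. a p - a (1,n-1) * box 1 (n-1) 2 n p - a (n-1,1) * box (n-1) 1 n 2 p)
     (sorted_list_of_set (grid n)) @ [\<lambda>a. weight n a + a (1,n) + a (n,1)]"

text \<open>The two boxes become infinitesimal; that at \<open>(n,1)\<close> is also infinitesimal compared with that at \<open>(1,n)\<close>.\<close>

definition corner_order :: "nat \<Rightarrow> expo \<Rightarrow> int poly" where
  "corner_order n = lex_poly ((\<lambda>a. a (n-1,1)) # (\<lambda>a. a (1,n-1)) # corner_rest n)"

lemma corner_order_eq:
  "corner_order n a = pCons (a (n-1,1)) (pCons (a (1,n-1)) (lex_poly (corner_rest n) a))"
  by (simp add: corner_order_def)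

lemma corner_rest_0:
  assumes "lex_poly (corner_rest n) a = 0" "p \<in> grid n"
  shows "a p = a (1,n-1) * box 1 (n-1) 2 n p + a (n-1,1) * box (n-1) 1 n 2 p"
  using assms by (auto simp: lex_poly_eq_0 corner_rest_def)

lemma corner_box_values:
  assumes "n \<ge> 3"
  shows "box 1 (n-1) 2 n (1,n-1) = 1" "box 1 (n-1) 2 n (n-1,1) = 0" "box 1 (n-1) 2 n (1,n) = -1"
    "box 1 (n-1) 2 n (2,n) = 1" "box 1 (n-1) 2 n (n,1) = 0"
    "box (n-1) 1 n 2 (1,n-1) = 0" "box (n-1) 1 n 2 (n-1,1) = 1" "box (n-1) 1 n 2 (n,1) = -1"
    "box (n-1) 1 n 2 (n,2) = 1" "box (n-1) 1 n 2 (1,n) = 0" "box (n-1) 1 n 2 (2,n) = 0"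
    "box 1 (n-1) 2 n (n,2) = 0"
  using assms by (auto simp: box_def unit_apply)

lemma corner_rest_box:
  assumes "n \<ge> 3"
  shows "lex_poly (corner_rest n) (box 1 (n-1) 2 n) = 0"
    "lex_poly (corner_rest n) (box (n-1) 1 n 2) = 0"
proof -
  have g: "(1,n-1) \<in> grid n" "(2,n) \<in> grid n" "(n-1,1) \<in> grid n" "(n,2) \<in> grid n"
    using assms by (auto simp: grid_def)
  show "lex_poly (corner_rest n) (box 1 (n-1) 2 n) = 0"
    "lex_poly (corner_rest n) (box (n-1) 1 n 2) = 0"
    unfolding lex_poly_eq_0 corner_rest_def
    using weight_box[OF g(1,2)] weight_box[OF g(3,4)] corner_box_values[OF assms] assms
    by auto
qed

lemma term_order_corner:
  assumes n: "n \<ge> 3"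
  shows "term_order n (corner_order n)"
  unfolding corner_order_def
proof (rule term_order_lex_poly)
  let ?ks = "(\<lambda>a. a (n-1,1)) # (\<lambda>a. a (1,n-1)) # corner_rest n"
  have "linear_key (\<lambda>a. a p - a (1,n-1) * c - a (n-1,1) * d)" for p c d
    by (simp add: linear_key_def algebra_simps)
  moreover have "linear_key (\<lambda>a. weight n a + a (1,n) + a (n,1))"
    using linear_weight[of n] by (simp add: linear_key_def algebra_simps)
  ultimately show "\<forall>k\<in>set ?ks. linear_key k"
    by (auto simp: corner_rest_def)
  fix a assume a: "supported n a" "\<And>k. k \<in> set ?ks \<Longrightarrow> k a = 0"
  have "a (n-1,1) = 0" by (rule a(2)) simp
  moreover have "a (1,n-1) = 0" by (rule a(2)) simp
  moreover have "lex_poly (corner_rest n) a = 0"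
    unfolding lex_poly_eq_0 by (intro ballI, rule a(2)) simp
  ultimately have "a p = 0" if "p \<in> grid n" for p using corner_rest_0[OF _ that, of a] by simp
  then have "k a = 0" if "k \<in> set (coords n)" for k using that unfolding coords_def by auto
  then show "a = 0" by (rule coords_eq_0[OF a(1)])
next
  fix i j k l assume g: "(i,j) \<in> grid n" "(k,l) \<in> grid n" "i < k" "j < l"
  let ?top = "\<lambda>a. weight n a + a (1,n) + a (n,1)"
  have b: "box i j k l (1,n) = (if i = 1 \<and> l = n then -1 else 0)"
    "box i j k l (n,1) = (if k = n \<and> j = 1 then -1 else 0)"
    using g by (auto simp: box_def unit_apply grid_def)
  define P where "P \<longleftrightarrow> i = 1 \<and> l = n"
  define Q where "Q \<longleftrightarrow> k = n \<and> j = 1"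
  have top: "?top (box i j k l) = (int k - int i) * (int l - int j) - (if P then 1 else 0) - (if Q then 1 else 0)"
    by (simp only: weight_box[OF g(1,2)] b P_def Q_def) simp
  have ge: "1 \<le> int k - int i" "1 \<le> int l - int j" using g by auto
  have prod2: "2 \<le> a * b" if "1 \<le> a" "1 \<le> b" "a \<noteq> 1 \<or> b \<noteq> 1" for a b :: int
  proof (cases "a = 1")
    case False
    then have "2 * 1 \<le> a * b" using that by (intro mult_mono) auto
    then show ?thesis by simp
  qed (use that in auto)
  consider "0 < ?top (box i j k l)" | "i = 1" "j = n-1" "k = 2" "l = n" | "i = n-1" "j = 1" "k = n" "l = 2"
  proof (cases P; cases Q)
    assume c: P Q
    have "2 * 2 \<le> (int k - int i) * (int l - int j)"
      using c n by (intro mult_mono) (auto simp: P_def Q_def)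
    then have "0 < ?top (box i j k l)" unfolding top using c by simp
    then show ?thesis by (rule that(1))
  next
    assume c: P "\<not> Q"
    show ?thesis
    proof (cases "k = 2 \<and> j = n - 1")
      case True
      then show ?thesis using c that(2) by (simp add: P_def)
    next
      case False
      then have "2 \<le> (int k - int i) * (int l - int j)"
        using c g ge by (intro prod2) (auto simp: P_def)
      then have "0 < ?top (box i j k l)" unfolding top using c by simp
      then show ?thesis by (rule that(1))
    qed
  next
    assume c: "\<not> P" Q
    show ?thesis
    proof (cases "i = n - 1 \<and> l = 2")
      case True
      then show ?thesis using c that(3) by (simp add: Q_def)
    next
      case False
      then have "2 \<le> (int k - int i) * (int l - int j)"
        using c g ge by (intro prod2) (auto simp: Q_def)
      then have "0 < ?top (box i j k l)" unfolding top using c by simp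
      then show ?thesis by (rule that(1))
    qed
  next
    assume c: "\<not> P" "\<not> Q"
    have "1 * 1 \<le> (int k - int i) * (int l - int j)" using ge by (intro mult_mono) auto
    then have "0 < ?top (box i j k l)" unfolding top using c by simp
    then show ?thesis by (rule that(1))
  qed
  then show "0 < lex_poly ((\<lambda>a. a (n-1,1)) # (\<lambda>a. a (1,n-1)) # corner_rest n) (box i j k l)"
  proof cases
    case 1
    then have "0 < lex_poly (corner_rest n) (box i j k l)"
      unfolding corner_rest_def by (rule lex_poly_snoc_pos[of ?top])
    then have "0 < pCons (box i j k l (n-1,1)) (pCons (box i j k l (1,n-1)) (lex_poly (corner_rest n) (box i j k l)))"
      by (intro pCons_pos)
    then show ?thesis by (simp only: lex_poly.simps)
  next
    case 2
    have "0 < pCons (0::int) (pCons 1 0)" by (intro pCons_pos pCons_0_pos) simp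
    then show ?thesis
      unfolding lex_poly.simps 2 corner_rest_box(1)[OF n] corner_box_values[OF n] .
  next
    case 3
    have "0 < pCons (1::int) (pCons 0 0)" by (simp add: pCons_0_pos)
    then show ?thesis
      unfolding lex_poly.simps 3 corner_rest_box(2)[OF n] corner_box_values[OF n] .
  qed
qed

lemma pCons_le_imp: "pCons a p \<le> pCons b r \<Longrightarrow> p \<le> (r :: int poly)"
  unfolding pCons_le_iff by (elim disjE conjE) simp_all

lemma pCons_le_0_imp: "pCons a 0 \<le> pCons b (0 :: int poly) \<Longrightarrow> a \<le> b"
  unfolding pCons_le_iff by simp

lemma corner_wall_NE:
  assumes n: "n \<ge> 3" and D: "0 < D"
    and v: "- smult D (corner_order n (box 1 (n-1) 2 n)) \<le> corner_order n v" "corner_order n v \<le> 0"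
  shows "v (1,n-1) = - v (1,n) \<and> v (2,n) = - v (1,n) \<and> 0 \<le> v (1,n)"
proof -
  let ?r = "lex_poly (corner_rest n) v"
  have k: "corner_order n (box 1 (n-1) 2 n) = pCons 0 (pCons 1 0)"
    unfolding corner_order_eq corner_rest_box(1)[OF n] corner_box_values[OF n] ..
  have "- smult D (pCons 0 (pCons 1 0)) = pCons 0 (pCons (- D) 0)" by simp
  with v(1) have "pCons 0 (pCons (- D) 0) \<le> pCons (v (n-1,1)) (pCons (v (1,n-1)) ?r)"
    by (simp only: k corner_order_eq[of n v])
  from pCons_le_imp[OF pCons_le_imp[OF this]] have "0 \<le> ?r" .
  have "pCons (v (n-1,1)) (pCons (v (1,n-1)) ?r) \<le> pCons 0 (pCons 0 0)"
    using v(2) unfolding corner_order_eq by simp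
  then have le: "pCons (v (1,n-1)) ?r \<le> pCons 0 0" by (rule pCons_le_imp)
  with \<open>0 \<le> ?r\<close> have r: "?r = 0" by (intro antisym pCons_le_imp[OF le])
  have v1: "v (1,n-1) \<le> 0" using le unfolding r by (rule pCons_le_0_imp)
  have g: "(1,n) \<in> grid n" "(2,n) \<in> grid n" using n by (auto simp: grid_def)
  have "v (1,n) = - v (1,n-1)" "v (2,n) = v (1,n-1)"
    using corner_rest_0[OF r g(1)] corner_rest_0[OF r g(2)]
    unfolding corner_box_values[OF n] by (simp_all only: mult_minus1_right mult_1_right mult_zero_right add_0_right)
  then show ?thesis using v1 by simp
qed

lemma corner_wall_SW:
  assumes n: "n \<ge> 3" and D: "0 < D"
    and v: "- smult D (corner_order n (box (n-1) 1 n 2)) \<le> corner_order n v" "corner_order n v \<le> 0"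
  shows "v (n-1,1) = - v (n,1) \<and> v (n,2) = - v (n,1) \<and> 0 \<le> v (n,1)"
proof -
  let ?r = "lex_poly (corner_rest n) v"
  have k: "corner_order n (box (n-1) 1 n 2) = pCons 1 (pCons 0 0)"
    unfolding corner_order_eq corner_rest_box(2)[OF n] corner_box_values[OF n] ..
  have "- smult D (pCons 1 (pCons 0 0)) = pCons (- D) (pCons 0 0)" by simp
  with v(1) have "pCons (- D) (pCons 0 0) \<le> pCons (v (n-1,1)) (pCons (v (1,n-1)) ?r)"
    by (simp only: k corner_order_eq[of n v])
  then have ge: "pCons 0 0 \<le> pCons (v (1,n-1)) ?r" by (rule pCons_le_imp)
  have "pCons (v (n-1,1)) (pCons (v (1,n-1)) ?r) \<le> pCons 0 (pCons 0 0)"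
    using v(2) unfolding corner_order_eq by simp
  note le = this
  have eq: "pCons (v (1,n-1)) ?r = pCons 0 0"
    using pCons_le_imp[OF le] ge by (rule antisym)
  then have r: "?r = 0" "v (1,n-1) = 0" unfolding pCons_eq_iff by blast+
  have "pCons (v (n-1,1)) 0 \<le> pCons 0 (0 :: int poly)" using le unfolding eq by simp
  then have v1: "v (n-1,1) \<le> 0" by (rule pCons_le_0_imp)
  have g: "(n,1) \<in> grid n" "(n,2) \<in> grid n" using n by (auto simp: grid_def)
  have "v (n,1) = - v (n-1,1)" "v (n,2) = v (n-1,1)"
    using corner_rest_0[OF r(1) g(1)] corner_rest_0[OF r(1) g(2)]
    unfolding corner_box_values[OF n] by (simp_all only: mult_minus1_right mult_1_right mult_zero_right add_0_left)
  then show ?thesis using v1 by simp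
qed

context extremal_shift
begin

lemma s_corner:
  shows "n \<ge> 2" "p0 = (1,n) \<or> p0 = (n,1)"
    and "n \<ge> 3 \<Longrightarrow> p0 = (1,n) \<Longrightarrow> s (1,n-1) = 0 \<and> s (2,n) = 0"
    and "n \<ge> 3 \<Longrightarrow> p0 = (n,1) \<Longrightarrow> s (n-1,1) = 0 \<and> s (n,2) = 0"
proof -
  have s_ge: "0 \<le> s r" if "r \<noteq> p0" for r
    using that wexp_unit_nonneg[of w0 r] by (simp add: s_def unit_def)
  note C = central_exponent_corner[OF _ p0 extremal_central(2) s_ge D_pos]
  show "n \<ge> 2" "p0 = (1,n) \<or> p0 = (n,1)" using C(1,2) extremal_central(1) by blast+
  show "n \<ge> 3 \<Longrightarrow> p0 = (1,n) \<Longrightarrow> s (1,n-1) = 0 \<and> s (2,n) = 0"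
    "n \<ge> 3 \<Longrightarrow> p0 = (n,1) \<Longrightarrow> s (n-1,1) = 0 \<and> s (n,2) = 0"
    using C(3,4) extremal_central(1) by blast+
qed

lemma no_extremal_corner:
  assumes n: "n \<ge> 3" and ho: "h = corner_order n"
  shows False
proof -
  note DX = op_scalars.qmatrixD[OF B.qmatrix_image] and Dx = op_scalars.qmatrixD[OF qmatrix_x]
  consider "p0 = (1,n)" | "p0 = (n,1)" using s_corner(2) by blast
  then show False
  proof cases
    case 1
    have k: "unit (1,n-1) + unit (2,n) - unit p0 - unit (2,n-1) = box 1 (n-1) 2 n"
      by (simp add: box_def 1)
    show False
    proof (rule no_corner_shift[of "(1,n-1)" "(2,n)" "(2,n-1)"])
      show "B.X (1,n-1) * B.X (2,n) - B.X (2,n) * B.X (1,n-1) = scal (q - 1/q) * (B.X p0 * B.X (2,n-1))"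
        "x (1,n-1) * x (2,n) - x (2,n) * x (1,n-1) = scal (q - 1/q) * (x p0 * x (2,n-1))"
        using DX(4)[of 1 "n-1" 2 n] Dx(4)[of 1 "n-1" 2 n] n by (simp_all add: 1 op_scalars.smul_def)
      fix v assume "- smult D (h (unit (1,n-1) + unit (2,n) - unit p0 - unit (2,n-1))) \<le> h v" "h v \<le> 0"
      then have "v (1,n-1) = - v (1,n) \<and> v (2,n) = - v (1,n) \<and> 0 \<le> v (1,n)"
        unfolding k ho by (rule corner_wall_NE[OF n D_pos])
      then show "v (1,n-1) = - v p0 \<and> v (2,n) = - v p0 \<and> 0 \<le> v p0"
        by (simp only: 1)
    qed (use s_corner(3) n 1 in \<open>auto simp: grid_def\<close>)
  next
    case 2
    have k: "unit (n-1,1) + unit (n,2) - unit p0 - unit (n-1,2) = box (n-1) 1 n 2"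
      by (simp add: box_def 2 diff_right_commute)
    show False
    proof (rule no_corner_shift[of "(n-1,1)" "(n,2)" "(n-1,2)"])
      have "B.X (n-1,2) * B.X (n,1) = B.X (n,1) * B.X (n-1,2)" "x (n-1,2) * x (n,1) = x (n,1) * x (n-1,2)"
        using DX(3)[of "n-1" 2 n 1] Dx(3)[of "n-1" 2 n 1] n by (simp_all add: op_scalars.qcomm_def)
      then show "B.X (n-1,1) * B.X (n,2) - B.X (n,2) * B.X (n-1,1) = scal (q - 1/q) * (B.X p0 * B.X (n-1,2))"
        "x (n-1,1) * x (n,2) - x (n,2) * x (n-1,1) = scal (q - 1/q) * (x p0 * x (n-1,2))"
        using DX(4)[of "n-1" 1 n 2] Dx(4)[of "n-1" 1 n 2] n by (simp_all add: 2 op_scalars.smul_def)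
      fix v assume "- smult D (h (unit (n-1,1) + unit (n,2) - unit p0 - unit (n-1,2))) \<le> h v" "h v \<le> 0"
      then have "v (n-1,1) = - v (n,1) \<and> v (n,2) = - v (n,1) \<and> 0 \<le> v (n,1)"
        unfolding k ho by (rule corner_wall_SW[OF n D_pos])
      then show "v (n-1,1) = - v p0 \<and> v (n,2) = - v p0 \<and> 0 \<le> v p0"
        by (simp only: 2)
    qed (use s_corner(4) n 2 in \<open>auto simp: grid_def\<close>)
  qed
qed

end

context quantum_torus
begin

lemma mspan_eq_sum:
  assumes "f \<in> mspan P"
  shows "finite {a. coef f a \<noteq> 0}"
    and "\<And>A. finite A \<Longrightarrow> {a. coef f a \<noteq> 0} \<subseteq> A \<Longrightarrow> f = (\<Sum>a\<in>A. scal (coef f a) * M a)"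
proof -
  have "finite {a. coef f a \<noteq> 0} \<and>
    (\<forall>A. finite A \<longrightarrow> {a. coef f a \<noteq> 0} \<subseteq> A \<longrightarrow> f = (\<Sum>a\<in>A. scal (coef f a) * M a))"
    using assms
  proof (induction rule: mspan.induct)
    case zero
    then show ?case by simp
  next
    case (step a f c)
    let ?g = "scal c * M a + f"
    have cg: "coef ?g b = (if b = a then c else 0) + coef f b" for b by (simp add: coef_mono)
    have sub: "{b. coef ?g b \<noteq> 0} \<subseteq> insert a {b. coef f b \<noteq> 0}" by (auto simp: coef_mono)
    have fin: "finite {b. coef ?g b \<noteq> 0}" by (rule finite_subset[OF sub]) (use step in auto)
    moreover have "?g = (\<Sum>b\<in>A. scal (coef ?g b) * M b)"
      if A: "finite A" "{b. coef ?g b \<noteq> 0} \<subseteq> A" for A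
    proof -
      let ?A = "A \<union> insert a {b. coef f b \<noteq> 0}"
      have finA: "finite ?A" using A step by simp
      have "(\<Sum>b\<in>A. scal (coef ?g b) * M b) = (\<Sum>b\<in>?A. scal (coef ?g b) * M b)"
      proof (rule sum.mono_neutral_left[OF finA])
        show "\<forall>i\<in>?A - A. scal (coef ?g i) * M i = 0"
        proof
          fix i assume "i \<in> ?A - A"
          then have "coef ?g i = 0" using A(2) by blast
          then show "scal (coef ?g i) * M i = 0" by (simp only: op_scalars.s_0 mult_zero_left)
        qed
      qed blast
      also have "\<dots> = (\<Sum>b\<in>?A. if b = a then scal c * M b else 0) + (\<Sum>b\<in>?A. scal (coef f b) * M b)"
        unfolding sum.distrib[symmetric] cg
        by (intro sum.cong refl) (simp add: op_scalars.s_add distrib_right)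
      also have "(\<Sum>b\<in>?A. scal (coef f b) * M b) = f"
        using step.IH finA by (intro sym[of f]) blast
      also have "(\<Sum>b\<in>?A. if b = a then scal c * M b else 0) = scal c * M a" using finA by simp
      finally show ?thesis by (rule sym)
    qed
    ultimately show ?case by blast
  qed
  then show "finite {a. coef f a \<noteq> 0}"
    "\<And>A. finite A \<Longrightarrow> {a. coef f a \<noteq> 0} \<subseteq> A \<Longrightarrow> f = (\<Sum>a\<in>A. scal (coef f a) * M a)" by blast+
qed

lemma word_val_deg_ge:
  assumes X: "\<And>p. p \<in> grid n \<Longrightarrow> X p \<in> mspan (\<lambda>a. m \<le> deg n a)"
    and w: "set (letters w) \<subseteq> grid n"
  shows "word_val X w \<in> mspan (\<lambda>a. int (word_length w) * m \<le> deg n a)"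
proof -
  have "set ps \<subseteq> grid n \<Longrightarrow> prod_list (map X ps) \<in> mspan (\<lambda>a. int (length ps) * m \<le> deg n a)" for ps
  proof (induction ps)
    case Nil
    then show ?case using mspan_M1[OF supported_simps(1), of "\<lambda>a. 0 \<le> deg n a"] by simp
  next
    case (Cons r ps)
    then have "X r \<in> mspan (\<lambda>a. m \<le> deg n a)"
      "prod_list (map X ps) \<in> mspan (\<lambda>a. int (length ps) * m \<le> deg n a)" using X by simp_all
    then have "X r * prod_list (map X ps) \<in> mspan (\<lambda>a. int (length (r # ps)) * m \<le> deg n a)"
      by (rule mspan_mult) (simp add: algebra_simps)
    then show ?case by simp
  qed
  then show ?thesis using w by (simp add: word_val_def)
qed

lemma word_val_x_deg_ge:
  "set (letters w) \<subseteq> grid n \<Longrightarrow> word_val x w \<in> mspan (\<lambda>a. int (word_length w) \<le> deg n a)"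
  using word_val_deg_ge[of x 1 w] mspan_mono[OF x_deg, of _ "\<lambda>a. 1 \<le> deg n a"] by simp

text \<open>For cofactors, whose leading terms cannot be read off from words.\<close>

lemma lead_exists:
  assumes h: "term_order n h" and f: "f \<in> mspan P" "f \<noteq> 0"
  obtains a c where "c \<noteq> 0" "lead h f a c" "P a"
proof -
  let ?S = "{a. coef f a \<noteq> 0}"
  note eq = mspan_eq_sum[OF f(1)]
  have "?S \<noteq> {}" using eq(2)[of "{}"] f(2) by auto
  then obtain a where a: "a \<in> ?S" "\<And>b. b \<in> ?S \<Longrightarrow> h b \<le> h a"
    using finite_max_image[OF eq(1), of h] by auto
  have supp: "supported n b" if "b \<in> ?S" for b using coef_mspan(2)[OF f(1)] that by blast
  have "f - scal (coef f a) * M a = (\<Sum>b\<in>?S - {a}. scal (coef f b) * M b)"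
  proof -
    have "f = scal (coef f a) * M a + (\<Sum>b\<in>?S - {a}. scal (coef f b) * M b)"
      using eq(2)[OF eq(1) subset_refl] sum.remove[OF eq(1) a(1), of "\<lambda>b. scal (coef f b) * M b"]
      by (rule trans)
    then show ?thesis by (simp only: add_diff_cancel_left' diff_eq_eq) (simp only: add.commute)
  qed
  also have "\<dots> \<in> mspan (\<lambda>b. h b < h a)"
  proof (intro mspan_sum mspan_M)
    fix b assume b: "b \<in> ?S - {a}"
    then show "supported n b" using supp by blast
    have "h b \<noteq> h a" using term_orderD(7)[OF h, of b a] supp a(1) b by blast
    then show "h b < h a" using a(2)[of b] b by simp
  qed
  finally have "lead h f a (coef f a)" using supp[OF a(1)] by (simp add: lead_def)
  then show ?thesis using that a(1) coef_mspan(1)[OF f(1)] by blast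
qed

end

context unipotent_half
begin

lemma gen_if_trivial:
  assumes p: "p \<in> grid n" and "\<And>w. w \<in> keys (b p) \<Longrightarrow> w = Word [p]"
  shows "b p = gen p"
proof (rule poly_mapping_eqI)
  fix w
  show "lookup (b p) w = lookup (gen p) w"
    using lookup_b[OF p] assms(2)[of w]
    by (cases "w = Word [p]") (auto simp: gen_def lookup_single when_def in_keys_iff)
qed

text \<open>A top word of degree one in the degree order leaves only the generator.\<close>

lemma trivial_if_lead:
  assumes p: "p \<in> grid n" and w: "w \<in> keys (b p)"
    "\<And>v. v \<in> keys (b p) \<Longrightarrow> deg_order n (wexp unit v) \<le> deg_order n (wexp unit w)"
    and deg: "deg n (wexp unit w) \<le> 1"
  shows "b p = gen p"
proof -
  have "v = Word [p]" if v: "v \<in> keys (b p)" for v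
  proof (rule ccontr)
    assume "v \<noteq> Word [p]"
    then have "2 \<le> word_length v" using long_b[OF p v] by simp
    moreover have "deg n (wexp unit v) \<le> 1"
      using deg_order_le[OF w(2)[OF v]] deg by simp
    ultimately show False using deg_wexp_unit[OF letters_b[OF p v]] by simp
  qed
  then show ?thesis by (rule gen_if_trivial[OF p])
qed

lemma word_val_deg_nonneg:
  assumes "set (letters w) \<subseteq> grid n"
  shows "word_val X w \<in> mspan (\<lambda>a. 0 \<le> deg n a)"
proof -
  have "X p \<in> mspan (\<lambda>a. 0 \<le> deg n a)" if p: "p \<in> grid n" for p
    unfolding image_family_def eval_def
    using letters_b[OF p]
    by (intro mspan_sum mspan_scal mspan_mono[OF word_val_x_deg_ge]) auto
  then show ?thesis using word_val_deg_ge[of X 0 w] assms by simp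
qed

text \<open>Degrees add up in products, since leading terms multiply. The cofactor has degree at least zero and \<open>x p\<close> has degree
  one, so \<open>X p\<close> has degree at most one.\<close>

lemma trivial_if_divides:
  assumes p: "p \<in> grid n" and R: "R \<in> mspan (\<lambda>a. 0 \<le> deg n a)"
    and "x p = X p * R \<or> x p = R * X p"
  shows "b p = gen p"
proof (rule lead_X[OF term_order_deg p])
  fix w c assume w: "w \<in> keys (b p)"
    "\<And>v. v \<in> keys (b p) \<Longrightarrow> deg_order n (wexp unit v) \<le> deg_order n (wexp unit w)"
    "c \<noteq> 0" "lead (deg_order n) (X p) (wexp unit w) c"
  note ho = term_orderD(2)[OF term_order_deg]
  have lx: "lead (deg_order n) (x p) (unit p) 1" by (rule lead_x[OF term_orderD(1)[OF term_order_deg] p])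
  then have "x p \<noteq> 0" using lead_coef by fastforce
  then have "R \<noteq> 0" using assms(3) by auto
  then obtain a e where a: "e \<noteq> 0" "lead (deg_order n) R a e" "0 \<le> deg n a"
    using lead_exists[OF term_order_deg R] by blast
  have "\<exists>d. d \<noteq> 0 \<and> lead (deg_order n) (x p) (wexp unit w + a) d"
    using assms(3)
  proof
    assume "x p = X p * R"
    then show ?thesis using lead_mult[OF ho w(4) a(2)] w(3) a(1) q
      by (intro exI[of _ "c * e * q powi twist n (wexp unit w) a"]) simp
  next
    assume "x p = R * X p"
    then show ?thesis using lead_mult[OF ho a(2) w(4)] w(3) a(1) q
      by (intro exI[of _ "e * c * q powi twist n a (wexp unit w)"]) (simp add: add.commute)
  qed
  then have "wexp unit w + a = unit p" using lead_unique[OF _ lx] by auto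
  then have "deg n (wexp unit w + a) = deg n (unit p)" by (rule arg_cong)
  then have "deg n (wexp unit w) + deg n a = 1" using p by simp
  then show ?thesis using a(3) trivial_if_lead[OF p w(1,2)] by simp
qed

end

context unipotent_pair
begin

lemma trivial_words:
  assumes n: "n \<noteq> 2" and p: "p \<in> grid n" and w: "w \<in> words p"
  shows "w = Word [p]"
proof (rule ccontr)
  assume ne: "w \<noteq> Word [p]"
  show False
  proof (cases "n \<ge> 3")
    case True
    from extremal_exists[OF term_order_corner[OF True] p w ne] obtain p0 w0
      where "extremal_shift q n b c (corner_order n) p0 w0" .
    then interpret extremal_shift q n b c "corner_order n" p0 w0 .
    show False by (rule no_extremal_corner[OF True refl])
  next
    case False
    from extremal_exists[OF term_order_deg p w ne] obtain p0 w0
      where "extremal_shift q n b c (deg_order n) p0 w0" .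
    then interpret extremal_shift q n b c "deg_order n" p0 w0 .
    show False using s_corner(1) n False by simp
  qed
qed

text \<open>For \<open>n = 2\<close> the difference of the entries at \<open>(1,1)\<close> and \<open>(2,2)\<close> vanishes on the box and on central exponents. With it
  (or its negative) as the top key, the extremal shift has slope zero there, so no shift is positive for either
  sign.\<close>

lemma balanced_words:
  assumes n: "n = 2" and p: "p \<in> grid n" and w: "w \<in> words p"
  shows "wexp unit w (1,1) - wexp unit w (2,2) = unit p (1,1) - unit p (2,2)"
proof (cases "w = Word [p]")
  case True
  then show ?thesis by (simp add: wexp_def)
next
  case False
  have "\<epsilon> * (wexp unit w (1,1) - wexp unit w (2,2)) \<le> \<epsilon> * (unit p (1,1) - unit p (2,2))" for \<epsilon> :: int
  proof -
    let ?k = "\<lambda>a :: expo. \<epsilon> * (a (1,1) - a (2,2))"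
    let ?ks = "coords n @ [weight n]"
    have k: "linear_key ?k" by (simp add: linear_key_def algebra_simps)
    have "term_order n (lex_poly (?ks @ [?k]))"
    proof (rule term_order_with_key[OF k])
      fix i j i' j' assume "(i,j) \<in> grid n" "(i',j') \<in> grid n" "i < i'" "j < j'"
      then have "i = 1" "i' = 2" "j = 1" "j' = 2" using n by (auto simp: grid_def)
      then show "?k (box i j i' j') = 0" by (simp add: box_def unit_apply)
    qed
    from extremal_exists[OF this p w False] obtain p0 w0
      where "extremal_shift q n b c (lex_poly (?ks @ [?k])) p0 w0" .
    then interpret extremal_shift q n b c "lex_poly (?ks @ [?k])" p0 w0 .
    have "s (Suc 1, Suc 1) = s (1,1)"
      by (rule central_exponent_diagonal) (use extremal_central(1) n in auto)
    then have s0: "?k s = 0" by (simp add: numeral_2_eq_2)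
    have "smult D (lex_poly (?ks @ [?k]) (wexp unit w - unit p))
        \<le> smult (int (word_length w) - 1) (lex_poly (?ks @ [?k]) s)"
      using extremal[OF p w] unfolding D_eq[symmetric] s_def[symmetric] .
    moreover have "\<forall>f\<in>set (?ks @ [?k]). linear_key f" using k by auto
    ultimately have "D * ?k (wexp unit w - unit p) \<le> (int (word_length w) - 1) * ?k s"
      by (rule top_key_le[rotated])
    then have "D * ?k (wexp unit w - unit p) \<le> 0" unfolding s0 by simp
    then have "?k (wexp unit w - unit p) \<le> 0" using D_pos by (simp only: mult_le_0_iff) auto
    then show ?thesis by (simp add: algebra_simps)
  qed
  from this[of 1] this[of "-1"] show ?thesis by simp
qed

text \<open>If every word of the inverse image of \<open>x p\<close> begins with \<open>p\<close>, then applying the automorphism shows that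
  \<open>X p\<close> divides \<open>x p\<close>, and similarly on the right.\<close>

lemma trivial_if_prefix_or_suffix:
  assumes p: "p \<in> grid n"
    and "(\<forall>w\<in>keys (c p). \<exists>u. set (letters u) \<subseteq> grid n \<and> w = Word [p] + u) \<or>
      (\<forall>w\<in>keys (c p). \<exists>u. set (letters u) \<subseteq> grid n \<and> w = u + Word [p])"
  shows "b p = gen p"
proof -
  have R: "(\<Sum>w\<in>keys (c p). scal (lookup (c p) w) * word_val B.X (T w)) \<in> mspan (\<lambda>a. 0 \<le> deg n a)"
    if "\<And>w. w \<in> keys (c p) \<Longrightarrow> set (letters (T w)) \<subseteq> grid n" for T
    using that by (intro mspan_sum mspan_scal B.word_val_deg_nonneg)
  have Xp: "word_val B.X (Word [p]) = B.X p" by (simp add: word_val_def)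
  from assms(2) show ?thesis
  proof
    assume "\<forall>w\<in>keys (c p). \<exists>u. set (letters u) \<subseteq> grid n \<and> w = Word [p] + u"
    then obtain T where T: "\<And>w. w \<in> keys (c p) \<Longrightarrow> set (letters (T w)) \<subseteq> grid n"
      "\<And>w. w \<in> keys (c p) \<Longrightarrow> w = Word [p] + T w" by metis
    have "word_val B.X w = B.X p * word_val B.X (T w)" if "w \<in> keys (c p)" for w
      using arg_cong[OF T(2)[OF that], of "word_val B.X"] by (simp only: word_val_add Xp)
    then have "x p = B.X p * (\<Sum>w\<in>keys (c p). scal (lookup (c p) w) * word_val B.X (T w))"
      unfolding eval_c[OF p, symmetric] eval_def sum_distrib_left
      by (intro sum.cong refl) (simp add: op_scalars.s_left_commute)
    then show ?thesis using B.trivial_if_divides[OF p R[of T]] T(1) by blast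
  next
    assume "\<forall>w\<in>keys (c p). \<exists>u. set (letters u) \<subseteq> grid n \<and> w = u + Word [p]"
    then obtain T where T: "\<And>w. w \<in> keys (c p) \<Longrightarrow> set (letters (T w)) \<subseteq> grid n"
      "\<And>w. w \<in> keys (c p) \<Longrightarrow> w = T w + Word [p]" by metis
    have "word_val B.X w = word_val B.X (T w) * B.X p" if "w \<in> keys (c p)" for w
      using arg_cong[OF T(2)[OF that], of "word_val B.X"] by (simp only: word_val_add Xp)
    then have "x p = (\<Sum>w\<in>keys (c p). scal (lookup (c p) w) * word_val B.X (T w)) * B.X p"
      unfolding eval_c[OF p, symmetric] eval_def sum_distrib_right
      by (intro sum.cong refl) (simp add: mult.assoc)
    then show ?thesis using B.trivial_if_divides[OF p R[of T]] T(1) by blast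
  qed
qed

text \<open>By balance, each word of \<open>c (1,1)\<close> contains the letter \<open>(1,1)\<close>, the smallest one, and hence begins with it; each
  word of \<open>c (2,2)\<close> ends with \<open>(2,2)\<close>. Once \<open>x (1,1)\<close> and \<open>x (2,2)\<close> are fixed, their commutator fixes
  \<open>x (1,2) x (2,1)\<close>, and both factors have degree one.\<close>

lemma two_trivial:
  assumes n: "n = 2"
  shows "p \<in> grid n \<Longrightarrow> b p = gen p"
proof -
  have g: "(1,1) \<in> grid n" "(2,2) \<in> grid n" "(1,2) \<in> grid n" "(2,1) \<in> grid n" using n by (auto simp: grid_def)
  have range: "r = (1,1) \<or> r = (1,2) \<or> r = (2,1) \<or> r = (2,2)" if "r \<in> grid n" for r
    using that n by (cases r) (auto simp: grid_def)
  have count: "wexp unit w (1,1) - wexp unit w (2,2) = unit p (1,1) - unit p (2,2)"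
    if "p \<in> grid n" "w \<in> keys (c p)" for p w
    using balanced_words[OF n that(1)] that(2) by (simp add: words_def)
  have "\<exists>u. set (letters u) \<subseteq> grid n \<and> w = Word [(1,1)] + u" if w: "w \<in> keys (c (1,1))" for w
  proof -
    have "wexp unit w (1,1) > 0"
      using count[OF g(1) w] wexp_unit_nonneg[of w "(2,2)"] by (simp add: unit_apply)
    then have mem: "(1,1) \<in> set (letters w)"
      using count_list_0_iff[of "letters w" "(1,1)"] unfolding wexp_unit by linarith
    obtain a ws where aws: "letters w = a # ws" using mem by (cases "letters w") auto
    have ws: "sorted (a # ws)" "set (a # ws) \<subseteq> grid n"
      using C.standard_b[OF g(1) w] by (auto simp: standard_def aws)
    then have "a \<le> (1,1)" "a \<in> grid n" using mem by (auto simp: aws)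
    then have "a = (1,1)" using range[of a] by (auto simp: less_eq_prod_def)
    then show ?thesis using aws ws(2)
      by (intro exI[of _ "Word ws"]) (cases w; simp add: plus_free_monoid_def)
  qed
  then have b11: "b (1,1) = gen (1,1)" by (intro trivial_if_prefix_or_suffix[OF g(1)]) blast
  have "\<exists>u. set (letters u) \<subseteq> grid n \<and> w = u + Word [(2,2)]" if w: "w \<in> keys (c (2,2))" for w
  proof -
    have "wexp unit w (2,2) > 0"
      using count[OF g(2) w] wexp_unit_nonneg[of w "(1,1)"] by (simp add: unit_apply)
    then have mem: "(2,2) \<in> set (letters w)"
      using count_list_0_iff[of "letters w" "(2,2)"] unfolding wexp_unit by linarith
    obtain a ws where aws: "letters w = ws @ [a]" using mem by (cases "letters w" rule: rev_cases) auto
    have ws: "sorted (ws @ [a])" "set (ws @ [a]) \<subseteq> grid n"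
      using C.standard_b[OF g(2) w] by (auto simp: standard_def aws)
    then have "(2,2) \<le> a" "a \<in> grid n" using mem by (auto simp: aws sorted_append)
    then have "a = (2,2)" using range[of a] by (auto simp: less_eq_prod_def)
    then show ?thesis using aws ws(2)
      by (intro exI[of _ "Word ws"]) (cases w; simp add: plus_free_monoid_def)
  qed
  then have b22: "b (2,2) = gen (2,2)" by (intro trivial_if_prefix_or_suffix[OF g(2)]) blast
  have X: "B.X (1,1) = x (1,1)" "B.X (2,2) = x (2,2)"
    unfolding image_family_def b11 b22 by (rule op_scalars.eval_gen)+
  have m: "1 \<in> {1..n}" "2 \<in> {1..n}" using n by auto
  have "scal (q - 1/q) * (B.X (1,2) * B.X (2,1)) = scal (q - 1/q) * (x (1,2) * x (2,1))"
    using op_scalars.qmatrixD(4)[OF B.qmatrix_image m(1,1) m(2,2)]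
      op_scalars.qmatrixD(4)[OF qmatrix_x m(1,1) m(2,2)]
    unfolding X op_scalars.smul_def by simp
  then have "scal (1 / (q - 1/q)) * (scal (q - 1/q) * (B.X (1,2) * B.X (2,1)))
      = scal (1 / (q - 1/q)) * (scal (q - 1/q) * (x (1,2) * x (2,1)))" by simp
  then have XX: "B.X (1,2) * B.X (2,1) = x (1,2) * x (2,1)"
    unfolding mult.assoc[symmetric] op_scalars.s_mult[symmetric] using q_not_inverse by simp
  note ho = term_orderD(2)[OF term_order_deg]
  have b12: "b (1,2) = gen (1,2) \<and> b (2,1) = gen (2,1)"
  proof (rule B.lead_X[OF term_order_deg g(3)], rule B.lead_X[OF term_order_deg g(4)])
    fix v w d e
    assume v: "v \<in> keys (b (1,2))"
      "\<And>u. u \<in> keys (b (1,2)) \<Longrightarrow> deg_order n (wexp unit u) \<le> deg_order n (wexp unit v)"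
      "d \<noteq> 0" "lead (deg_order n) (B.X (1,2)) (wexp unit v) d"
      and w: "w \<in> keys (b (2,1))"
      "\<And>u. u \<in> keys (b (2,1)) \<Longrightarrow> deg_order n (wexp unit u) \<le> deg_order n (wexp unit w)"
      "e \<noteq> 0" "lead (deg_order n) (B.X (2,1)) (wexp unit w) e"
    note lx = lead_x[OF term_orderD(1)[OF term_order_deg]]
    have "wexp unit v + wexp unit w = unit (1,2) + unit (2,1)"
    proof (rule lead_unique)
      show "lead (deg_order n) (x (1,2) * x (2,1)) (wexp unit v + wexp unit w)
          (d * e * q powi twist n (wexp unit v) (wexp unit w))"
        unfolding XX[symmetric] by (rule lead_mult[OF ho v(4) w(4)])
      show "lead (deg_order n) (x (1,2) * x (2,1)) (unit (1,2) + unit (2,1))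
          (1 * 1 * q powi twist n (unit (1,2)) (unit (2,1)))"
        by (rule lead_mult[OF ho lx[OF g(3)] lx[OF g(4)]])
    qed (use v(3) w(3) q in simp_all)
    then have "deg n (wexp unit v + wexp unit w) = deg n (unit (1,2) + unit (2,1))" by (rule arg_cong)
    then have "deg n (wexp unit v) + deg n (wexp unit w) = 2" using g by simp
    moreover have "1 \<le> deg n (wexp unit v)" "1 \<le> deg n (wexp unit w)"
      using B.long_b'[OF g(3) v(1)] B.long_b'[OF g(4) w(1)]
        deg_wexp_unit[OF B.letters_b[OF g(3) v(1)]] deg_wexp_unit[OF B.letters_b[OF g(4) w(1)]] by linarith+
    ultimately show ?thesis
      using B.trivial_if_lead[OF g(3) v(1,2)] B.trivial_if_lead[OF g(4) w(1,2)] by simp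
  qed
  show "b p = gen p" if "p \<in> grid n" using range[OF that] b11 b22 b12 by auto
qed

theorem rigidity: "p \<in> grid n \<Longrightarrow> b p = gen p"
  using two_trivial trivial_words[of p] B.gen_if_trivial[of p]
  by (cases "n = 2") (auto simp: words_def)

end


section \<open>Endomorphisms of quantum matrices as families in the torus\<close>

context quantum_matrices
begin

abbreviation A :: "('k, ((nat \<times> nat) free_monoid \<Rightarrow>\<^sub>0 'k) set) module" where "A \<equiv> qmat q n"
abbreviation \<pi> :: "((nat \<times> nat) free_monoid \<Rightarrow>\<^sub>0 'k) \<Rightarrow> ((nat \<times> nat) free_monoid \<Rightarrow>\<^sub>0 'k) set"
  where "\<pi> \<equiv> qmat_proj q n"

lemma F_closed:
  "p \<in> carrier F \<Longrightarrow> p' \<in> carrier F \<Longrightarrow> p * p' \<in> carrier F"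
  "p \<in> carrier F \<Longrightarrow> p' \<in> carrier F \<Longrightarrow> p + p' \<in> carrier F"
  "p \<in> carrier F \<Longrightarrow> p' \<in> carrier F \<Longrightarrow> p - p' \<in> carrier F"
  "scalar c \<in> carrier F" "r \<in> grid n \<Longrightarrow> gen r \<in> carrier F" "0 \<in> carrier F" "1 \<in> carrier F"
proof -
  show "1 \<in> carrier F"
    using scalar_closed[of 1 "{1..n} \<times> {1..n}"] by (simp only: free_scalars.s_1)
  show "0 \<in> carrier F" by simp
  show "r \<in> grid n \<Longrightarrow> gen r \<in> carrier F" unfolding grid_def by (rule gen_closed)
qed (fact free_algebra_mult_closed free_algebra_add_closed free_algebra_diff_closed scalar_closed)+

lemma carrier_A: "carrier A = \<pi> ` carrier F"
  by (auto simp: qmat_def FactRing_def A_RCOSETS_def' qmat_proj_def simp del: free_algebra_simps(1))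

lemma proj_hom: "\<pi> \<in> ring_hom F (F Quot J)"
  using ideal.rcos_ring_hom[OF ideal_qmat_ideal] unfolding qmat_proj_def[abs_def] .

lemma proj_mult: "p \<in> carrier F \<Longrightarrow> p' \<in> carrier F \<Longrightarrow> \<pi> p \<otimes>\<^bsub>A\<^esub> \<pi> p' = \<pi> (p * p')"
  using ring_hom_mult[OF proj_hom, of p p'] by (simp add: qmat_def del: free_algebra_simps(1))

lemma proj_add: "p \<in> carrier F \<Longrightarrow> p' \<in> carrier F \<Longrightarrow> \<pi> p \<oplus>\<^bsub>A\<^esub> \<pi> p' = \<pi> (p + p')"
  using ring_hom_add[OF proj_hom, of p p'] by (simp add: qmat_def del: free_algebra_simps(1))

lemma proj_one: "\<one>\<^bsub>A\<^esub> = \<pi> 1"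
  using ring_hom_one[OF proj_hom] by (simp add: qmat_def)

lemma proj_zero: "\<zero>\<^bsub>A\<^esub> = \<pi> 0"
proof -
  have "\<pi> 0 = J"
    by (auto simp: qmat_proj_def a_r_coset_def')
  then show ?thesis by (simp add: qmat_def FactRing_def)
qed

lemma proj_smult: "p \<in> carrier F \<Longrightarrow> c \<odot>\<^bsub>A\<^esub> \<pi> p = \<pi> (scalar c * p)"
  by (rule qmat_smult)

lemma proj_eq_iff:
  assumes "p \<in> carrier F" "p' \<in> carrier F"
  shows "\<pi> p = \<pi> p' \<longleftrightarrow> p - p' \<in> J"
proof
  assume "\<pi> p = \<pi> p'"
  moreover have "p \<in> \<pi> p"
    using J_0 unfolding qmat_proj_def a_r_coset_def' by (auto intro!: bexI[of _ 0])
  ultimately have "p \<in> \<pi> p'" by simp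
  then show "p - p' \<in> J" by (auto simp: qmat_proj_def a_r_coset_def')
next
  assume "p - p' \<in> J"
  then have "\<exists>h\<in>J. p = h + p'" by (intro bexI[of _ "p - p'"]) auto
  then have "p \<in> \<pi> p'" by (simp add: qmat_proj_def a_r_coset_def')
  interpret ideal J F by (rule ideal_qmat_ideal)
  show "\<pi> p = \<pi> p'"
    using a_repr_independence'[OF _ assms(2), of p] \<open>p \<in> \<pi> p'\<close> by (simp only: qmat_proj_def)
qed

abbreviation \<rho> :: "((nat \<times> nat) free_monoid \<Rightarrow>\<^sub>0 'k) \<Rightarrow> 'k lin_op" where "\<rho> \<equiv> eval scal x"

lemma eval_rels:
  assumes X: "op_scalars.qmatrix q n n X" and r: "r \<in> qmat_rels q n"
  shows "eval scal X r = 0"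
  using r unfolding qmat_rels_def
  by (elim UnE CollectE exE conjE)
     (use op_scalars.qmatrixD[OF X] in \<open>auto simp: op_scalars.eval_diff op_scalars.eval_mult
        op_scalars.qcomm_def op_scalars.smul_def inverse_eq_divide\<close>)

lemma kernel_ideal: "ideal {p \<in> carrier F. \<rho> p = 0} F"
proof (rule idealI[OF ring_free_algebra])
  interpret R: ring F by (rule ring_free_algebra)
  show "subgroup {p \<in> carrier F. \<rho> p = 0} (add_monoid F)"
  proof (rule subgroup.intro)
    fix p assume p: "p \<in> {p \<in> carrier F. \<rho> p = 0}"
    have "0 - p \<in> carrier F" by (rule F_closed(3)[OF F_closed(6)]) (use p in blast)
    then have "- p \<in> carrier F" by (simp only: diff_0)
    then have "\<ominus>\<^bsub>F\<^esub> p = - p"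
      using p by (intro R.minus_equality) (auto simp del: free_algebra_simps(1))
    then have "inv\<^bsub>add_monoid F\<^esub> p = - p" by (simp add: a_inv_def)
    then show "inv\<^bsub>add_monoid F\<^esub> p \<in> {p \<in> carrier F. \<rho> p = 0}"
      using p \<open>- p \<in> carrier F\<close> by (simp add: op_scalars.eval_minus del: free_algebra_simps(1))
  next
    fix p p' assume "p \<in> {p \<in> carrier F. \<rho> p = 0}" "p' \<in> {p \<in> carrier F. \<rho> p = 0}"
    then have "p + p' \<in> {p \<in> carrier F. \<rho> p = 0}"
      using F_closed(2)[of p p'] by (simp add: op_scalars.eval_add del: free_algebra_simps(1))
    then show "p \<otimes>\<^bsub>add_monoid F\<^esub> p' \<in> {p \<in> carrier F. \<rho> p = 0}" by simp
  next
    show "{p \<in> carrier F. \<rho> p = 0} \<subseteq> carrier (add_monoid F)" by auto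
  next
    show "\<one>\<^bsub>add_monoid F\<^esub> \<in> {p \<in> carrier F. \<rho> p = 0}" by simp
  qed
next
  fix a p assume "a \<in> {p \<in> carrier F. \<rho> p = 0}" "p \<in> carrier F"
  then show "p \<otimes>\<^bsub>F\<^esub> a \<in> {p \<in> carrier F. \<rho> p = 0}" "a \<otimes>\<^bsub>F\<^esub> p \<in> {p \<in> carrier F. \<rho> p = 0}"
    using F_closed(1)[of p a] F_closed(1)[of a p]
    by (simp_all add: op_scalars.eval_mult del: free_algebra_simps(1))
qed

text \<open>The homomorphism to the torus factors through the quotient, so relations and inverses can be pushed
  forward to the torus.\<close>

lemma rho_J: "p \<in> J \<Longrightarrow> \<rho> p = 0"
proof -
  have "J \<subseteq> {p \<in> carrier F. \<rho> p = 0}"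
    unfolding qmat_ideal_def
    by (rule ring.genideal_minimal[OF ring_free_algebra kernel_ideal])
       (use qmat_rels_closed eval_rels[OF qmatrix_x] in blast)
  then show "p \<in> J \<Longrightarrow> \<rho> p = 0" by blast
qed

lemma word_val_closed:
  assumes "\<And>r. r \<in> grid n \<Longrightarrow> B r \<in> carrier F" "set (letters w) \<subseteq> grid n"
  shows "word_val B w \<in> carrier F"
proof -
  have "set ps \<subseteq> grid n \<Longrightarrow> prod_list (map B ps) \<in> carrier F" for ps
    by (induction ps) (use assms(1) F_closed(1,7) in \<open>auto simp del: free_algebra_simps(1)\<close>)
  then show ?thesis using assms(2) by (simp add: word_val_def del: free_algebra_simps(1))
qed

lemma eval_closed:
  assumes "\<And>r. r \<in> grid n \<Longrightarrow> B r \<in> carrier F" "p \<in> carrier F"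
  shows "eval scalar B p \<in> carrier F"
proof -
  have "(\<Sum>w\<in>S. scalar (c w) * word_val B w) \<in> carrier F"
    if "finite S" "\<And>w. w \<in> S \<Longrightarrow> set (letters w) \<subseteq> grid n" for S and c :: "_ \<Rightarrow> 'k"
    using that
    by (induction S) (use F_closed(1,2,4,6) word_val_closed[OF assms(1)] in
        \<open>auto simp del: free_algebra_simps(1)\<close>)
  note main = this
  show ?thesis
    unfolding eval_def by (rule main[OF finite_keys]) (use assms(2) in \<open>simp add: grid_def\<close>)
qed

end

text \<open>An algebra endomorphism of the quantum matrices, described by sorted lifts of the images of the
  generators. Both an automorphism and its inverse are treated in this way.\<close>

locale algebra_endo = quantum_matrices q n for q :: "'k::field" and n :: nat +
  fixes \<Phi> :: "((nat \<times> nat) free_monoid \<Rightarrow>\<^sub>0 'k) set \<Rightarrow> ((nat \<times> nat) free_monoid \<Rightarrow>\<^sub>0 'k) set"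
    and B :: "nat \<times> nat \<Rightarrow> ((nat \<times> nat) free_monoid \<Rightarrow>\<^sub>0 'k)"
  assumes hom: "\<Phi> \<in> ring_hom (qmat q n) (qmat q n)"
    and scal_hom: "\<And>c a. a \<in> carrier (qmat q n) \<Longrightarrow> \<Phi> (c \<odot>\<^bsub>qmat q n\<^esub> a) = c \<odot>\<^bsub>qmat q n\<^esub> \<Phi> a"
    and B_normal: "\<And>p. p \<in> grid n \<Longrightarrow> normal (B p)"
    and B_lift: "\<And>p. p \<in> grid n \<Longrightarrow> \<Phi> (qmat_proj q n (gen p)) = qmat_proj q n (B p)"
begin

lemma B_closed: "r \<in> grid n \<Longrightarrow> B r \<in> carrier F"
  by (rule normal_closed[OF B_normal])

lemma proj_carrier: "p \<in> carrier F \<Longrightarrow> \<pi> p \<in> carrier A"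
  by (simp add: carrier_A del: free_algebra_simps(1))

lemma Phi_word: "set ps \<subseteq> grid n \<Longrightarrow> \<Phi> (\<pi> (word ps)) = \<pi> (word_val B (Word ps))"
proof (induction ps)
  case Nil
  have "word [] = 1" by (simp add: word_def flip: zero_free_monoid_def)
  then show ?case using ring_hom_one[OF hom] by (simp add: proj_one word_val_def)
next
  case (Cons p ps)
  then have c: "gen p \<in> carrier F" "word ps \<in> carrier F" "B p \<in> carrier F"
    "word_val B (Word ps) \<in> carrier F" "p \<in> grid n"
    using F_closed(5)[of p] word_closed[of ps] B_closed[of p] word_val_closed[OF B_closed, where w = "Word ps"]
    by (simp_all del: free_algebra_simps(1))
  have "\<Phi> (\<pi> (word (p # ps))) = \<Phi> (\<pi> (gen p) \<otimes>\<^bsub>A\<^esub> \<pi> (word ps))"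
    by (simp only: word_Cons proj_mult[OF c(1,2)])
  also have "\<dots> = \<Phi> (\<pi> (gen p)) \<otimes>\<^bsub>A\<^esub> \<Phi> (\<pi> (word ps))"
    by (rule ring_hom_mult[OF hom proj_carrier[OF c(1)] proj_carrier[OF c(2)]])
  also have "\<dots> = \<pi> (B p) \<otimes>\<^bsub>A\<^esub> \<pi> (word_val B (Word ps))"
    using Cons by (simp add: B_lift)
  also have "\<dots> = \<pi> (word_val B (Word (p # ps)))"
    by (simp only: word_val_Word_Cons proj_mult[OF c(3,4)])
  finally show ?case .
qed

text \<open>An endomorphism acts by substituting the images of the generators.\<close>

theorem Phi_proj:
  assumes "p \<in> carrier F"
  shows "\<Phi> (\<pi> p) = \<pi> (eval scalar B p)"
proof -
  have "\<Phi> (\<pi> (\<Sum>w\<in>S. scalar (c w) * word (letters w))) = \<pi> (\<Sum>w\<in>S. scalar (c w) * word_val B w)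
     \<and> (\<Sum>w\<in>S. scalar (c w) * word (letters w)) \<in> carrier F \<and> (\<Sum>w\<in>S. scalar (c w) * word_val B w) \<in> carrier F"
    if "finite S" "\<And>w. w \<in> S \<Longrightarrow> set (letters w) \<subseteq> grid n" for S and c :: "_ \<Rightarrow> 'k"
    using that
  proof (induction S)
    case empty
    have "\<pi> 0 = \<zero>\<^bsub>A\<^esub>" by (simp add: proj_zero)
    moreover have "\<Phi> \<zero>\<^bsub>A\<^esub> = \<zero>\<^bsub>A\<^esub>" by (rule ring_hom_zero[OF hom ring_qmat ring_qmat])
    ultimately show ?case using F_closed(6) by (simp del: free_algebra_simps(1))
  next
    case (insert w S)
    let ?u = "word (letters w)" and ?v = "word_val B w"
    let ?U = "\<Sum>w\<in>S. scalar (c w) * word (letters w)" and ?V = "\<Sum>w\<in>S. scalar (c w) * word_val B w"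
    have IH: "\<Phi> (\<pi> ?U) = \<pi> ?V" "?U \<in> carrier F" "?V \<in> carrier F" using insert by auto
    have lw: "set (letters w) \<subseteq> grid n" using insert by simp
    have c: "?u \<in> carrier F" "?v \<in> carrier F"
      by (rule word_closed[OF lw], rule word_val_closed[OF B_closed lw])
    have c': "scalar (c w) * ?u \<in> carrier F" "scalar (c w) * ?v \<in> carrier F"
      by (rule F_closed(1)[OF F_closed(4)], rule c)+
    have "\<Phi> (\<pi> (scalar (c w) * ?u)) = c w \<odot>\<^bsub>A\<^esub> \<Phi> (\<pi> ?u)"
      unfolding proj_smult[OF c(1), symmetric] by (rule scal_hom[OF proj_carrier[OF c(1)]])
    also have "\<Phi> (\<pi> ?u) = \<pi> ?v" using Phi_word[OF lw] by simp
    also have "c w \<odot>\<^bsub>A\<^esub> \<pi> ?v = \<pi> (scalar (c w) * ?v)" by (rule proj_smult[OF c(2)])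
    finally have 1: "\<Phi> (\<pi> (scalar (c w) * ?u)) = \<pi> (scalar (c w) * ?v)" .
    have "\<Phi> (\<pi> (scalar (c w) * ?u + ?U)) = \<Phi> (\<pi> (scalar (c w) * ?u)) \<oplus>\<^bsub>A\<^esub> \<Phi> (\<pi> ?U)"
      unfolding proj_add[OF c'(1) IH(2), symmetric]
      by (rule ring_hom_add[OF hom proj_carrier[OF c'(1)] proj_carrier[OF IH(2)]])
    also have "\<dots> = \<pi> (scalar (c w) * ?v + ?V)"
      unfolding 1 IH(1) by (rule proj_add[OF c'(2) IH(3)])
    finally show ?case
      using insert(1,2) F_closed(2)[OF c'(1) IH(2)] F_closed(2)[OF c'(2) IH(3)]
      by (simp del: free_algebra_simps(1))
  qed
  note main = this
  have "scalar (c::'k) * word (letters w) = Poly_Mapping.single w c" for c w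
    by (simp add: word_def scalar_def mult_single)
  then have "p = (\<Sum>w\<in>keys p. scalar (lookup p w) * word (letters w))"
    by (simp add: poly_mapping_eq_sum)
  moreover have "set (letters w) \<subseteq> grid n" if "w \<in> keys p" for w
    using assms that by (simp add: grid_def)
  ultimately show ?thesis
    using main[OF finite_keys, of p "lookup p"] by (simp only: eval_def)
qed

lemma eval_image_J: "r \<in> J \<Longrightarrow> eval scal (image_family q n B) r = 0"
proof -
  assume r: "r \<in> J"
  have c: "r \<in> carrier F" "eval scalar B r \<in> carrier F"
    by (rule J_closed[OF r], rule eval_closed[OF B_closed J_closed[OF r]])
  have "\<pi> r = \<pi> 0" using proj_eq_iff[OF c(1) F_closed(6)] r by simp
  then have "\<pi> (eval scalar B r) = \<Phi> (\<pi> 0)" using Phi_proj[OF c(1)] by simp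
  also have "\<dots> = \<pi> 0" using Phi_proj[OF F_closed(6)] by simp
  finally have "eval scalar B r \<in> J" using proj_eq_iff[OF c(2) F_closed(6)] by simp
  then have "\<rho> (eval scalar B r) = 0" by (rule rho_J)
  then show ?thesis
    by (simp add: eval_eval[OF op_scalars.scalars_axioms] image_family_def[abs_def])
qed

lemma qmatrix_image_B: "op_scalars.qmatrix q n n (image_family q n B)"
  unfolding op_scalars.qmatrix_def
proof (intro conjI ballI impI)
  let ?X = "image_family q n B"
  note simps = op_scalars.eval_diff op_scalars.eval_mult op_scalars.qcomm_def op_scalars.smul_def
    inverse_eq_divide
  fix i k j assume g: "i \<in> {1..n}" "k \<in> {1..n}" "j \<in> {1..n}" "i < k"
  show "op_scalars.qcomm q (?X (i,j)) (?X (k,j))"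
    using eval_image_J[OF J_rel_col[of i j k]] g by (simp add: simps)
  fix l assume l: "l \<in> {1..n}"
  show "op_scalars.qcomm 1 (?X (i,j)) (?X (k,l))" if "l < j"
    using eval_image_J[OF J_rel_anti[of i j k l]] g l that by (simp add: simps)
  show "?X (i,j) * ?X (k,l) - ?X (k,l) * ?X (i,j) = op_scalars.smul (q - 1/q) (?X (i,l) * ?X (k,j))"
    if "j < l"
    using eval_image_J[OF J_rel_diag[of i j k l]] g l that by (simp add: simps)
next
  let ?X = "image_family q n B"
  fix i j l assume g: "i \<in> {1..n}" "j \<in> {1..n}" "l \<in> {1..n}" "j < l"
  then show "op_scalars.qcomm q (?X (i,j)) (?X (i,l))"
    using eval_image_J[OF J_rel_row[of i j l]]
    by (simp add: op_scalars.eval_diff op_scalars.eval_mult op_scalars.qcomm_def op_scalars.smul_def)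
qed

end

section \<open>Unipotent automorphisms\<close>

context quantum_matrices
begin

lemma rho_deg_ge:
  assumes "\<And>w. w \<in> keys P \<Longrightarrow> set (letters w) \<subseteq> grid n \<and> d \<le> int (word_length w)"
  shows "\<rho> P \<in> mspan (\<lambda>a. d \<le> deg n a)"
  unfolding eval_def
proof (intro mspan_sum mspan_scal)
  fix w assume "w \<in> keys P"
  then show "word_val x w \<in> mspan (\<lambda>a. d \<le> deg n a)"
    using assms[of w] by (intro mspan_mono[OF word_val_x_deg_ge]) auto
qed

text \<open>The part of \<open>P\<close> in words shorter than \<open>d\<close> has a leading monomial of degree below \<open>d\<close>, as leading exponents of
  standard words are distinct.\<close>

lemma low_degree:
  assumes P: "normal P" and "\<rho> P \<in> mspan (\<lambda>a. d \<le> deg n a)"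
    and w: "w \<in> keys P"
  shows "d \<le> int (word_length w)"
proof (rule ccontr)
  assume short: "\<not> ?thesis"
  define L where "L = {w \<in> keys P. int (word_length w) < d}"
  define Q where "Q = (\<Sum>w\<in>L. Poly_Mapping.single w (lookup P w))"
  have L: "finite L" "L \<subseteq> keys P" "w \<in> L" using w short by (auto simp: L_def)
  have keysQ: "keys Q \<subseteq> L"
    unfolding Q_def using keys_sum[of "\<lambda>w. Poly_Mapping.single w (lookup P w)" L]
    by (auto split: if_splits)
  have "lookup Q w = lookup P w"
    using L by (simp add: Q_def lookup_sum lookup_single when_def)
  then have "Q \<noteq> 0" using w by (auto simp: in_keys_iff)
  have std: "standard n v" if "v \<in> keys P" for v using P that by (simp add: normal_def)
  have letters: "set (letters v) \<subseteq> grid n" if "v \<in> keys P" for v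
    using std[OF that] by (simp add: standard_def)
  have "\<rho> P = \<rho> Q + (\<Sum>v\<in>keys P - L. scal (lookup P v) * word_val x v)"
    unfolding eval_def[of scal x P] Q_def op_scalars.eval_sum op_scalars.eval_single
    using sum.subset_diff[OF L(2) finite_keys] by (simp add: add.commute)
  moreover have "(\<Sum>v\<in>keys P - L. scal (lookup P v) * word_val x v)
      \<in> mspan (\<lambda>a. d \<le> deg n a)"
    using letters by (intro mspan_sum mspan_scal mspan_mono[OF word_val_x_deg_ge]) (auto simp: L_def)
  ultimately have Qd: "\<rho> Q \<in> mspan (\<lambda>a. d \<le> deg n a)"
    using mspan_diff[OF assms(2), of "\<Sum>v\<in>keys P - L. scal (lookup P v) * word_val x v"]
    by simp
  define h where "h = deg_order n"
  have h: "term_order n h" unfolding h_def by (rule term_order_deg)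
  have inj: "inj_on (\<lambda>w. h (wexp unit w)) (keys Q)"
    using std keysQ L(2) by (intro inj_on_standard[OF h]) blast
  have X: "\<And>r. r \<in> grid n \<Longrightarrow> \<exists>c. c \<noteq> 0 \<and> lead h (x r) (unit r) c"
    using lead_x[OF term_orderD(1)[OF h]] by (intro exI[of _ 1]) simp
  have lQ: "\<And>v. v \<in> keys Q \<Longrightarrow> set (letters v) \<subseteq> grid n" using letters keysQ L by blast
  show False
  proof (rule lead_eval[OF term_orderD(2)[OF h] X \<open>Q \<noteq> 0\<close> lQ inj])
    fix v c assume v: "v \<in> keys Q" "c \<noteq> 0" "lead h (\<rho> Q) (wexp unit v) c"
    then have "coef (\<rho> Q) (wexp unit v) \<noteq> 0" by (simp add: lead_coef)
    then have "d \<le> deg n (wexp unit v)" by (rule coef_mspan(1)[OF Qd])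
    then show False using deg_wexp_unit[OF lQ[OF v(1)]] v(1) keysQ by (auto simp: L_def)
  qed
qed

lemma normal_minus_gen: "normal P \<Longrightarrow> p \<in> grid n \<Longrightarrow> normal (P - gen p)"
  using keys_diff[of P "gen p"] by (fastforce simp: normal_def gen_def split: if_splits)

lemma long_minus_gen:
  assumes "\<And>w. w \<in> keys (P - gen p) \<Longrightarrow> 2 \<le> int (word_length w)"
  shows "lookup P (Word [p]) = (1 :: 'k)"
    and "w \<in> keys P \<Longrightarrow> w \<noteq> Word [p] \<Longrightarrow> 2 \<le> word_length w"
proof -
  have eq: "lookup (P - gen p) v = lookup P v - (if v = Word [p] then 1 else 0)" for v
    by (simp add: lookup_minus gen_def lookup_single when_def)
  have "Word [p] \<notin> keys (P - gen p)" using assms[of "Word [p]"] by auto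
  then show "lookup P (Word [p]) = 1" using eq[of "Word [p]"] by (simp add: in_keys_iff)
  show "2 \<le> word_length w" if "w \<in> keys P" "w \<noteq> Word [p]"
    using assms[of w] eq[of w] that by (simp add: in_keys_iff)
qed

text \<open>Substituting \<open>X\<close> for the generators changes a word only in higher degrees. So the shortest words of \<open>P - gen p\<close>
  survive the substitution, but the result \<open>x p - X p\<close> starts in degree two.\<close>

lemma inverse_unipotent:
  assumes X: "\<And>r. r \<in> grid n \<Longrightarrow> X r - x r \<in> mspan (\<lambda>a. 2 \<le> deg n a)"
    and P: "normal P" and p: "p \<in> grid n" and eval: "eval scal X P = x p"
    and w: "w \<in> keys (P - gen p)"
  shows "2 \<le> int (word_length w)"
proof (rule ccontr)
  assume short: "\<not> ?thesis"
  let ?R = "P - gen p"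
  have R: "normal ?R" using P p by (rule normal_minus_gen)
  have letters: "set (letters v) \<subseteq> grid n" if "v \<in> keys ?R" for v
    using R that by (auto simp: normal_def standard_def)
  obtain v where v: "v \<in> keys ?R"
    "\<And>u. u \<in> keys ?R \<Longrightarrow> - int (word_length u) \<le> - int (word_length v)"
  proof -
    have "keys ?R \<noteq> {}" using w by blast
    then show ?thesis
      by (rule finite_max_image[OF finite_keys, where f = "\<lambda>u. - int (word_length u)"]) (rule that)
  qed
  let ?d = "int (word_length v)"
  have word: "set ps \<subseteq> grid n \<Longrightarrow> prod_list (map X ps) \<in> mspan (\<lambda>a. int (length ps) \<le> deg n a) \<and>
      prod_list (map X ps) - prod_list (map x ps) \<in> mspan (\<lambda>a. int (length ps) + 1 \<le> deg n a)" for ps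
  proof (induction ps)
    case Nil
    then show ?case
      using mspan_M1[OF supported_simps(1), of "\<lambda>a. 0 \<le> deg n a"] by (simp add: mspan.zero)
  next
    case (Cons r ps)
    let ?A = "prod_list (map X ps)" and ?B = "prod_list (map x ps)"
    have r: "r \<in> grid n" and IH: "?A \<in> mspan (\<lambda>a. int (length ps) \<le> deg n a)"
      "?A - ?B \<in> mspan (\<lambda>a. int (length ps) + 1 \<le> deg n a)" using Cons by auto
    have "x r + (X r - x r) \<in> mspan (\<lambda>a. 1 \<le> deg n a)"
      by (rule mspan_add; rule mspan_mono[OF x_deg[OF r]] mspan_mono[OF X[OF r]]) simp_all
    then have "X r \<in> mspan (\<lambda>a. 1 \<le> deg n a)" by simp
    from this IH(1) have 1: "X r * ?A \<in> mspan (\<lambda>a. int (length (r # ps)) \<le> deg n a)"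
      by (rule mspan_mult) simp
    have "(X r - x r) * ?A \<in> mspan (\<lambda>a. int (length (r # ps)) + 1 \<le> deg n a)"
      by (rule mspan_mult[OF X[OF r] IH(1)]) simp
    moreover have "x r * (?A - ?B) \<in> mspan (\<lambda>a. int (length (r # ps)) + 1 \<le> deg n a)"
      by (rule mspan_mult[OF x_deg[OF r] IH(2)]) simp
    ultimately have "(X r - x r) * ?A + x r * (?A - ?B) \<in> mspan (\<lambda>a. int (length (r # ps)) + 1 \<le> deg n a)"
      by (rule mspan_add)
    also have "(X r - x r) * ?A + x r * (?A - ?B) = X r * ?A - x r * ?B" by (simp add: algebra_simps)
    finally show ?case using 1 by simp
  qed
  have "eval scal X ?R - \<rho> ?R
      = (\<Sum>u\<in>keys ?R. scal (lookup ?R u) * (word_val X u - word_val x u))"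
    by (simp add: eval_def right_diff_distrib sum_subtractf)
  also have "\<dots> \<in> mspan (\<lambda>a. ?d + 1 \<le> deg n a)"
  proof (intro mspan_sum mspan_scal)
    fix u assume u: "u \<in> keys ?R"
    then have "word_val X u - word_val x u \<in> mspan (\<lambda>a. int (word_length u) + 1 \<le> deg n a)"
      using word[OF letters[OF u]] by (simp add: word_val_def)
    then show "word_val X u - word_val x u \<in> mspan (\<lambda>a. ?d + 1 \<le> deg n a)"
      by (rule mspan_mono) (use v(2)[OF u] in simp)
  qed
  finally have 1: "eval scal X ?R - \<rho> ?R \<in> mspan (\<lambda>a. ?d + 1 \<le> deg n a)" .
  have "eval scal X ?R = - (X p - x p)" by (simp add: op_scalars.eval_diff eval)
  then have "eval scal X ?R \<in> mspan (\<lambda>a. 2 \<le> deg n a)" using mspan_minus[OF X[OF p]] by simp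
  then have "eval scal X ?R \<in> mspan (\<lambda>a. ?d + 1 \<le> deg n a)"
    by (rule mspan_mono) (use short v(2)[OF w] in simp)
  from mspan_diff[OF this 1] have "\<rho> ?R \<in> mspan (\<lambda>a. ?d + 1 \<le> deg n a)" by simp
  from low_degree[OF R this v(1)] show False by simp
qed

text \<open>Homogeneous lifts of the summands add up to a lift of the sum.\<close>

lemma qmat_ge_lift:
  assumes "a \<in> qmat_ge q n m"
  shows "\<exists>S\<in>carrier F. a = \<pi> S \<and> \<rho> S \<in> mspan (\<lambda>a. int m \<le> deg n a)"
proof -
  interpret A: ring A by (rule ring_qmat)
  from assms obtain D f where D: "a = (\<Oplus>\<^bsub>A\<^esub>d\<in>D. f d)" "finite D" "D \<subseteq> {m..}"
    and f: "\<And>d. d \<in> D \<Longrightarrow> f d \<in> qmat_component q n d"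
    unfolding qmat_ge_def by blast
  have lift: "\<exists>S\<in>carrier F. f d = \<pi> S \<and> \<rho> S \<in> mspan (\<lambda>a. int m \<le> deg n a)" if d: "d \<in> D" for d
  proof -
    obtain S where S: "S \<in> carrier F" "\<forall>w\<in>keys S. word_length w = d" "f d = \<pi> S"
      using f[OF d] unfolding qmat_component_def by blast
    moreover have "\<rho> S \<in> mspan (\<lambda>a. int m \<le> deg n a)"
      by (rule rho_deg_ge) (use S D(3) d in \<open>auto simp: grid_def\<close>)
    ultimately show ?thesis by blast
  qed
  have "\<exists>S\<in>carrier F. (\<Oplus>\<^bsub>A\<^esub>d\<in>D'. f d) = \<pi> S \<and> \<rho> S \<in> mspan (\<lambda>a. int m \<le> deg n a)"
    if "finite D'" "D' \<subseteq> D" for D'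
    using that
  proof (induction D')
    case empty
    have "(\<Oplus>\<^bsub>A\<^esub>d\<in>{}. f d) = \<pi> 0" by (simp add: proj_zero)
    then show ?case using F_closed(6) mspan.zero op_scalars.eval_0 by (intro bexI[of _ 0]) simp_all
  next
    case (insert d D')
    then obtain S where S: "S \<in> carrier F" "(\<Oplus>\<^bsub>A\<^esub>d\<in>D'. f d) = \<pi> S" "\<rho> S \<in> mspan (\<lambda>a. int m \<le> deg n a)"
      by blast
    obtain S' where S': "S' \<in> carrier F" "f d = \<pi> S'" "\<rho> S' \<in> mspan (\<lambda>a. int m \<le> deg n a)"
      using lift[of d] insert by blast
    have fc: "f d \<in> carrier A" if "d \<in> D" for d
      using lift[OF that] unfolding carrier_A by blast
    have "(\<Oplus>\<^bsub>A\<^esub>d\<in>insert d D'. f d) = f d \<oplus>\<^bsub>A\<^esub> (\<Oplus>\<^bsub>A\<^esub>d\<in>D'. f d)"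
      using insert fc by (intro A.finsum_insert) auto
    also have "\<dots> = \<pi> (S' + S)" unfolding S(2) S'(2) by (rule proj_add[OF S'(1) S(1)])
    finally show ?case
      using F_closed(2)[OF S'(1) S(1)] mspan_add[OF S'(3) S(3)]
      by (intro bexI[of _ "S' + S"]) (simp_all only: op_scalars.eval_add)
  qed
  from this[OF D(2) subset_refl] show ?thesis by (simp only: D(1))
qed

lemma unipotent_image:
  assumes p: "p \<in> grid n" and B: "B \<in> carrier F"
    and ge: "\<pi> B \<ominus>\<^bsub>A\<^esub> \<pi> (gen p) \<in> qmat_ge q n 2"
  shows "\<rho> B - x p \<in> mspan (\<lambda>a. 2 \<le> deg n a)"
proof -
  interpret A: ring A by (rule ring_qmat)
  obtain S where S: "S \<in> carrier F" "\<pi> B \<ominus>\<^bsub>A\<^esub> \<pi> (gen p) = \<pi> S"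
    "\<rho> S \<in> mspan (\<lambda>a. int 2 \<le> deg n a)"
    using qmat_ge_lift[OF ge] by blast
  have c: "\<pi> B \<in> carrier A" "\<pi> (gen p) \<in> carrier A" unfolding carrier_A using B F_closed(5)[OF p] by blast+
  have "\<pi> B = (\<pi> B \<ominus>\<^bsub>A\<^esub> \<pi> (gen p)) \<oplus>\<^bsub>A\<^esub> \<pi> (gen p)"
    using c by (simp add: A.minus_eq A.a_assoc A.l_neg)
  also have "\<dots> = \<pi> (S + gen p)" unfolding S(2) by (rule proj_add[OF S(1) F_closed(5)[OF p]])
  finally have "B - (S + gen p) \<in> J"
    using proj_eq_iff[OF B F_closed(2)[OF S(1) F_closed(5)[OF p]]] by simp
  then have "\<rho> (B - (S + gen p)) = 0" by (rule rho_J)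
  then have "\<rho> B - x p = \<rho> S" by (simp add: op_scalars.eval_diff op_scalars.eval_add algebra_simps)
  then show ?thesis using S(3) by simp
qed

lemma lifts_exist:
  assumes "\<And>p. p \<in> grid n \<Longrightarrow> f p \<in> carrier A"
  shows "\<exists>B. \<forall>p\<in>grid n. normal (B p) \<and> f p = \<pi> (B p)"
proof -
  have "\<exists>P. normal P \<and> f p = \<pi> P" if p: "p \<in> grid n" for p
  proof -
    obtain u where u: "u \<in> carrier F" "f p = \<pi> u" using assms[OF p] unfolding carrier_A by blast
    obtain P where P: "normal P" "u - P \<in> J" using straighten[OF u(1)] by blast
    then show ?thesis using u proj_eq_iff[OF u(1) normal_closed[OF P(1)]] by auto
  qed
  then show ?thesis by (intro bchoice) blast
qed

lemma eval_gen_id: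
  assumes "\<And>r. r \<in> grid n \<Longrightarrow> B r = gen r" "p \<in> carrier F"
  shows "eval scalar B p = p"
proof -
  have w: "word_val B w = Poly_Mapping.single w 1" if "set (letters w) \<subseteq> grid n" for w
  proof -
    have "set ps \<subseteq> grid n \<Longrightarrow> prod_list (map B ps) = word ps" for ps
      by (induction ps) (auto simp: word_Cons assms(1), simp add: word_def flip: zero_free_monoid_def)
    then show ?thesis using that by (cases w) (simp add: word_val_def word_def)
  qed
  have "eval scalar B p = (\<Sum>v\<in>keys p. Poly_Mapping.single v (lookup p v))"
    unfolding eval_def
    by (intro sum.cong refl) (use assms(2) in \<open>simp add: w grid_def scalar_def mult_single\<close>)
  also have "\<dots> = p" by (rule poly_mapping_eq_sum)
  finally show ?thesis .
qed

theorem unipotent_automorphism_trivial: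
  assumes \<Phi>: "unipotent_automorphism q n \<Phi>" and a: "a \<in> carrier A"
  shows "\<Phi> a = a"
proof -
  have iso: "\<Phi> \<in> ring_iso A A"
    and sc: "\<And>c a. a \<in> carrier A \<Longrightarrow> \<Phi> (c \<odot>\<^bsub>A\<^esub> a) = c \<odot>\<^bsub>A\<^esub> \<Phi> a"
    and uni: "\<And>k l. k \<in> {1..n} \<Longrightarrow> l \<in> {1..n} \<Longrightarrow> \<Phi> (qmat_gen q n k l) \<ominus>\<^bsub>A\<^esub> qmat_gen q n k l \<in> qmat_ge q n 2"
    using \<Phi> by (auto simp: unipotent_automorphism_def algebra_automorphism_def)
  define \<Psi> where "\<Psi> = inv_into (carrier A) \<Phi>"
  have hom: "\<Phi> \<in> ring_hom A A" and bij: "bij_betw \<Phi> (carrier A) (carrier A)"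
    using iso by (auto simp: ring_iso_def)
  have "\<Psi> \<in> ring_iso A A" unfolding \<Psi>_def by (rule ring_iso_set_sym[OF ring_qmat iso])
  then have hom': "\<Psi> \<in> ring_hom A A" by (simp add: ring_iso_def)
  have \<Phi>c: "\<Phi> z \<in> carrier A" if "z \<in> carrier A" for z using bij that by (auto simp: bij_betw_def)
  have \<Psi>c: "\<Psi> z \<in> carrier A" if "z \<in> carrier A" for z
    using bij_betw_inv_into[OF bij] that by (auto simp: \<Psi>_def bij_betw_def)
  have \<Phi>\<Psi>: "\<Phi> (\<Psi> z) = z" and \<Psi>\<Phi>: "\<Psi> (\<Phi> z) = z" if "z \<in> carrier A" for z
    using bij_betw_inv_into_right[OF bij that] bij_betw_inv_into_left[OF bij that] by (simp_all add: \<Psi>_def)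
  have smult_closed: "c \<odot>\<^bsub>A\<^esub> z \<in> carrier A" if z: "z \<in> carrier A" for c z
  proof -
    obtain p where "p \<in> carrier F" "z = \<pi> p" using z unfolding carrier_A by blast
    then show ?thesis using F_closed(1)[OF F_closed(4)] proj_smult unfolding carrier_A by blast
  qed
  have sc': "\<Psi> (c \<odot>\<^bsub>A\<^esub> z) = c \<odot>\<^bsub>A\<^esub> \<Psi> z" if "z \<in> carrier A" for c z
    using sc[OF \<Psi>c[OF that], of c] \<Psi>\<Phi>[OF smult_closed[OF \<Psi>c[OF that]], of c] \<Phi>\<Psi>[OF that] by simp
  have gc: "\<pi> (gen p) \<in> carrier A" if "p \<in> grid n" for p
    unfolding carrier_A using F_closed(5)[OF that] by blast
  obtain B where B: "\<And>p. p \<in> grid n \<Longrightarrow> normal (B p)" "\<And>p. p \<in> grid n \<Longrightarrow> \<Phi> (\<pi> (gen p)) = \<pi> (B p)"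
    using lifts_exist[of "\<lambda>p. \<Phi> (\<pi> (gen p))"] \<Phi>c gc by blast
  obtain C where C: "\<And>p. p \<in> grid n \<Longrightarrow> normal (C p)" "\<And>p. p \<in> grid n \<Longrightarrow> \<Psi> (\<pi> (gen p)) = \<pi> (C p)"
    using lifts_exist[of "\<lambda>p. \<Psi> (\<pi> (gen p))"] \<Psi>c gc by blast
  interpret B: algebra_endo q n \<Phi> B by unfold_locales (fact hom sc B)+
  interpret C: algebra_endo q n \<Psi> C by unfold_locales (fact hom' sc' C)+
  let ?X = "image_family q n B" and ?Y = "image_family q n C"
  have cancel: "eval scal (image_family q n B1) B2 = x p"
    if "B2 \<in> carrier F" "eval scalar B1 B2 \<in> carrier F" "\<pi> (eval scalar B1 B2) = \<pi> (gen p)" "p \<in> grid n"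
    for B1 B2 p
  proof -
    have "eval scalar B1 B2 - gen p \<in> J"
      using proj_eq_iff[OF that(2) F_closed(5)[OF that(4)]] that(3) by simp
    from rho_J[OF this] show ?thesis
      by (simp add: op_scalars.eval_diff eval_eval[OF op_scalars.scalars_axioms] image_family_def[abs_def])
  qed
  have XC: "eval scal ?X (C p) = x p" if p: "p \<in> grid n" for p
  proof (rule cancel[OF C.B_closed[OF p] eval_closed[OF B.B_closed C.B_closed[OF p]] _ p])
    show "\<pi> (eval scalar B (C p)) = \<pi> (gen p)"
      using B.Phi_proj[OF C.B_closed[OF p]] C(2)[OF p] \<Phi>\<Psi>[OF gc[OF p]] by simp
  qed
  have YB: "eval scal ?Y (B p) = x p" if p: "p \<in> grid n" for p
  proof (rule cancel[OF B.B_closed[OF p] eval_closed[OF C.B_closed B.B_closed[OF p]] _ p])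
    show "\<pi> (eval scalar C (B p)) = \<pi> (gen p)"
      using C.Phi_proj[OF B.B_closed[OF p]] B(2)[OF p] \<Psi>\<Phi>[OF gc[OF p]] by simp
  qed
  have X2: "?X p - x p \<in> mspan (\<lambda>a. 2 \<le> deg n a)" if p: "p \<in> grid n" for p
    unfolding image_family_def
  proof (rule unipotent_image[OF p B.B_closed[OF p]])
    obtain k l where kl: "p = (k,l)" by (cases p)
    then show "\<pi> (B p) \<ominus>\<^bsub>A\<^esub> \<pi> (gen p) \<in> qmat_ge q n 2"
      using uni[of k l] p B(2)[OF p] by (simp add: qmat_gen_def grid_def)
  qed
  have longB: "2 \<le> int (word_length w)" if "p \<in> grid n" "w \<in> keys (B p - gen p)" for p w
  proof (rule low_degree[OF normal_minus_gen[OF B(1)[OF that(1)] that(1)] _ that(2)])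
    show "\<rho> (B p - gen p) \<in> mspan (\<lambda>a. 2 \<le> deg n a)"
      using X2[OF that(1)] by (simp add: op_scalars.eval_diff image_family_def)
  qed
  have longC: "2 \<le> int (word_length w)" if "p \<in> grid n" "w \<in> keys (C p - gen p)" for p w
    by (rule inverse_unipotent[OF X2 C(1)[OF that(1)] that(1) XC[OF that(1)] that(2)])
  interpret unipotent_pair q n B C
  proof unfold_locales
    fix p assume p: "p \<in> grid n"
    show "normal (B p)" "normal (C p)" by (fact B(1)[OF p] C(1)[OF p])+
    show "lookup (B p) (Word [p]) = 1" "lookup (C p) (Word [p]) = 1"
      by (rule long_minus_gen(1)[OF longB[OF p]], assumption, rule long_minus_gen(1)[OF longC[OF p]])
    show "eval scal ?X (C p) = x p" "eval scal ?Y (B p) = x p" by (fact XC[OF p] YB[OF p])+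
    fix w assume "w \<noteq> Word [p]"
    then show "w \<in> keys (B p) \<Longrightarrow> 2 \<le> word_length w"
      "w \<in> keys (C p) \<Longrightarrow> 2 \<le> word_length w"
      using long_minus_gen(2)[OF longB[OF p]] long_minus_gen(2)[OF longC[OF p]] by blast+
  qed (fact B.qmatrix_image_B C.qmatrix_image_B)+
  obtain p where p: "p \<in> carrier F" "a = \<pi> p" using a unfolding carrier_A by blast
  then show ?thesis using B.Phi_proj[OF p(1)] eval_gen_id[OF rigidity p(1)] by simp
qed

end

theorem theorem3p1:
  fixes q :: "'k::field" and n :: nat
    and \<Phi> :: "((nat \<times> nat) free_monoid \<Rightarrow>\<^sub>0 'k) set \<Rightarrow> ((nat \<times> nat) free_monoid \<Rightarrow>\<^sub>0 'k) set"
  assumes "q \<noteq> 0" and "\<And>m::nat. m > 0 \<Longrightarrow> q ^ m \<noteq> 1" and "n \<ge> 1"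
    and "unipotent_automorphism q n \<Phi>"
  shows "\<forall>a \<in> carrier (qmat q n). \<Phi> a = a"
proof -
  interpret quantum_matrices q n
    by unfold_locales (use assms in auto)
  show ?thesis using unipotent_automorphism_trivial[OF assms(4)] by blast
qed

end
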